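(* Let $k\ge1$, and suppose that the estimators $\hat{\boldsymbol{\mu}}^{(n)}$ of $\boldsymbol{\mu}$, $\hat{\boldsymbol{\Sigma}}^{(n)}$ of $\boldsymbol{\Sigma}$ and $\hat\nu^{(n)}$ of $\nu$ are root-$n$ consistent and locally and asymptotically discrete. Let $$\hat\nu^{(n)}_{Cam}=\hat\nu^{(n)}+n^{-1/2}\left(\Gamma^*_{33}(\hat{\boldsymbol{\mu}}^{(n)},\hat{\boldsymbol{\Sigma}}^{(n)},\hat\nu^{(n)})\right)^{-1}\Delta_3^{(n)*}(\hat{\boldsymbol{\mu}}^{(n)},\hat{\boldsymbol{\Sigma}}^{(n)},\hat\nu^{(n)})$$ be the associated one-step estimator. Then, for every $\boldsymbol{\mathcal V}=(\boldsymbol{\mu},\boldsymbol{\Sigma},\nu)\in\mathbb{R}^k\times S_k\times(0,\infty)$, under $\mathrm P^{(n)}_{\boldsymbol{\mathcal V}}$, $$n^{1/2}(\hat\nu^{(n)}_{Cam}-\nu)\stackrel{\mathcal L}{\longrightarrow}\mathcal N\left(0,(\Gamma^*_{33}(\boldsymbol{\mathcal V}))^{-1}\right)$$ as $n\to\infty$. Moreover, $\hat\nu^{(n)}_{Cam}$ is the most (asymptotically) efficient estimator of $\nu$ under $\bigcup_{\boldsymbol{\mu}\in\mathbb{R}^k}\bigcup_{\boldsymbol{\Sigma}\in S_k}\bigcup_{\nu>0}\mathrm P^{(n)}_{(\boldsymbol{\mu},\boldsymbol{\Sigma},\nu)}$.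
   Context: $M_k$ is the set of real $k\times k$ matrices and $S_k\subset M_k$ the set of symmetric positive definite ones. For $\boldsymbol{\mathcal V}=(\boldsymbol{\mu},\boldsymbol{\Sigma},\nu)\in\mathbb{R}^k\times S_k\times(0,\infty)$, the $k$-dimensional Student $t$ density is $$f_{\boldsymbol{\mu},\boldsymbol{\Sigma},\nu}(\boldsymbol x)=c_{\nu,k}|\boldsymbol{\Sigma}|^{-1/2}\left(1+\|\boldsymbol{\Sigma}^{-1/2}(\boldsymbol x-\boldsymbol{\mu})\|^2/\nu\right)^{-\frac{\nu+k}{2}},\qquad c_{\nu,k}=\frac{\Gamma(\frac{\nu+k}{2})}{(\pi\nu)^{k/2}\Gamma(\frac{\nu}{2})}.$$ $\mathrm P^{(n)}_{\boldsymbol{\mathcal V}}$ is the joint distribution of $n$ i.i.d. random vectors $\boldsymbol X_1,\dots,\boldsymbol X_n$ with density $f_{\boldsymbol{\mu},\boldsymbol{\Sigma},\nu}$. For $\boldsymbol A\in M_k$, $\mathrm{vech}(\boldsymbol A)$ is the $k(k+1)/2$-vector formed by the entries of $\boldsymbol A$ on and above the diagonal (in the order in which they appear when stacking columns). A symmetric matrix is identified with its vech, which serves as free coordinates. The score vector $\boldsymbol{\mathcal L}_{\boldsymbol{\mathcal V}}(\boldsymbol x)$ has three blocks: $\boldsymbol{\mathcal L}^{(1)}_{\boldsymbol{\mathcal V}}=\nabla_{\boldsymbol{\mu}}\log f_{\boldsymbol{\mu},\boldsymbol{\Sigma},\nu}$, $\boldsymbol{\mathcal L}^{(2)}_{\boldsymbol{\mathcal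 V}}=\nabla_{\mathrm{vech}(\boldsymbol{\Sigma})}\log f_{\boldsymbol{\mu},\boldsymbol{\Sigma},\nu}$, $\mathcal L^{(3)}_{\boldsymbol{\mathcal V}}=\partial_\nu\log f_{\boldsymbol{\mu},\boldsymbol{\Sigma},\nu}$. Put $\boldsymbol{\Delta}^{(n)}_i(\boldsymbol{\mathcal V})=n^{-1/2}\sum_{j=1}^n\boldsymbol{\mathcal L}^{(i)}_{\boldsymbol{\mathcal V}}(\boldsymbol X_j)$, $i=1,2,3$. The Fisher information matrix $\boldsymbol{\Gamma}(\boldsymbol{\mathcal V})$ is the covariance matrix of $\boldsymbol{\mathcal L}_{\boldsymbol{\mathcal V}}(\boldsymbol X)$ when $\boldsymbol X$ has density $f_{\boldsymbol{\mu},\boldsymbol{\Sigma},\nu}$, with blocks $\boldsymbol{\Gamma}_{ij}(\boldsymbol{\mathcal V})$, $i,j\in\{1,2,3\}$ (here $\boldsymbol{\Gamma}_{12}=\boldsymbol 0$, $\boldsymbol{\Gamma}_{13}=\boldsymbol 0$, and $\Gamma_{33}$ depends on $\nu$ only); it is known to be finite and non-singular for every $\boldsymbol{\mathcal V}$. The efficient central sequence and efficient Fisher information for tail weight are $$\Delta_3^{(n)*}(\boldsymbol{\mathcal V})=\Delta_3^{(n)}(\boldsymbol{\mathcal V})-(\boldsymbol{\Gamma}_{23}(\boldsymbol{\mathcal V}))'(\boldsymbol{\Gamma}_{22}(\boldsymbol{\mathcal V}))^{-1}\boldsymbol{\Delta}^{(n)}_2(\boldsymbol{\mathcal V}),\qquad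 \Gamma_{33}^*(\boldsymbol{\mathcal V})=\Gamma_{33}(\nu)-(\boldsymbol{\Gamma}_{23}(\boldsymbol{\mathcal V}))'(\boldsymbol{\Gamma}_{22}(\boldsymbol{\mathcal V}))^{-1}\boldsymbol{\Gamma}_{23}(\boldsymbol{\mathcal V}).$$ Conditions on estimators (measurable functions of $\boldsymbol X_1,\dots,\boldsymbol X_n$ with values in $\mathbb{R}^k$, $S_k$, $(0,\infty)$ respectively). For experiments $\{\mathrm P^{(n)}_\lambda\mid\lambda\in\Lambda\}$, here $\lambda=\boldsymbol{\mathcal V}$ and $\Lambda=\mathbb{R}^k\times S_k\times(0,\infty)$, a sequence of estimators $\hat\lambda^{(n)}$ of $\lambda$ (or of a component of it) is root-$n$ consistent if $n^{1/2}(\hat\lambda^{(n)}-\lambda)=O_{\mathrm P}(1)$ under $\mathrm P^{(n)}_\lambda$ for all $\lambda\in\Lambda$. It is locally and asymptotically discrete if, for every $\lambda\in\Lambda$ and $c>0$, the number of possible values of $\hat\lambda^{(n)}$ in the $\lambda$-centered ball of radius $cn^{-1/2}$ is bounded uniformly in $n$ as $n\to\infty$. Efficiency. "Most efficient" means that, at every $\boldsymbol{\mathcal V}$, the asymptotic variance equals the inverse $(\Gamma_{33}^*(\boldsymbol{\mathcal V}))^{-1}$ of the efficient Fisher information for $\nu$ (with $\boldsymbol{\mu},\boldsymbol{\Sigma}$ unknown), which is the smallest possible asymptotic variance among regular estimators of $\nu$. An estimator sequence $T^{(n)}$ of $\nu$ is regular at $\boldsymbol{\mathcal V}$ if, for all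 fixed $\boldsymbol t_1\in\mathbb{R}^k$, symmetric $\boldsymbol t_2\in M_k$, $t_3\in\mathbb{R}$, the law of $n^{1/2}(T^{(n)}-\nu-n^{-1/2}t_3)$ under $\mathrm P^{(n)}_{(\boldsymbol{\mu}+n^{-1/2}\boldsymbol t_1,\boldsymbol{\Sigma}+n^{-1/2}\boldsymbol t_2,\nu+n^{-1/2}t_3)}$ converges weakly to a limit not depending on $(\boldsymbol t_1,\boldsymbol t_2,t_3)$. *)

theory Defs
  imports "HOL-Probability.Probability"
begin

type_synonym 'k rvec = "(real, 'k) vec"
type_synonym 'k rmat = "((real, 'k) vec, 'k) vec"

section \<open>Symmetric matrices and their free coordinates\<close>

definition pos_def :: "('k::finite) rmat \<Rightarrow> bool"
  where "pos_def A \<longleftrightarrow> transpose A = A \<and> (\<forall>x. x \<noteq> 0 \<longrightarrow> 0 < x \<bullet> (A *v x))"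

text \<open>\<open>A\<^sup>-\<^sup>1\<^sup>/\<^sup>2\<close>: the symmetric positive definite square root of the inverse.\<close>

definition inv_sqrt :: "('k::finite) rmat \<Rightarrow> 'k rmat"
  where "inv_sqrt A = (THE B. pos_def B \<and> B ** B = matrix_inv A)"

text \<open>Positions (row, column) on and above the diagonal. A vector indexed by this type has
  \<open>k(k+1)/2\<close> components; these are labelled by their positions rather than by the numbers
  obtained by listing them column by column. All quantities below in which the labels are summed
  out do not depend on the order of listing.\<close>

typedef (overloaded) 'k vech_index = "{(i, j). (i::'k::linorder) \<le> j}"
  by auto

instance vech_index :: ("{finite,linorder}") finite
proof
  have "inj (Rep_vech_index :: 'a vech_index \<Rightarrow> 'a \<times> 'a)"
    by (simp add: inj_def Rep_vech_index_inject)
  then show "finite (UNIV :: 'a vech_index set)"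
    by (rule inj_on_finite[where B = UNIV]) simp_all
qed

definition vech :: "('k::{finite,linorder}) rmat \<Rightarrow> real^('k vech_index)"
  where "vech A = (\<chi> p. case Rep_vech_index p of (i, j) \<Rightarrow> A $ i $ j)"

definition unvech :: "real^('k vech_index) \<Rightarrow> ('k::{finite,linorder}) rmat"
  where "unvech v = (\<chi> i j. v $ Abs_vech_index (min i j, max i j))"

lemma vech_unvech: "vech (unvech v) = v"
proof -
  have "vech (unvech v) $ p = v $ p" for p
  proof -
    obtain i j where ij: "Rep_vech_index p = (i, j)"
      by (cases "Rep_vech_index p")
    then have "i \<le> j"
      using Rep_vech_index[of p] by simp
    then show ?thesis
      using Rep_vech_index_inverse[of p] by (simp add: vech_def unvech_def ij min_def max_def)
  qed
  then show ?thesis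
    by (simp add: vec_eq_iff)
qed

lemma unvech_vech:
  assumes "transpose A = A"
  shows "unvech (vech A) = A"
proof -
  have sym: "A $ i $ j = A $ j $ i" for i j
    using assms by (metis transpose_def vec_lambda_beta)
  have "unvech (vech A) $ i $ j = A $ i $ j" for i j
    using sym[of i j] by (simp add: vech_def unvech_def Abs_vech_index_inverse min_def max_def)
  then show ?thesis
    by (simp add: vec_eq_iff)
qed

section \<open>The Student t model\<close>

definition t_density :: "('k::finite) rvec \<Rightarrow> 'k rmat \<Rightarrow> real \<Rightarrow> 'k rvec \<Rightarrow> real"
  where "t_density \<mu> \<Sigma> \<nu> x =
    (let k = real CARD('k);
         c = Gamma ((\<nu> + k) / 2) / ((pi * \<nu>) powr (k / 2) * Gamma (\<nu> / 2))
     in c * det \<Sigma> powr (- 1 / 2) *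
        (1 + (norm (inv_sqrt \<Sigma> *v (x - \<mu>)))\<^sup>2 / \<nu>) powr (- (\<nu> + k) / 2))"

definition t_law :: "('k::finite) rvec \<Rightarrow> 'k rmat \<Rightarrow> real \<Rightarrow> ('k rvec) measure"
  where "t_law \<mu> \<Sigma> \<nu> = density lborel (\<lambda>x. ennreal (t_density \<mu> \<Sigma> \<nu> x))"

text \<open>A sample of size \<open>n\<close> is a function on \<open>{..<n}\<close>.\<close>

definition sample_law :: "nat \<Rightarrow> ('k::finite) rvec \<Rightarrow> 'k rmat \<Rightarrow> real \<Rightarrow> (nat \<Rightarrow> 'k rvec) measure"
  where "sample_law n \<mu> \<Sigma> \<nu> = (\<Pi>\<^sub>M j\<in>{..<n}. t_law \<mu> \<Sigma> \<nu>)"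

section \<open>Scores and Fisher information\<close>

definition gradient :: "('a::real_inner \<Rightarrow> real) \<Rightarrow> 'a \<Rightarrow> 'a"
  where "gradient f x = (THE D. GDERIV f x :> D)"

definition score1 :: "('k::finite) rvec \<Rightarrow> 'k rmat \<Rightarrow> real \<Rightarrow> 'k rvec \<Rightarrow> 'k rvec"
  where "score1 \<mu> \<Sigma> \<nu> x = gradient (\<lambda>m. ln (t_density m \<Sigma> \<nu> x)) \<mu>"

definition score2 ::
    "('k::{finite,linorder}) rvec \<Rightarrow> 'k rmat \<Rightarrow> real \<Rightarrow> 'k rvec \<Rightarrow> real^('k vech_index)"
  where "score2 \<mu> \<Sigma> \<nu> x = gradient (\<lambda>v. ln (t_density \<mu> (unvech v) \<nu> x)) (vech \<Sigma>)"

definition score3 :: "('k::finite) rvec \<Rightarrow> 'k rmat \<Rightarrow> real \<Rightarrow> 'k rvec \<Rightarrow> real"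
  where "score3 \<mu> \<Sigma> \<nu> x = deriv (\<lambda>s. ln (t_density \<mu> \<Sigma> s x)) \<nu>"

definition score ::
    "('k::{finite,linorder}) rvec \<Rightarrow> 'k rmat \<Rightarrow> real \<Rightarrow> 'k rvec
      \<Rightarrow> real^('k + 'k vech_index + unit)"
  where "score \<mu> \<Sigma> \<nu> x =
    (\<chi> a. case a of
        Inl i \<Rightarrow> score1 \<mu> \<Sigma> \<nu> x $ i
      | Inr (Inl p) \<Rightarrow> score2 \<mu> \<Sigma> \<nu> x $ p
      | Inr (Inr u) \<Rightarrow> score3 \<mu> \<Sigma> \<nu> x)"

definition covariance_matrix :: "'a measure \<Rightarrow> ('a \<Rightarrow> real^'d) \<Rightarrow> real^'d^'d"
  where "covariance_matrix M Y =
    (\<chi> a b. LINT x|M. (Y x $ a - (LINT y|M. Y y $ a)) * (Y x $ b - (LINT y|M. Y y $ b)))"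

definition fisher_info ::
    "('k::{finite,linorder}) rvec \<Rightarrow> 'k rmat \<Rightarrow> real
      \<Rightarrow> real^('k + 'k vech_index + unit)^('k + 'k vech_index + unit)"
  where "fisher_info \<mu> \<Sigma> \<nu> = covariance_matrix (t_law \<mu> \<Sigma> \<nu>) (score \<mu> \<Sigma> \<nu>)"

definition fisher22 ::
    "('k::{finite,linorder}) rvec \<Rightarrow> 'k rmat \<Rightarrow> real \<Rightarrow> real^('k vech_index)^('k vech_index)"
  where "fisher22 \<mu> \<Sigma> \<nu> = (\<chi> p q. fisher_info \<mu> \<Sigma> \<nu> $ Inr (Inl p) $ Inr (Inl q))"

definition fisher23 ::
    "('k::{finite,linorder}) rvec \<Rightarrow> 'k rmat \<Rightarrow> real \<Rightarrow> real^('k vech_index)"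
  where "fisher23 \<mu> \<Sigma> \<nu> = (\<chi> p. fisher_info \<mu> \<Sigma> \<nu> $ Inr (Inl p) $ Inr (Inr ()))"

definition fisher33 :: "('k::{finite,linorder}) rvec \<Rightarrow> 'k rmat \<Rightarrow> real \<Rightarrow> real"
  where "fisher33 \<mu> \<Sigma> \<nu> = fisher_info \<mu> \<Sigma> \<nu> $ Inr (Inr ()) $ Inr (Inr ())"

definition eff_fisher33 :: "('k::{finite,linorder}) rvec \<Rightarrow> 'k rmat \<Rightarrow> real \<Rightarrow> real"
  where "eff_fisher33 \<mu> \<Sigma> \<nu> =
    fisher33 \<mu> \<Sigma> \<nu> - fisher23 \<mu> \<Sigma> \<nu> \<bullet> (matrix_inv (fisher22 \<mu> \<Sigma> \<nu>) *v fisher23 \<mu> \<Sigma> \<nu>)"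

definition central2 ::
    "nat \<Rightarrow> ('k::{finite,linorder}) rvec \<Rightarrow> 'k rmat \<Rightarrow> real \<Rightarrow> (nat \<Rightarrow> 'k rvec)
      \<Rightarrow> real^('k vech_index)"
  where "central2 n \<mu> \<Sigma> \<nu> X = (1 / sqrt (real n)) *\<^sub>R (\<Sum>j<n. score2 \<mu> \<Sigma> \<nu> (X j))"

definition central3 :: "nat \<Rightarrow> ('k::finite) rvec \<Rightarrow> 'k rmat \<Rightarrow> real \<Rightarrow> (nat \<Rightarrow> 'k rvec) \<Rightarrow> real"
  where "central3 n \<mu> \<Sigma> \<nu> X = (1 / sqrt (real n)) * (\<Sum>j<n. score3 \<mu> \<Sigma> \<nu> (X j))"

definition eff_central3 ::
    "nat \<Rightarrow> ('k::{finite,linorder}) rvec \<Rightarrow> 'k rmat \<Rightarrow> real \<Rightarrow> (nat \<Rightarrow> 'k rvec) \<Rightarrow> real"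
  where "eff_central3 n \<mu> \<Sigma> \<nu> X =
    central3 n \<mu> \<Sigma> \<nu> X
      - fisher23 \<mu> \<Sigma> \<nu> \<bullet> (matrix_inv (fisher22 \<mu> \<Sigma> \<nu>) *v central2 n \<mu> \<Sigma> \<nu> X)"

section \<open>Estimators\<close>

abbreviation sample_space :: "nat \<Rightarrow> (nat \<Rightarrow> ('k::finite) rvec) measure"
  where "sample_space n \<equiv> (\<Pi>\<^sub>M j\<in>{..<n}. borel)"

definition estimator ::
    "'p::topological_space set \<Rightarrow> (nat \<Rightarrow> (nat \<Rightarrow> ('k::finite) rvec) \<Rightarrow> 'p) \<Rightarrow> bool"
  where "estimator S T \<longleftrightarrow>
    (\<forall>n\<ge>1. T n \<in> borel_measurable (sample_space n) \<and> T n ` space (sample_space n) \<subseteq> S)"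

text \<open>\<open>g\<close> selects the estimated component of the parameter.\<close>

definition root_n_consistent ::
    "(('k::finite) rvec \<Rightarrow> 'k rmat \<Rightarrow> real \<Rightarrow> 'p::real_normed_vector)
      \<Rightarrow> (nat \<Rightarrow> (nat \<Rightarrow> 'k rvec) \<Rightarrow> 'p) \<Rightarrow> bool"
  where "root_n_consistent g T \<longleftrightarrow>
    (\<forall>\<mu> \<Sigma> \<nu>. pos_def \<Sigma> \<and> 0 < \<nu> \<longrightarrow>
      (\<forall>\<epsilon>>0. \<exists>C. \<forall>\<^sub>F n in sequentially.
         measure (sample_law n \<mu> \<Sigma> \<nu>)
           {X \<in> space (sample_law n \<mu> \<Sigma> \<nu>).
              C < norm (sqrt (real n) *\<^sub>R (T n X - g \<mu> \<Sigma> \<nu>))} \<le> \<epsilon>))"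

definition loc_asymp_discrete ::
    "'p::metric_space set \<Rightarrow> (nat \<Rightarrow> (nat \<Rightarrow> ('k::finite) rvec) \<Rightarrow> 'p) \<Rightarrow> bool"
  where "loc_asymp_discrete S T \<longleftrightarrow>
    (\<forall>\<theta>\<in>S. \<forall>c>0. \<exists>N::nat. \<forall>\<^sub>F n in sequentially.
       finite (T n ` space (sample_space n) \<inter> ball \<theta> (c / sqrt (real n))) \<and>
       card (T n ` space (sample_space n) \<inter> ball \<theta> (c / sqrt (real n))) \<le> N)"

definition nu_cam ::
    "(nat \<Rightarrow> (nat \<Rightarrow> 'k rvec) \<Rightarrow> ('k::{finite,linorder}) rvec)
      \<Rightarrow> (nat \<Rightarrow> (nat \<Rightarrow> 'k rvec) \<Rightarrow> 'k rmat)
      \<Rightarrow> (nat \<Rightarrow> (nat \<Rightarrow> 'k rvec) \<Rightarrow> real) \<Rightarrow> nat \<Rightarrow> (nat \<Rightarrow> 'k rvec) \<Rightarrow> real"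
  where "nu_cam mu_hat Sigma_hat nu_hat n X =
    nu_hat n X + (1 / sqrt (real n)) *
      (inverse (eff_fisher33 (mu_hat n X) (Sigma_hat n X) (nu_hat n X)) *
       eff_central3 n (mu_hat n X) (Sigma_hat n X) (nu_hat n X) X)"

section \<open>Efficiency\<close>

text \<open>\<open>T\<close> is regular at \<open>(\<mu>, \<Sigma>, \<nu>)\<close>, with limit law \<open>L\<close>. For small \<open>n\<close> the
  perturbed parameter may lie outside the parameter space; this does not affect the limit.\<close>

definition regular_with_limit ::
    "(nat \<Rightarrow> (nat \<Rightarrow> ('k::finite) rvec) \<Rightarrow> real) \<Rightarrow> 'k rvec \<Rightarrow> 'k rmat \<Rightarrow> real \<Rightarrow> real measure \<Rightarrow> bool"
  where "regular_with_limit T \<mu> \<Sigma> \<nu> L \<longleftrightarrow>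
    real_distribution L \<and>
    (\<forall>t1 t2 t3. transpose t2 = t2 \<longrightarrow>
      weak_conv_m
        (\<lambda>n. distr
           (sample_law n (\<mu> + (1 / sqrt (real n)) *\<^sub>R t1) (\<Sigma> + (1 / sqrt (real n)) *\<^sub>R t2)
              (\<nu> + t3 / sqrt (real n)))
           borel (\<lambda>X. sqrt (real n) * (T n X - \<nu> - t3 / sqrt (real n))))
        L)"

text \<open>\<open>T\<close> is regular, its asymptotic variance is the inverse of the efficient Fisher
  information, and no regular estimator has a smaller one. A limit law whose square is
  not integrable has infinite variance, so there is nothing to require of it.\<close>

definition most_efficient :: "(nat \<Rightarrow> (nat \<Rightarrow> ('k::{finite,linorder}) rvec) \<Rightarrow> real) \<Rightarrow> bool"
  where "most_efficient T \<longleftrightarrow>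
    estimator UNIV T \<and>
    (\<forall>\<mu> \<Sigma> \<nu>. pos_def \<Sigma> \<and> 0 < \<nu> \<longrightarrow>
      (\<exists>L. regular_with_limit T \<mu> \<Sigma> \<nu> L \<and> integrable L (\<lambda>y. y\<^sup>2) \<and>
           prob_space.variance L (\<lambda>y. y) = inverse (eff_fisher33 \<mu> \<Sigma> \<nu>)) \<and>
      (\<forall>T' L'. estimator UNIV T' \<and> regular_with_limit T' \<mu> \<Sigma> \<nu> L' \<and>
               integrable L' (\<lambda>y. y\<^sup>2) \<longrightarrow>
           inverse (eff_fisher33 \<mu> \<Sigma> \<nu>) \<le> prob_space.variance L' (\<lambda>y. y)))"

end

theory Submission
  imports Defs
begin

text \<open>Local asymptotic normality is avoided. Near each parameter the score and the likelihood ratio are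
  dominated by a random variable with a fourth moment, so dominated convergence gives \<open>L\<^sup>2\<close> expansions
  along \<open>\<theta> + t\<^sub>n / sqrt n\<close>. They bound the chi-square divergence of the product laws, which gives
  contiguity by the Cauchy--Schwarz inequality, and by Chebyshev's inequality they make the central sequence
  asymptotically linear along such paths, and hence at the locally finitely many values of a discrete
  estimator. The one-step estimator is then asymptotically linear in the efficient score, and its limit
  under local alternatives follows from a triangular central limit theorem.

  For the lower bound, the Hammersley--Chapman--Robbins inequality for a bounded function of \<open>T'\<close> passes to
  the limit law \<open>L\<close>. Let the bounded function tend to the identity; in the least favourable direction, letting
  the shift tend to zero then gives \<open>1 / \<Gamma>\<^sub>3\<^sub>3\<^sup>* \<le> Var L\<close>.

  For the t model, the log-density and the score are continuous functions of the parameter and of the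
  direction of \<open>(x, 1)\<close>, up to a logarithm of its norm; compactness of the sphere yields the
  domination, and the same formula shows that the information for \<open>(\<Sigma>, \<nu>)\<close> is nonsingular.\<close>

section \<open>Smooth parametric models\<close>

text \<open>The fourth moment pays for the chi-square divergence: by the mean value inequality
  \<open>sqrt n * (p \<theta>' / p \<theta> - 1)\<close> is bounded by \<open>C * D^2\<close>, and
  its square has to be integrable. Dominated convergence is always run under the fixed law
  \<open>P \<theta>\<close>; integrals under moving laws are brought back to it by the density
  ratio. Contiguity is used from \<open>\<theta>\<close> to the alternatives, because the central
  limit theorem is run directly under the alternative, for the score taken there, which is then
  centred. Efficiency is encoded by a direction \<open>a \<theta>\<close> in parameter space. The
  identity \<open>info \<theta> (a \<theta>) h = G \<theta> * (e \<bullet> h)\<close> states the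
  orthogonality to all nuisance scores, and it is also why one step removes the error of the
  preliminary estimate. The Hammersley--Chapman--Robbins bound contains the exponential of the
  information minus 1 in place of the information, so it becomes sharp only for infinitesimal
  shifts; the shift therefore tends to zero after the sample size has tended to infinity.\<close>

lemma dominated_convergence_eventually:
  fixes f :: "nat \<Rightarrow> 'a \<Rightarrow> 'b::{banach, second_countable_topology}"
  assumes g: "g \<in> borel_measurable M" and w: "integrable M w"
    and ev: "\<forall>\<^sub>F n in sequentially. f n \<in> borel_measurable M \<and> (\<forall>x\<in>space M. norm (f n x) \<le> w x)"
    and lim: "\<And>x. x \<in> space M \<Longrightarrow> (\<lambda>n. f n x) \<longlonglongrightarrow> g x"
  shows "(\<lambda>n. integral\<^sup>L M (f n)) \<longlonglongrightarrow> integral\<^sup>L M g"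
    and "integrable M g"
proof -
  obtain N where N: "\<And>n. n \<ge> N \<Longrightarrow> f n \<in> borel_measurable M \<and> (\<forall>x\<in>space M. norm (f n x) \<le> w x)"
    using ev by (auto simp: eventually_sequentially)
  have *: "(\<lambda>n. f (n + N) x) \<longlonglongrightarrow> g x" if "x \<in> space M" for x
    using lim[OF that] by (rule LIMSEQ_ignore_initial_segment)
  have "(\<lambda>n. integral\<^sup>L M (f (n + N))) \<longlonglongrightarrow> integral\<^sup>L M g"
    by (rule integral_dominated_convergence[where w=w]) (use g w N * in auto)
  then show "(\<lambda>n. integral\<^sup>L M (f n)) \<longlonglongrightarrow> integral\<^sup>L M g"
    by (rule LIMSEQ_offset)
  show "integrable M g"
    by (rule integrable_dominated_convergence[where w=w and s="\<lambda>n. f (n + N)"]) (use g w N * in auto)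
qed

lemma Cauchy_Schwarz_integral:
  fixes f g :: "'a \<Rightarrow> real"
  assumes [measurable]: "f \<in> borel_measurable M" "g \<in> borel_measurable M"
    and f2: "integrable M (\<lambda>x. (f x)\<^sup>2)" and g2: "integrable M (\<lambda>x. (g x)\<^sup>2)"
  shows "integrable M (\<lambda>x. f x * g x)"
    and "(LINT x|M. f x * g x)\<^sup>2 \<le> (LINT x|M. (f x)\<^sup>2) * (LINT x|M. (g x)\<^sup>2)"
proof -
  show fg: "integrable M (\<lambda>x. f x * g x)"
  proof (rule Bochner_Integration.integrable_bound)
    show "integrable M (\<lambda>x. (f x)\<^sup>2 + (g x)\<^sup>2)"
      using f2 g2 by simp
    show "AE x in M. norm (f x * g x) \<le> norm ((f x)\<^sup>2 + (g x)\<^sup>2)"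
    proof (rule AE_I2)
      fix x
      have "2 * (\<bar>f x\<bar> * \<bar>g x\<bar>) \<le> (f x)\<^sup>2 + (g x)\<^sup>2"
        using sum_squares_bound[of "\<bar>f x\<bar>" "\<bar>g x\<bar>"] by simp
      moreover have "0 \<le> \<bar>f x\<bar> * \<bar>g x\<bar>" by simp
      moreover have "norm ((f x)\<^sup>2 + (g x)\<^sup>2) = (f x)\<^sup>2 + (g x)\<^sup>2" by simp
      moreover have "norm (f x * g x) = \<bar>f x\<bar> * \<bar>g x\<bar>" by (simp add: abs_mult)
      ultimately show "norm (f x * g x) \<le> norm ((f x)\<^sup>2 + (g x)\<^sup>2)"
        by linarith
    qed
  qed measurable
  have pos: "0 \<le> (LINT x|M. (f x)\<^sup>2) - 2 * c * (LINT x|M. f x * g x) + c\<^sup>2 * (LINT x|M. (g x)\<^sup>2)" for c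
  proof -
    have "0 \<le> (LINT x|M. (f x - c * g x)\<^sup>2)"
      by (rule integral_nonneg_AE) simp
    also have "(\<lambda>x. (f x - c * g x)\<^sup>2) = (\<lambda>x. (f x)\<^sup>2 - 2 * c * (f x * g x) + c\<^sup>2 * (g x)\<^sup>2)"
      by (auto simp: power2_eq_square algebra_simps)
    also have "integral\<^sup>L M \<dots> = (LINT x|M. (f x)\<^sup>2) - 2 * c * (LINT x|M. f x * g x) + c\<^sup>2 * (LINT x|M. (g x)\<^sup>2)"
      using f2 g2 fg by simp
    finally show ?thesis .
  qed
  let ?A = "LINT x|M. (f x)\<^sup>2" and ?B = "LINT x|M. f x * g x" and ?C = "LINT x|M. (g x)\<^sup>2"
  \<comment> \<open>A quadratic in \<open>d\<close> that is nonnegative everywhere has its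
    discriminant bounded: evaluate at the minimiser \<open>b / c\<close>. For \<open>c = 0\<close>
    it is affine, and \<open>b \<noteq> 0\<close> would allow the value \<open>-1\<close>.\<close>
  have key: "b\<^sup>2 \<le> a * c" if "\<And>d. 0 \<le> a - 2 * d * b + d\<^sup>2 * c" "0 \<le> c" for a b c :: real
  proof (cases "c = 0")
    case True
    have "b = 0"
    proof (rule ccontr)
      assume "b \<noteq> 0"
      then show False
        using that(1)[of "(a + 1) / (2 * b)"] True by simp
    qed
    with True show ?thesis by simp
  next
    case False
    then have "0 < c" using that(2) by simp
    then show ?thesis
      using that(1)[of "b / c"] by (simp add: field_simps power2_eq_square)
  qed
  show "?B\<^sup>2 \<le> ?A * ?C"
    by (rule key[OF pos]) simp
qed

section \<open>Models with differentiable log-density and dominated likelihood ratio\<close>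

text \<open>The fourth moment pays for the square of \<open>C * D^2\<close>, the majorant of the
  normalised likelihood-ratio increment in \<open>D'_bound\<close>. The condition
  \<open>1 \<le> D\<close> makes powers of \<open>D\<close> increase with the exponent, so that
  every majorant can be raised to a multiple of \<open>D^4\<close>.\<close>

locale smooth_model =
  fixes M :: "'x measure" and U :: "'p::euclidean_space set"
    and p :: "'p \<Rightarrow> 'x \<Rightarrow> real" and s :: "'p \<Rightarrow> 'x \<Rightarrow> 'p"
  assumes open_U: "open U"
    and p_measurable: "\<And>\<theta>. \<theta> \<in> U \<Longrightarrow> p \<theta> \<in> borel_measurable M"
    and s_measurable: "\<And>\<theta>. \<theta> \<in> U \<Longrightarrow> s \<theta> \<in> borel_measurable M"
    and p_pos: "\<And>\<theta> x. \<theta> \<in> U \<Longrightarrow> 0 < p \<theta> x"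
    and prob_P: "\<And>\<theta>. \<theta> \<in> U \<Longrightarrow> prob_space (density M (\<lambda>x. ennreal (p \<theta> x)))"
    and ln_p_deriv: "\<And>\<theta> x. \<theta> \<in> U \<Longrightarrow> ((\<lambda>\<theta>. ln (p \<theta> x)) has_derivative (\<lambda>h. s \<theta> x \<bullet> h)) (at \<theta>)"
    and s_cont: "\<And>\<theta> x. \<theta> \<in> U \<Longrightarrow> isCont (\<lambda>\<theta>. s \<theta> x) \<theta>"
    and dominated: "\<And>\<theta>. \<theta> \<in> U \<Longrightarrow> \<exists>\<epsilon>>0. \<exists>D. D \<in> borel_measurable M \<and> ball \<theta> \<epsilon> \<subseteq> U \<and>
        integrable (density M (\<lambda>x. ennreal (p \<theta> x))) (\<lambda>x. (D x)^4) \<and>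
        (\<forall>x. 1 \<le> D x) \<and> (\<forall>\<theta>'\<in>ball \<theta> \<epsilon>. \<forall>x. norm (s \<theta>' x) \<le> D x \<and> p \<theta>' x \<le> D x * p \<theta> x)"
begin

definition P where "P \<theta> = density M (\<lambda>x. ennreal (p \<theta> x))"

text \<open>A bilinear form on directions, so that no basis of the parameter space enters. The raw
  second moment is a covariance because of \<open>score_mean_zero\<close>.\<close>

definition info where "info \<theta> a b = (LINT x|P \<theta>. (a \<bullet> s \<theta> x) * (b \<bullet> s \<theta> x))"

lemma sets_P [simp, measurable_cong]: "sets (P \<theta>) = sets M"
  and space_P [simp]: "space (P \<theta>) = space M"
  by (simp_all add: P_def)

lemma prob_space_P: "\<theta> \<in> U \<Longrightarrow> prob_space (P \<theta>)"
  using prob_P by (simp add: P_def)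

lemma p_deriv:
  assumes "\<theta> \<in> U"
  shows "((\<lambda>\<theta>. p \<theta> x) has_derivative (\<lambda>h. p \<theta> x * (s \<theta> x \<bullet> h))) (at \<theta>)"
proof -
  have "((\<lambda>\<theta>. exp (ln (p \<theta> x))) has_derivative (\<lambda>h. exp (ln (p \<theta> x)) * (s \<theta> x \<bullet> h))) (at \<theta>)"
    using has_derivative_compose[OF ln_p_deriv[OF assms, of x], of exp "\<lambda>h. exp (ln (p \<theta> x)) * h"]
      DERIV_exp[of "ln (p \<theta> x)"] by (simp add: has_field_derivative_def)
  then show ?thesis
    using open_U assms p_pos[OF assms, of x] p_pos
    by (auto intro: has_derivative_transform_within_open[where s=U])
qed

lemma P_eq_density:
  assumes "\<theta> \<in> U" "\<theta>' \<in> U"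
  shows "P \<theta>' = density (P \<theta>) (\<lambda>x. ennreal (p \<theta>' x / p \<theta> x))"
proof -
  have [measurable]: "p \<theta> \<in> borel_measurable M" "p \<theta>' \<in> borel_measurable M"
    using assms p_measurable by auto
  have eq: "ennreal (p \<theta> x) * ennreal (p \<theta>' x / p \<theta> x) = ennreal (p \<theta>' x)" for x
    using p_pos[OF assms(1), of x] p_pos[OF assms(2), of x]
    by (subst ennreal_mult[symmetric]) (auto simp: field_simps)
  show ?thesis
    unfolding P_def by (subst density_density_eq) (auto simp: eq)
qed

lemma integral_P_change:
  fixes f :: "'x \<Rightarrow> 'b::{banach, second_countable_topology}"
  assumes "\<theta> \<in> U" "\<theta>' \<in> U" and [measurable]: "f \<in> borel_measurable M"
  shows "integral\<^sup>L (P \<theta>') f = (LINT x|P \<theta>. (p \<theta>' x / p \<theta> x) *\<^sub>R f x)"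
    and "integrable (P \<theta>') f \<longleftrightarrow> integrable (P \<theta>) (\<lambda>x. (p \<theta>' x / p \<theta> x) *\<^sub>R f x)"
proof -
  have [measurable]: "p \<theta> \<in> borel_measurable M" "p \<theta>' \<in> borel_measurable M"
    using assms p_measurable by auto
  have nn: "0 \<le> p \<theta>' x / p \<theta> x" for x
    using p_pos[OF assms(1), of x] p_pos[OF assms(2), of x] by simp
  show "integral\<^sup>L (P \<theta>') f = (LINT x|P \<theta>. (p \<theta>' x / p \<theta> x) *\<^sub>R f x)"
    unfolding P_eq_density[OF assms(1,2)] by (rule integral_density) (auto simp: nn)
  show "integrable (P \<theta>') f \<longleftrightarrow> integrable (P \<theta>) (\<lambda>x. (p \<theta>' x / p \<theta> x) *\<^sub>R f x)"
    unfolding P_eq_density[OF assms(1,2)] by (rule integrable_density) (auto simp: nn)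
qed

lemma dominated_P:
  assumes "\<theta> \<in> U"
  obtains \<epsilon> D where "0 < \<epsilon>" "D \<in> borel_measurable M" "ball \<theta> \<epsilon> \<subseteq> U"
    "\<And>x. 1 \<le> D x" "\<And>k. k \<le> 4 \<Longrightarrow> integrable (P \<theta>) (\<lambda>x. (D x)^k)"
    "\<And>\<theta>' x. \<theta>' \<in> ball \<theta> \<epsilon> \<Longrightarrow> norm (s \<theta>' x) \<le> D x"
    "\<And>\<theta>' x. \<theta>' \<in> ball \<theta> \<epsilon> \<Longrightarrow> p \<theta>' x \<le> D x * p \<theta> x"
proof -
  obtain \<epsilon> D where *: "\<epsilon> > 0" "D \<in> borel_measurable M" "ball \<theta> \<epsilon> \<subseteq> U"
        "integrable (P \<theta>) (\<lambda>x. (D x)^4)"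
        "\<And>x. 1 \<le> D x" "\<And>\<theta>' x. \<theta>' \<in> ball \<theta> \<epsilon> \<Longrightarrow> norm (s \<theta>' x) \<le> D x"
        "\<And>\<theta>' x. \<theta>' \<in> ball \<theta> \<epsilon> \<Longrightarrow> p \<theta>' x \<le> D x * p \<theta> x"
    using dominated[OF assms] unfolding P_def by blast
  have "integrable (P \<theta>) (\<lambda>x. (D x)^k)" if "k \<le> 4" for k
  proof (rule Bochner_Integration.integrable_bound[OF *(4)])
    show "AE x in P \<theta>. norm (D x ^ k) \<le> norm (D x ^ 4)"
    proof (rule AE_I2)
      fix x
      have "D x ^ k \<le> D x ^ 4"
        using *(5)[of x] that by (intro power_increasing) auto
      then show "norm (D x ^ k) \<le> norm (D x ^ 4)"
        using *(5)[of x] by (simp add: abs_of_nonneg order_trans[OF zero_le_one])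
    qed
  qed (use *(2) in measurable)
  with * that show ?thesis by blast
qed

end

section \<open>Expansions along paths at distance of order \<open>1 / sqrt n\<close>\<close>

text \<open>The direction \<open>t n\<close> is merely bounded, since the rescaled worst points of
  the finite sets in \<open>Delta_linear_finite\<close> need not converge. Limits that depend on
  \<open>t n\<close> are therefore stated as differences tending to 0.\<close>

locale smooth_path = smooth_model M U p s
  for M :: "'x measure" and U :: "'p::euclidean_space set"
    and p :: "'p \<Rightarrow> 'x \<Rightarrow> real" and s :: "'p \<Rightarrow> 'x \<Rightarrow> 'p" +
  fixes \<theta> :: 'p and t :: "nat \<Rightarrow> 'p" and C :: real
  assumes \<theta>_in: "\<theta> \<in> U" and t_bound: "\<And>n. norm (t n) \<le> C"
begin

definition th where "th n = \<theta> + (1 / sqrt (real n)) *\<^sub>R t n"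

definition r where "r n x = p (th n) x / p \<theta> x"

text \<open>The normalised increment of the likelihood ratio; its first-order approximation is
  \<open>t n \<bullet> s \<theta> x\<close>.\<close>

abbreviation D' where "D' \<equiv> \<lambda>n x. sqrt (real n) * (r n x - 1)"

lemma C_nonneg: "0 \<le> C"
  using order_trans[OF norm_ge_zero t_bound] .

lemma th_tendsto: "th \<longlonglongrightarrow> \<theta>"
proof -
  have "(\<lambda>n. (1 / sqrt (real n)) *\<^sub>R t n) \<longlonglongrightarrow> 0"
  proof (rule Lim_null_comparison)
    show "\<forall>\<^sub>F n in sequentially. norm ((1 / sqrt (real n)) *\<^sub>R t n) \<le> C / sqrt (real n)"
      using t_bound by (intro always_eventually allI) (simp add: divide_right_mono)
    show "(\<lambda>n. C / sqrt (real n)) \<longlonglongrightarrow> 0"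
      by real_asymp
  qed
  from tendsto_add[OF tendsto_const[of \<theta>] this] show ?thesis
    unfolding th_def by simp
qed

lemma eventually_th: "0 < \<epsilon> \<Longrightarrow> \<forall>\<^sub>F n in sequentially. th n \<in> ball \<theta> \<epsilon>"
  using th_tendsto by (auto simp: tendsto_iff dist_commute)

lemma eventually_th_in: "\<forall>\<^sub>F n in sequentially. th n \<in> U"
  using th_tendsto open_U \<theta>_in by (rule topological_tendstoD)

lemma r_measurable: "th n \<in> U \<Longrightarrow> r n \<in> borel_measurable M"
  unfolding r_def using p_measurable \<theta>_in by measurable

lemma r_tendsto: "(\<lambda>n. r n x) \<longlonglongrightarrow> 1"
proof -
  have "isCont (\<lambda>\<theta>. p \<theta> x) \<theta>"
    using p_deriv[OF \<theta>_in] by (rule has_derivative_continuous)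
  then have "(\<lambda>n. p (th n) x) \<longlonglongrightarrow> p \<theta> x"
    using th_tendsto by (rule isCont_tendsto_compose)
  from tendsto_divide[OF this tendsto_const[of "p \<theta> x"]] show ?thesis
    unfolding r_def using p_pos[OF \<theta>_in, of x] by simp
qed

lemma s_tendsto: "(\<lambda>n. s (th n) x) \<longlonglongrightarrow> s \<theta> x"
  using s_cont[OF \<theta>_in] th_tendsto by (rule isCont_tendsto_compose)

lemma D'_tendsto: "(\<lambda>n. D' n x - t n \<bullet> s \<theta> x) \<longlonglongrightarrow> 0"
proof (rule tendstoI)
  fix e :: real assume e: "0 < e"
  \<comment> \<open>With this \<open>e'\<close> the first-order error becomes
    \<open>e * (C / (C + 1))\<close>, strictly below \<open>e\<close> even for
    \<open>C = 0\<close>.\<close>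
  define e' where "e' = e * p \<theta> x / (C + 1)"
  have px: "0 < p \<theta> x" using p_pos[OF \<theta>_in] .
  have e': "0 < e'" using e px C_nonneg by (simp add: e'_def)
  obtain d where d: "d > 0" "\<And>y. norm (y - \<theta>) < d \<Longrightarrow>
      norm (p y x - p \<theta> x - p \<theta> x * (s \<theta> x \<bullet> (y - \<theta>))) \<le> e' * norm (y - \<theta>)"
    using p_deriv[OF \<theta>_in, of x] e' unfolding has_derivative_within_alt by blast
  have "\<forall>\<^sub>F n in sequentially. n \<ge> 1 \<and> th n \<in> ball \<theta> d"
    using eventually_th[OF d(1)] eventually_ge_at_top[of 1] by eventually_elim simp
  then show "\<forall>\<^sub>F n in sequentially. dist (D' n x - t n \<bullet> s \<theta> x) 0 < e"
  proof eventually_elim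
    case (elim n)
    let ?q = "sqrt (real n)"
    have q: "?q > 0" using elim by simp
    have h: "th n - \<theta> = (1 / ?q) *\<^sub>R t n" by (simp add: th_def)
    have "norm (p (th n) x - p \<theta> x - p \<theta> x * (s \<theta> x \<bullet> (th n - \<theta>))) \<le> e' * norm (th n - \<theta>)"
      using d(2)[of "th n"] elim by (simp add: dist_norm norm_minus_commute)
    also have "\<dots> \<le> e' * (C / ?q)"
      using t_bound[of n] e' q unfolding h by (intro mult_left_mono) (simp_all add: divide_right_mono)
    finally have *: "\<bar>p (th n) x - p \<theta> x - p \<theta> x * (s \<theta> x \<bullet> (th n - \<theta>))\<bar> \<le> e' * (C / ?q)"
      by simp
    have "D' n x - t n \<bullet> s \<theta> x = ?q / p \<theta> x * (p (th n) x - p \<theta> x - p \<theta> x * (s \<theta> x \<bullet> (th n - \<theta>)))"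
      unfolding h r_def using q px by (simp add: field_simps inner_commute)
    then have "\<bar>D' n x - t n \<bullet> s \<theta> x\<bar> = ?q / p \<theta> x * \<bar>p (th n) x - p \<theta> x - p \<theta> x * (s \<theta> x \<bullet> (th n - \<theta>))\<bar>"
      using q px by (simp add: abs_mult)
    also have "\<dots> \<le> ?q / p \<theta> x * (e' * (C / ?q))"
      using q px * by (intro mult_left_mono) auto
    also have "\<dots> = e * (C / (C + 1))"
      using q px by (simp add: e'_def)
    also have "\<dots> < e * 1"
      using e C_nonneg by (intro mult_strict_left_mono) (simp_all add: field_simps)
    finally show ?case by simp
  qed
qed

definition dominates where "dominates \<epsilon> D \<longleftrightarrow> 0 < \<epsilon> \<and> D \<in> borel_measurable M \<and> ball \<theta> \<epsilon> \<subseteq> U \<and>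
    (\<forall>x. 1 \<le> D x) \<and> (\<forall>k\<le>4. integrable (P \<theta>) (\<lambda>x. (D x)^k)) \<and>
    (\<forall>\<theta>'\<in>ball \<theta> \<epsilon>. \<forall>x. norm (s \<theta>' x) \<le> D x \<and> p \<theta>' x \<le> D x * p \<theta> x)"

lemma dominates_ex: "\<exists>\<epsilon> D. dominates \<epsilon> D"
proof (rule dominated_P[OF \<theta>_in], goal_cases)
  case (1 \<epsilon> D)
  then have "dominates \<epsilon> D"
    unfolding dominates_def by simp
  then show ?case by blast
qed

text \<open>Mean value inequality on the ball: the derivative of the density is density times score,
  and relative to \<open>p \<theta> x\<close> each of the two factors contributes one
  \<open>D\<close>.\<close>

lemma D'_bound:
  assumes "dominates \<epsilon> D" "th n \<in> ball \<theta> \<epsilon>"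
  shows "\<bar>D' n x\<bar> \<le> C * (D x)^2"
proof (cases "n = 0")
  case True
  then show ?thesis using C_nonneg by simp
next
  case False
  let ?q = "sqrt (real n)"
  have q: "?q > 0" using False by simp
  have px: "0 < p \<theta> x" using p_pos[OF \<theta>_in] .
  have D1: "1 \<le> D x" using assms by (simp add: dominates_def)
  have "norm (p (th n) x - p \<theta> x) \<le> ((D x)^2 * p \<theta> x) * norm (th n - \<theta>)"
  proof (rule differentiable_bound[where S="ball \<theta> \<epsilon>"])
    fix y assume y: "y \<in> ball \<theta> \<epsilon>"
    then have yU: "y \<in> U" using assms by (auto simp: dominates_def)
    show "((\<lambda>\<theta>. p \<theta> x) has_derivative (\<lambda>h. p y x * (s y x \<bullet> h))) (at y within ball \<theta> \<epsilon>)"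
      using p_deriv[OF yU] by (rule has_derivative_at_withinI)
    show "onorm (\<lambda>h. p y x * (s y x \<bullet> h)) \<le> (D x)^2 * p \<theta> x"
    proof (rule onorm_le)
      fix h
      have "\<bar>p y x * (s y x \<bullet> h)\<bar> \<le> p y x * (norm (s y x) * norm h)"
        using p_pos[OF yU, of x] Cauchy_Schwarz_ineq2[of "s y x" h] by (simp add: abs_mult)
      also have "\<dots> \<le> (D x * p \<theta> x) * (D x * norm h)"
        using assms y p_pos[OF yU, of x] px order_trans[OF zero_le_one D1]
        by (intro mult_mono mult_right_mono mult_nonneg_nonneg) (auto simp: dominates_def)
      finally show "norm (p y x * (s y x \<bullet> h)) \<le> (D x)^2 * p \<theta> x * norm h"
        by (simp add: power2_eq_square algebra_simps)
    qed
  qed (use assms in \<open>auto simp: dominates_def\<close>)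
  also have "norm (th n - \<theta>) \<le> C / ?q"
    using t_bound[of n] q by (simp add: th_def divide_right_mono)
  finally have *: "\<bar>p (th n) x - p \<theta> x\<bar> \<le> (D x)^2 * p \<theta> x * (C / ?q)"
    using px by (simp add: mult_left_mono)
  have "\<bar>D' n x\<bar> = ?q / p \<theta> x * \<bar>p (th n) x - p \<theta> x\<bar>"
  proof -
    have "D' n x = ?q / p \<theta> x * (p (th n) x - p \<theta> x)"
      using px by (simp add: r_def field_simps)
    then show ?thesis using q px by (simp add: abs_mult)
  qed
  also have "\<dots> \<le> ?q / p \<theta> x * ((D x)^2 * p \<theta> x * (C / ?q))"
    using * q px by (intro mult_left_mono) auto
  also have "\<dots> = C * (D x)^2"
    using q px by simp
  finally show ?thesis .
qed

end

context smooth_path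
begin

lemma dominates_integrable:
  fixes f :: "'x \<Rightarrow> 'b::{banach, second_countable_topology}"
  assumes "dominates \<epsilon> D" "f \<in> borel_measurable M" "\<And>x. norm (f x) \<le> K * (D x)^4"
  shows "integrable (P \<theta>) f"
proof (rule Bochner_Integration.integrable_bound)
  show "integrable (P \<theta>) (\<lambda>x. K * (D x)^4)"
    using assms(1) by (simp add: dominates_def)
  show "AE x in P \<theta>. norm (f x) \<le> norm (K * (D x)^4)"
    using assms(3) by (intro AE_I2) (simp, meson abs_ge_self order_trans)
qed (use assms(2) in measurable)

text \<open>All majorants are multiples of \<open>D^4\<close>. Measurability and bounds are asked
  for only where \<open>th n\<close> lies in \<open>U\<close> or in the ball, which happens
  eventually.\<close>

lemma path_dominated_convergence:
  fixes f :: "nat \<Rightarrow> 'x \<Rightarrow> 'b::{banach, second_countable_topology}"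
  assumes dom: "dominates \<epsilon> D" and g: "g \<in> borel_measurable M"
    and f: "\<And>n. th n \<in> U \<Longrightarrow> f n \<in> borel_measurable M"
    and bound: "\<And>n x. 1 \<le> n \<Longrightarrow> th n \<in> ball \<theta> \<epsilon> \<Longrightarrow> norm (f n x) \<le> K * (D x)^4"
    and lim: "\<And>x. (\<lambda>n. f n x) \<longlonglongrightarrow> g x"
  shows "(\<lambda>n. integral\<^sup>L (P \<theta>) (f n)) \<longlonglongrightarrow> integral\<^sup>L (P \<theta>) g"
proof (rule dominated_convergence_eventually)
  show "g \<in> borel_measurable (P \<theta>)"
    using g by measurable
  show "integrable (P \<theta>) (\<lambda>x. K * (D x)^4)"
    using dom by (simp add: dominates_def)
  have "0 < \<epsilon>" "ball \<theta> \<epsilon> \<subseteq> U" using dom by (auto simp: dominates_def)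
  show "\<forall>\<^sub>F n in sequentially. f n \<in> borel_measurable (P \<theta>) \<and> (\<forall>x\<in>space (P \<theta>). norm (f n x) \<le> K * (D x)^4)"
    using eventually_th[OF \<open>0 < \<epsilon>\<close>] eventually_ge_at_top[of 1]
  proof eventually_elim
    case (elim n)
    then have "f n \<in> borel_measurable M"
      using f \<open>ball \<theta> \<epsilon> \<subseteq> U\<close> by auto
    then have "f n \<in> borel_measurable (P \<theta>)" by measurable
    with bound elim show ?case by simp
  qed
qed (rule lim)

lemma D_pow_le:
  assumes "dominates \<epsilon> D" "k \<le> l"
  shows "(D x)^k \<le> (D x)^l"
  using assms by (intro power_increasing) (auto simp: dominates_def)

lemma D'_measurable: "th n \<in> U \<Longrightarrow> D' n \<in> borel_measurable M"
  using r_measurable[of n] by measurable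

end

context smooth_model
begin

lemma inner_s_measurable: "\<theta> \<in> U \<Longrightarrow> (\<lambda>x. a \<bullet> s \<theta> x) \<in> borel_measurable M"
  using s_measurable[of \<theta>] by measurable

lemma smooth_path_const: "\<theta> \<in> U \<Longrightarrow> smooth_path M U p s \<theta> (\<lambda>_. a) (norm a)"
  by unfold_locales auto

lemma inner_s_abs_le: "norm (s \<theta> x) \<le> d \<Longrightarrow> norm a \<le> A \<Longrightarrow> \<bar>a \<bullet> s \<theta> x\<bar> \<le> A * d"
  using Cauchy_Schwarz_ineq2[of a "s \<theta> x"] mult_mono[of "norm a" A "norm (s \<theta> x)" d]
  by (smt (verit) norm_ge_zero)

lemma score_prod_integrable:
  assumes "\<theta> \<in> U"
  shows "integrable (P \<theta>) (\<lambda>x. (a \<bullet> s \<theta> x) * (b \<bullet> s \<theta> x))"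
    and "integrable (P \<theta>) (\<lambda>x. a \<bullet> s \<theta> x)"
proof -
  interpret smooth_path M U p s \<theta> "\<lambda>_. a" "norm a"
    using smooth_path_const[OF assms] .
  obtain \<epsilon> D where D: "dominates \<epsilon> D" using dominates_ex by blast
  have [measurable]: "(\<lambda>x. a \<bullet> s \<theta> x) \<in> borel_measurable M" for a
    using inner_s_measurable[OF assms] .
  have s: "norm (s \<theta> x) \<le> D x" and D1: "1 \<le> D x" for x
    using D by (auto simp: dominates_def)
  show "integrable (P \<theta>) (\<lambda>x. (a \<bullet> s \<theta> x) * (b \<bullet> s \<theta> x))"
  proof (rule dominates_integrable[OF D])
    fix x
    have "\<bar>a \<bullet> s \<theta> x\<bar> * \<bar>b \<bullet> s \<theta> x\<bar> \<le> (norm a * D x) * (norm b * D x)"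
      using D1[of x] s[of x] by (intro mult_mono inner_s_abs_le) auto
    also have "\<dots> = norm a * norm b * (D x)^2" by (simp add: power2_eq_square)
    also have "\<dots> \<le> norm a * norm b * (D x)^4"
      using D_pow_le[OF D, of 2 4] by (intro mult_left_mono) auto
    finally show "norm ((a \<bullet> s \<theta> x) * (b \<bullet> s \<theta> x)) \<le> norm a * norm b * (D x)^4"
      by (simp add: abs_mult)
  qed measurable
  show "integrable (P \<theta>) (\<lambda>x. a \<bullet> s \<theta> x)"
  proof (rule dominates_integrable[OF D])
    fix x
    have "\<bar>a \<bullet> s \<theta> x\<bar> \<le> norm a * (D x)^1"
      using s[of x] by (simp add: inner_s_abs_le)
    also have "\<dots> \<le> norm a * (D x)^4"
      using D_pow_le[OF D, of 1 4] by (intro mult_left_mono) auto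
    finally show "norm (a \<bullet> s \<theta> x) \<le> norm a * (D x)^4"
      by simp
  qed measurable
qed

text \<open>Along a fixed direction the increments \<open>D'\<close> integrate to 0, because both
  densities integrate to 1. Passing to the limit under the majorant takes the place of
  differentiation under the integral sign.\<close>

lemma score_mean_zero:
  assumes "\<theta> \<in> U"
  shows "(LINT x|P \<theta>. a \<bullet> s \<theta> x) = 0"
proof -
  interpret smooth_path M U p s \<theta> "\<lambda>_. a" "norm a"
    using smooth_path_const[OF assms] .
  obtain \<epsilon> D where D: "dominates \<epsilon> D" using dominates_ex by blast
  have "(\<lambda>n. LINT x|P \<theta>. D' n x) \<longlonglongrightarrow> (LINT x|P \<theta>. a \<bullet> s \<theta> x)"
  proof (rule path_dominated_convergence[OF D, where K="norm a"])
    fix n x assume "th n \<in> ball \<theta> \<epsilon>"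
    then have "\<bar>D' n x\<bar> \<le> norm a * (D x)^2" using D'_bound[OF D] by simp
    also have "\<dots> \<le> norm a * (D x)^4"
      using D_pow_le[OF D, of 2 4] by (intro mult_left_mono) auto
    finally show "norm (D' n x) \<le> norm a * (D x)^4" by simp
  next
    fix x
    show "(\<lambda>n. D' n x) \<longlonglongrightarrow> a \<bullet> s \<theta> x"
      using D'_tendsto[of x] by (simp add: LIM_zero_iff)
  qed (use D'_measurable inner_s_measurable[OF assms] in auto)
  moreover have "\<forall>\<^sub>F n in sequentially. (LINT x|P \<theta>. D' n x) = 0"
    using eventually_th_in
  proof eventually_elim
    case (elim n)
    interpret P1: prob_space "P \<theta>" using prob_space_P[OF assms] .
    interpret P2: prob_space "P (th n)" using prob_space_P[OF elim] .
    have "integrable (P \<theta>) (r n)" "(LINT x|P \<theta>. r n x) = 1"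
      using integral_P_change[OF assms elim, of "\<lambda>_. 1::real"] P2.prob_space
      by (simp_all add: r_def[abs_def])
    then show ?case
      using P1.prob_space by simp
  qed
  ultimately have "(\<lambda>n. 0) \<longlonglongrightarrow> (LINT x|P \<theta>. a \<bullet> s \<theta> x)"
    by (rule Lim_transform_eventually)
  then show ?thesis
    by (simp add: LIMSEQ_const_iff)
qed

end

section \<open>Scores evaluated at the points of a path\<close>

text \<open>The efficient direction varies with the parameter, so the score at \<open>th n\<close>
  is tested against its own direction \<open>a n\<close>, which converges to the direction
  \<open>a0\<close> belonging to \<open>\<theta>\<close>.\<close>

locale smooth_path_dir = smooth_path M U p s \<theta> t C
  for M :: "'x measure" and U :: "'p::euclidean_space set"
    and p :: "'p \<Rightarrow> 'x \<Rightarrow> real" and s :: "'p \<Rightarrow> 'x \<Rightarrow> 'p"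
    and \<theta> :: 'p and t :: "nat \<Rightarrow> 'p" and C :: real +
  fixes a :: "nat \<Rightarrow> 'p" and a0 :: 'p and A :: real
  assumes a_lim: "a \<longlonglongrightarrow> a0" and a_bound: "\<And>n. norm (a n) \<le> A" and a0_bound: "norm a0 \<le> A"
begin

definition phi where "phi n x = a n \<bullet> s (th n) x"
definition phi0 where "phi0 x = a0 \<bullet> s \<theta> x"

lemma A_nonneg: "0 \<le> A"
  using order_trans[OF norm_ge_zero a0_bound] .

lemma phi_tendsto: "(\<lambda>n. phi n x) \<longlonglongrightarrow> phi0 x"
  unfolding phi_def phi0_def by (intro tendsto_inner a_lim s_tendsto)

lemma phi_measurable: "th n \<in> U \<Longrightarrow> phi n \<in> borel_measurable M"
  unfolding phi_def by (rule inner_s_measurable)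

lemma phi0_measurable: "phi0 \<in> borel_measurable M"
  unfolding phi0_def by (rule inner_s_measurable[OF \<theta>_in])

lemma phi_bound:
  assumes "dominates \<epsilon> D"
  shows "th n \<in> ball \<theta> \<epsilon> \<Longrightarrow> \<bar>phi n x\<bar> \<le> A * D x" and "\<bar>phi0 x\<bar> \<le> A * D x"
  unfolding phi_def phi0_def using assms a_bound a0_bound
  by (auto intro!: inner_s_abs_le simp: dominates_def)

lemma D_ge_1: "dominates \<epsilon> D \<Longrightarrow> 1 \<le> D x"
  by (simp add: dominates_def)

lemma phi_diff_L2: "(\<lambda>n. LINT x|P \<theta>. (phi n x - phi0 x)\<^sup>2) \<longlonglongrightarrow> 0"
proof -
  obtain \<epsilon> D where D: "dominates \<epsilon> D" using dominates_ex by blast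
  have "(\<lambda>n. LINT x|P \<theta>. (phi n x - phi0 x)\<^sup>2) \<longlonglongrightarrow> (LINT x|P \<theta>. 0)"
  proof (rule path_dominated_convergence[OF D, where K="(2 * A)\<^sup>2"])
    fix n x assume "th n \<in> ball \<theta> \<epsilon>"
    then have "\<bar>phi n x - phi0 x\<bar> \<le> 2 * A * D x"
      using phi_bound(1)[OF D, of n x] phi_bound(2)[OF D, of x] by linarith
    then have "\<bar>phi n x - phi0 x\<bar>\<^sup>2 \<le> (2 * A * D x)\<^sup>2"
      by (intro power_mono) auto
    also have "\<dots> = (2 * A)\<^sup>2 * (D x)^2" by (simp add: power_mult_distrib)
    also have "\<dots> \<le> (2 * A)\<^sup>2 * (D x)^4"
      using D_pow_le[OF D, of 2 4] by (intro mult_left_mono) auto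
    finally show "norm ((phi n x - phi0 x)\<^sup>2) \<le> (2 * A)\<^sup>2 * (D x)^4" by simp
  next
    fix x
    show "(\<lambda>n. (phi n x - phi0 x)\<^sup>2) \<longlonglongrightarrow> 0"
      using tendsto_power[OF tendsto_diff[OF phi_tendsto[of x] tendsto_const[of "phi0 x"]], of 2] by simp
  next
    fix n assume "th n \<in> U"
    from phi_measurable[OF this] phi0_measurable show "(\<lambda>x. (phi n x - phi0 x)\<^sup>2) \<in> borel_measurable M"
      by measurable
  qed simp
  then show ?thesis by simp
qed

text \<open>The integrand differs from \<open>phi0 x * (t n \<bullet> s \<theta> x)\<close> by
  \<open>phi n x * (D' n x - t n \<bullet> s \<theta> x) + (phi n x - phi0 x) * (t n \<bullet> s
  \<theta> x)\<close>, and both terms vanish pointwise.\<close>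

lemma phi_D'_limit: "(\<lambda>n. (LINT x|P \<theta>. phi n x * D' n x) - info \<theta> a0 (t n)) \<longlonglongrightarrow> 0"
proof -
  obtain \<epsilon> D where D: "dominates \<epsilon> D" using dominates_ex by blast
  then have \<epsilon>: "0 < \<epsilon>" "ball \<theta> \<epsilon> \<subseteq> U" by (auto simp: dominates_def)
  have [measurable]: "(\<lambda>x. b \<bullet> s \<theta> x) \<in> borel_measurable M" for b
    using inner_s_measurable[OF \<theta>_in] .
  note [measurable] = phi0_measurable
  have D0: "0 \<le> D x" for x using D_ge_1[OF D, of x] by simp
  have b1: "\<bar>phi n x * D' n x\<bar> \<le> A * C * (D x)^4" if "th n \<in> ball \<theta> \<epsilon>" for n x
  proof -
    have "\<bar>phi n x\<bar> * \<bar>D' n x\<bar> \<le> (A * D x) * (C * (D x)^2)"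
      using D0[of x] A_nonneg by (intro mult_mono phi_bound[OF D] D'_bound[OF D] that) auto
    also have "\<dots> = A * C * (D x)^3" by (simp add: power2_eq_square power3_eq_cube)
    also have "\<dots> \<le> A * C * (D x)^4"
      using D_pow_le[OF D, of 3 4] A_nonneg C_nonneg by (intro mult_left_mono) auto
    finally show ?thesis by (simp add: abs_mult)
  qed
  have b2: "\<bar>phi0 x * (t n \<bullet> s \<theta> x)\<bar> \<le> A * C * (D x)^4" for n x
  proof -
    have "\<bar>phi0 x\<bar> * \<bar>t n \<bullet> s \<theta> x\<bar> \<le> (A * D x) * (C * D x)"
      using D0[of x] A_nonneg D \<epsilon> t_bound[of n]
      by (intro mult_mono phi_bound[OF D] inner_s_abs_le) (auto simp: dominates_def)
    also have "\<dots> = A * C * (D x)^2" by (simp add: power2_eq_square)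
    also have "\<dots> \<le> A * C * (D x)^4"
      using D_pow_le[OF D, of 2 4] A_nonneg C_nonneg by (intro mult_left_mono) auto
    finally show ?thesis by (simp add: abs_mult)
  qed
  have "(\<lambda>n. LINT x|P \<theta>. phi n x * D' n x - phi0 x * (t n \<bullet> s \<theta> x)) \<longlonglongrightarrow> (LINT x|P \<theta>. 0)"
  proof (rule path_dominated_convergence[OF D, where K="2 * (A * C)"])
    fix n x assume "th n \<in> ball \<theta> \<epsilon>"
    from b1[OF this, of x] b2[of x n]
    have "\<bar>phi n x * D' n x\<bar> + \<bar>phi0 x * (t n \<bullet> s \<theta> x)\<bar> \<le> 2 * (A * C) * (D x)^4" by linarith
    then show "norm (phi n x * D' n x - phi0 x * (t n \<bullet> s \<theta> x)) \<le> 2 * (A * C) * (D x)^4"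
      using abs_triangle_ineq4[of "phi n x * D' n x" "phi0 x * (t n \<bullet> s \<theta> x)"] by simp
  next
    fix x
    have "(\<lambda>n. (phi n x - phi0 x) * (t n \<bullet> s \<theta> x)) \<longlonglongrightarrow> 0"
    proof (rule Lim_null_comparison)
      show "\<forall>\<^sub>F n in sequentially. norm ((phi n x - phi0 x) * (t n \<bullet> s \<theta> x)) \<le> \<bar>phi n x - phi0 x\<bar> * (C * norm (s \<theta> x))"
        using t_bound by (auto intro!: always_eventually mult_left_mono inner_s_abs_le simp: abs_mult)
      show "(\<lambda>n. \<bar>phi n x - phi0 x\<bar> * (C * norm (s \<theta> x))) \<longlonglongrightarrow> 0"
        using tendsto_mult[OF tendsto_rabs[OF tendsto_diff[OF phi_tendsto[of x] tendsto_const[of "phi0 x"]]]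
            tendsto_const[of "C * norm (s \<theta> x)"]] by simp
    qed
    moreover have "(\<lambda>n. phi n x * (D' n x - t n \<bullet> s \<theta> x)) \<longlonglongrightarrow> 0"
      using tendsto_mult[OF phi_tendsto[of x] D'_tendsto[of x]] by simp
    ultimately have "(\<lambda>n. phi n x * (D' n x - t n \<bullet> s \<theta> x) + (phi n x - phi0 x) * (t n \<bullet> s \<theta> x)) \<longlonglongrightarrow> 0 + 0"
      by (intro tendsto_add)
    then show "(\<lambda>n. phi n x * D' n x - phi0 x * (t n \<bullet> s \<theta> x)) \<longlonglongrightarrow> 0"
      by (simp add: algebra_simps)
  next
    fix n assume "th n \<in> U"
    note [measurable] = phi_measurable[OF this] D'_measurable[OF this]
    show "(\<lambda>x. phi n x * D' n x - phi0 x * (t n \<bullet> s \<theta> x)) \<in> borel_measurable M"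
      by measurable
  qed simp
  moreover have "\<forall>\<^sub>F n in sequentially. (LINT x|P \<theta>. phi n x * D' n x - phi0 x * (t n \<bullet> s \<theta> x))
      = (LINT x|P \<theta>. phi n x * D' n x) - info \<theta> a0 (t n)"
    using eventually_th[OF \<epsilon>(1)]
  proof eventually_elim
    case (elim n)
    then have "th n \<in> U" using \<epsilon> by auto
    note [measurable] = phi_measurable[OF this] D'_measurable[OF this]
    have "integrable (P \<theta>) (\<lambda>x. phi n x * D' n x)"
      using b1[OF elim] by (intro dominates_integrable[OF D, where K="A * C"]) auto
    moreover have "integrable (P \<theta>) (\<lambda>x. phi0 x * (t n \<bullet> s \<theta> x))"
      using b2 by (intro dominates_integrable[OF D, where K="A * C"]) auto
    ultimately show ?case
      by (simp add: info_def phi0_def)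
  qed
  ultimately show ?thesis
    using Lim_transform_eventually by fastforce
qed

lemma phi_integrable:
  assumes "dominates \<epsilon> D" "th n \<in> ball \<theta> \<epsilon>"
  shows "integrable (P \<theta>) (phi n)" "integrable (P \<theta>) (\<lambda>x. (phi n x)\<^sup>2)"
    "integrable (P \<theta>) (r n)" "integrable (P \<theta>) (\<lambda>x. phi n x * r n x)"
proof -
  note D = assms(1)
  have "th n \<in> U" using assms by (auto simp: dominates_def)
  note [measurable] = phi_measurable[OF this] r_measurable[OF this]
  have D0: "0 \<le> D x" for x using D_ge_1[OF D, of x] by simp
  have \<phi>: "\<bar>phi n x\<bar> \<le> A * D x" for x using phi_bound(1)[OF D assms(2)] .
  have r: "\<bar>r n x\<bar> \<le> D x" for x
    using assms p_pos[OF \<theta>_in, of x] p_pos[OF \<open>th n \<in> U\<close>, of x]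
    by (simp add: r_def dominates_def divide_le_eq)
  have le: "K * (D x)^k \<le> K * (D x)^4" if "k \<le> 4" "0 \<le> K" for k K x
    using D_pow_le[OF D, of k 4 x] that by (intro mult_left_mono) auto
  show "integrable (P \<theta>) (phi n)"
  proof (rule dominates_integrable[OF D, where K=A])
    show "norm (phi n x) \<le> A * D x ^ 4" for x
      using \<phi>[of x] le[of 1 A x] A_nonneg by simp
  qed measurable
  show "integrable (P \<theta>) (r n)"
  proof (rule dominates_integrable[OF D, where K=1])
    show "norm (r n x) \<le> 1 * D x ^ 4" for x
      using r[of x] le[of 1 1 x] by simp
  qed measurable
  show "integrable (P \<theta>) (\<lambda>x. phi n x * r n x)"
  proof (rule dominates_integrable[OF D, where K=A])
    show "norm (phi n x * r n x) \<le> A * D x ^ 4" for x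
    proof -
      have "\<bar>phi n x\<bar> * \<bar>r n x\<bar> \<le> (A * D x) * D x"
        using \<phi>[of x] r[of x] A_nonneg D0[of x] by (intro mult_mono) auto
      then show ?thesis
        using le[of 2 A x] A_nonneg by (simp add: abs_mult power2_eq_square)
    qed
  qed measurable
  show "integrable (P \<theta>) (\<lambda>x. (phi n x)\<^sup>2)"
  proof (rule dominates_integrable[OF D, where K="A\<^sup>2"])
    show "norm ((phi n x)\<^sup>2) \<le> A\<^sup>2 * D x ^ 4" for x
    proof -
      have "\<bar>phi n x\<bar>\<^sup>2 \<le> (A * D x)\<^sup>2"
        using \<phi>[of x] by (intro power_mono) auto
      then show ?thesis
        using le[of 2 "A\<^sup>2" x] by (simp add: power_mult_distrib)
    qed
  qed measurable
qed

text \<open>The score at \<open>th n\<close> is centred under \<open>P (th n)\<close>, so by the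
  change of measure its product with \<open>r n\<close> has integral 0 under
  \<open>P \<theta>\<close>.\<close>

lemma phi_mean:
  assumes "dominates \<epsilon> D" "th n \<in> ball \<theta> \<epsilon>"
  shows "sqrt (real n) * (LINT x|P \<theta>. phi n x) = - (LINT x|P \<theta>. phi n x * D' n x)"
proof -
  have U: "th n \<in> U" using assms by (auto simp: dominates_def)
  have 0: "(LINT x|P \<theta>. phi n x * r n x) = 0"
    using score_mean_zero[OF U, of "a n"] integral_P_change(1)[OF \<theta>_in U inner_s_measurable[OF U], of "a n"]
    by (simp add: phi_def r_def mult.commute)
  have "(LINT x|P \<theta>. phi n x * D' n x) = (LINT x|P \<theta>. sqrt (real n) * (phi n x * r n x) - sqrt (real n) * phi n x)"
    by (simp add: algebra_simps)
  also have "\<dots> = - sqrt (real n) * (LINT x|P \<theta>. phi n x)"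
    using phi_integrable[OF assms] 0 by simp
  finally show ?thesis by simp
qed

text \<open>To first order the score taken at a neighbouring parameter is off centre under the base
  law by \<open>- info \<theta> a0 (t n) / sqrt n\<close>; this is the drift in
  \<open>asymptotic_linearity\<close>.\<close>

lemma phi_mean_limit: "(\<lambda>n. sqrt (real n) * (LINT x|P \<theta>. phi n x) + info \<theta> a0 (t n)) \<longlonglongrightarrow> 0"
proof -
  obtain \<epsilon> D where D: "dominates \<epsilon> D" using dominates_ex by blast
  then have \<epsilon>: "0 < \<epsilon>" by (auto simp: dominates_def)
  have "\<forall>\<^sub>F n in sequentially. - ((LINT x|P \<theta>. phi n x * D' n x) - info \<theta> a0 (t n))
     = sqrt (real n) * (LINT x|P \<theta>. phi n x) + info \<theta> a0 (t n)"
    using eventually_th[OF \<epsilon>] by eventually_elim (simp add: phi_mean[OF D])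
  with tendsto_minus[OF phi_D'_limit] show ?thesis
    using Lim_transform_eventually by fastforce
qed

end

context smooth_path
begin

text \<open>The integral is \<open>n\<close> times the chi-square divergence between neighbouring
  laws. Its majorant \<open>(C * D^2)^2\<close> uses up the fourth moment.\<close>

lemma D'_sq_limit: "(\<lambda>n. (LINT x|P \<theta>. (D' n x)\<^sup>2) - info \<theta> (t n) (t n)) \<longlonglongrightarrow> 0"
proof -
  obtain \<epsilon> D where D: "dominates \<epsilon> D" using dominates_ex by blast
  then have \<epsilon>: "0 < \<epsilon>" "ball \<theta> \<epsilon> \<subseteq> U" by (auto simp: dominates_def)
  have [measurable]: "(\<lambda>x. b \<bullet> s \<theta> x) \<in> borel_measurable M" for b
    using inner_s_measurable[OF \<theta>_in] .
  have D1: "1 \<le> D x" for x using D by (simp add: dominates_def)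
  have D0: "0 \<le> D x" for x using D1[of x] by simp
  have b1: "(D' n x)\<^sup>2 \<le> C\<^sup>2 * (D x)^4" if "th n \<in> ball \<theta> \<epsilon>" for n x
  proof -
    have "\<bar>D' n x\<bar>\<^sup>2 \<le> (C * (D x)^2)\<^sup>2"
      by (intro power_mono D'_bound[OF D] that) auto
    also have "\<dots> = C\<^sup>2 * (D x)^4" by (simp add: power_mult_distrib flip: power_mult)
    finally show ?thesis by simp
  qed
  have ts: "\<bar>t n \<bullet> s \<theta> x\<bar> \<le> C * D x" for n x
    using D \<epsilon> t_bound[of n] by (intro inner_s_abs_le) (auto simp: dominates_def)
  have b2: "(t n \<bullet> s \<theta> x)\<^sup>2 \<le> C\<^sup>2 * (D x)^4" for n x
  proof -
    have "\<bar>t n \<bullet> s \<theta> x\<bar>\<^sup>2 \<le> (C * D x)\<^sup>2"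
      by (intro power_mono ts) auto
    also have "\<dots> = C\<^sup>2 * (D x)^2" by (simp add: power_mult_distrib)
    also have "\<dots> \<le> C\<^sup>2 * (D x)^4"
      using D_pow_le[OF D, of 2 4] by (intro mult_left_mono) auto
    finally show ?thesis by simp
  qed
  have "(\<lambda>n. LINT x|P \<theta>. (D' n x)\<^sup>2 - (t n \<bullet> s \<theta> x)\<^sup>2) \<longlonglongrightarrow> (LINT x|P \<theta>. 0)"
  proof (rule path_dominated_convergence[OF D, where K="C\<^sup>2"])
    fix n x assume "th n \<in> ball \<theta> \<epsilon>"
    from b1[OF this, of x] b2[of n x] zero_le_power2[of "D' n x"] zero_le_power2[of "t n \<bullet> s \<theta> x"]
    have "\<bar>(D' n x)\<^sup>2 - (t n \<bullet> s \<theta> x)\<^sup>2\<bar> \<le> C\<^sup>2 * (D x)^4" by linarith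
    then show "norm ((D' n x)\<^sup>2 - (t n \<bullet> s \<theta> x)\<^sup>2) \<le> C\<^sup>2 * (D x)^4" by simp
  next
    fix x
    have "(\<lambda>n. (D' n x - t n \<bullet> s \<theta> x) * (D' n x - t n \<bullet> s \<theta> x)) \<longlonglongrightarrow> 0 * 0"
      by (intro tendsto_mult D'_tendsto)
    moreover have "(\<lambda>n. 2 * (t n \<bullet> s \<theta> x) * (D' n x - t n \<bullet> s \<theta> x)) \<longlonglongrightarrow> 0"
    proof (rule Lim_null_comparison)
      show "\<forall>\<^sub>F n in sequentially. norm (2 * (t n \<bullet> s \<theta> x) * (D' n x - t n \<bullet> s \<theta> x))
          \<le> 2 * (C * D x) * \<bar>D' n x - t n \<bullet> s \<theta> x\<bar>"
      proof (intro always_eventually allI)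
        fix n
        show "norm (2 * (t n \<bullet> s \<theta> x) * (D' n x - t n \<bullet> s \<theta> x)) \<le> 2 * (C * D x) * \<bar>D' n x - t n \<bullet> s \<theta> x\<bar>"
          unfolding real_norm_def abs_mult using ts[of n x] by (intro mult_right_mono) auto
      qed
      show "(\<lambda>n. 2 * (C * D x) * \<bar>D' n x - t n \<bullet> s \<theta> x\<bar>) \<longlonglongrightarrow> 0"
        using tendsto_mult[OF tendsto_const[of "2 * (C * D x)"] tendsto_rabs[OF D'_tendsto[of x]]] by simp
    qed
    ultimately have "(\<lambda>n. (D' n x - t n \<bullet> s \<theta> x) * (D' n x - t n \<bullet> s \<theta> x)
        + 2 * (t n \<bullet> s \<theta> x) * (D' n x - t n \<bullet> s \<theta> x)) \<longlonglongrightarrow> 0 * 0 + 0"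
      by (rule tendsto_add)
    moreover have "(d - e) * (d - e) + 2 * e * (d - e) = d\<^sup>2 - e\<^sup>2" for d e :: real
      by (simp add: power2_eq_square algebra_simps)
    ultimately show "(\<lambda>n. (D' n x)\<^sup>2 - (t n \<bullet> s \<theta> x)\<^sup>2) \<longlonglongrightarrow> 0"
      by simp
  next
    fix n assume "th n \<in> U"
    note [measurable] = D'_measurable[OF this]
    show "(\<lambda>x. (D' n x)\<^sup>2 - (t n \<bullet> s \<theta> x)\<^sup>2) \<in> borel_measurable M"
      by measurable
  qed simp
  moreover have "\<forall>\<^sub>F n in sequentially. (LINT x|P \<theta>. (D' n x)\<^sup>2 - (t n \<bullet> s \<theta> x)\<^sup>2)
      = (LINT x|P \<theta>. (D' n x)\<^sup>2) - info \<theta> (t n) (t n)"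
    using eventually_th[OF \<epsilon>(1)]
  proof eventually_elim
    case (elim n)
    then have "th n \<in> U" using \<epsilon> by auto
    note [measurable] = D'_measurable[OF this]
    have "integrable (P \<theta>) (\<lambda>x. (D' n x)\<^sup>2)"
      using b1[OF elim] by (intro dominates_integrable[OF D, where K="C\<^sup>2"]) auto
    moreover have "integrable (P \<theta>) (\<lambda>x. (t n \<bullet> s \<theta> x)\<^sup>2)"
      using b2 by (intro dominates_integrable[OF D, where K="C\<^sup>2"]) auto
    ultimately show ?case
      by (simp add: info_def power2_eq_square)
  qed
  ultimately show ?thesis
    using Lim_transform_eventually by fastforce
qed

end

section \<open>Characteristic functions of the normalised score\<close>

lemma iexp_remainder:
  fixes y :: real
  shows "norm (iexp y - 1 - \<i> * complex_of_real y) \<le> y\<^sup>2 / 2"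
    and "norm (iexp y - 1 - \<i> * complex_of_real y + complex_of_real (y\<^sup>2 / 2)) \<le> \<bar>y\<bar>^3 / 6"
proof -
  have 1: "(\<Sum>k\<le>1. (\<i> * complex_of_real y)^k / fact k) = 1 + \<i> * complex_of_real y"
    by simp
  show "norm (iexp y - 1 - \<i> * complex_of_real y) \<le> y\<^sup>2 / 2"
    using iexp_approx1[of y 1] unfolding 1 by (simp add: diff_diff_eq numeral_2_eq_2[symmetric])
  have 2: "(\<Sum>k\<le>2. (\<i> * complex_of_real y)^k / fact k) = 1 + \<i> * complex_of_real y - complex_of_real (y\<^sup>2 / 2)"
    by (simp add: numeral_2_eq_2) (simp add: power2_eq_square complex_eq_iff)
  have "\<bar>y\<bar>^Suc 2 / fact (Suc 2) = \<bar>y\<bar>^3/6"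
    by (simp add: numeral_3_eq_3[symmetric] fact_numeral)
  then show "norm (iexp y - 1 - \<i> * complex_of_real y + complex_of_real (y\<^sup>2 / 2)) \<le> \<bar>y\<bar>^3 / 6"
    using iexp_approx1[of y 2] unfolding 2 by (simp add: algebra_simps)
qed

text \<open>In the closed unit disc \<open>|w^n - z^n| \<le> n * |w - z|\<close>. With
  \<open>z = 1 + c / n\<close>, which lies in the disc once \<open>n \<ge> |c|\<close> because
  \<open>c \<le> 0\<close>, the right side is the error in \<open>lim\<close>.\<close>

lemma tendsto_power_exp:
  fixes w :: "nat \<Rightarrow> complex" and c :: real
  assumes w: "\<forall>\<^sub>F n in sequentially. norm (w n) \<le> 1" and c: "c \<le> 0"
    and lim: "(\<lambda>n. of_nat n * (w n - 1)) \<longlonglongrightarrow> complex_of_real c"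
  shows "(\<lambda>n. w n ^ n) \<longlonglongrightarrow> complex_of_real (exp c)"
proof (rule Lim_transform)
  show "(\<lambda>n. complex_of_real ((1 + c / n) ^ n)) \<longlonglongrightarrow> complex_of_real (exp c)"
    by (intro tendsto_of_real tendsto_exp_limit_sequentially)
  show "(\<lambda>n. w n ^ n - complex_of_real ((1 + c / n) ^ n)) \<longlonglongrightarrow> 0"
  proof (rule Lim_null_comparison)
    show "\<forall>\<^sub>F n in sequentially. norm (w n ^ n - complex_of_real ((1 + c / n) ^ n))
        \<le> norm (of_nat n * (w n - 1) - complex_of_real c)"
      using w eventually_ge_at_top[of "nat \<lceil>\<bar>c\<bar>\<rceil> + 1"]
    proof eventually_elim
      case (elim n)
      then have n: "\<bar>c\<bar> \<le> real n" "0 < real n" by linarith+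
      have "- 1 \<le> c / n" "c / n \<le> 0"
        using n c by (simp_all add: field_simps)
      then have "\<bar>1 + c / n\<bar> \<le> 1" by linarith
      then have "norm (complex_of_real (1 + c / n)) \<le> 1"
        by (simp only: norm_of_real)
      from norm_power_diff[OF elim(1) this, of n]
      have "norm (w n ^ n - complex_of_real ((1 + c / n) ^ n)) \<le> n * norm (w n - complex_of_real (1 + c / n))"
        by simp
      also have "\<dots> = norm (of_nat n * (w n - complex_of_real (1 + c / n)))"
        by (simp add: norm_mult)
      also have "of_nat n * (w n - complex_of_real (1 + c / n)) = of_nat n * (w n - 1) - complex_of_real c"
        using n by (simp add: field_simps)
      finally show ?case .
    qed
    show "(\<lambda>n. norm (of_nat n * (w n - 1) - complex_of_real c)) \<longlonglongrightarrow> 0"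
      using lim by (simp add: LIM_zero tendsto_norm_zero)
  qed
qed

context smooth_path_dir
begin

text \<open>\<open>phi n\<close> is centred under \<open>P (th n)\<close>, so the linear term
  integrates to 0 and only the remainder \<open>R\<close>, of order \<open>1 / n\<close>, is left.
  After the change to the fixed law \<open>P \<theta>\<close>, the quadratic bound on
  \<open>R\<close> supplies the majorant and the cubic bound the pointwise limit: dominated
  convergence takes the place of a Lindeberg condition.\<close>

lemma char_phi_limit:
  "(\<lambda>n. of_nat n * ((LINT x|P (th n). iexp (u * phi n x / sqrt (real n))) - 1))
     \<longlonglongrightarrow> complex_of_real (- (u\<^sup>2 * info \<theta> a0 a0 / 2))"
proof -
  obtain \<epsilon> D where D: "dominates \<epsilon> D" using dominates_ex by blast
  then have \<epsilon>: "0 < \<epsilon>" "ball \<theta> \<epsilon> \<subseteq> U" by (auto simp: dominates_def)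
  define R where "R y = iexp y - 1 - \<i> * complex_of_real y" for y
  have [measurable]: "R \<in> borel_measurable borel" unfolding R_def[abs_def] by measurable
  have R1: "norm (R y) \<le> y\<^sup>2 / 2" for y
    unfolding R_def by (rule iexp_remainder(1))
  have R2: "norm (R y + complex_of_real (y\<^sup>2 / 2)) \<le> \<bar>y\<bar>^3 / 6" for y
    unfolding R_def by (rule iexp_remainder(2))
  let ?y = "\<lambda>n x. u * phi n x / sqrt (real n)"
  define f where "f n x = of_nat n * (complex_of_real (r n x) * R (?y n x))" for n x
  have "(\<lambda>n. LINT x|P \<theta>. f n x) \<longlonglongrightarrow> (LINT x|P \<theta>. complex_of_real (- (u\<^sup>2 * (phi0 x * phi0 x) / 2)))"
  proof (rule path_dominated_convergence[OF D, where K="u\<^sup>2 * A\<^sup>2"])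
    fix n x assume n: "1 \<le> n" and thn: "th n \<in> ball \<theta> \<epsilon>"
    have U: "th n \<in> U" using thn \<epsilon> by auto
    have r: "0 \<le> r n x" "r n x \<le> D x"
      using D thn p_pos[OF \<theta>_in, of x] p_pos[OF U, of x]
      by (auto simp: r_def dominates_def divide_le_eq)
    have "norm (f n x) = real n * (r n x * norm (R (?y n x)))"
      using r by (simp add: f_def norm_mult)
    also have "\<dots> \<le> real n * (D x * ((?y n x)\<^sup>2 / 2))"
      using r R1 by (intro mult_left_mono mult_mono) auto
    also have "\<dots> = D x * (u\<^sup>2 * \<bar>phi n x\<bar>\<^sup>2) / 2"
      using n by (simp add: power_divide power_mult_distrib)
    also have "\<dots> \<le> D x * (u\<^sup>2 * (A * D x)\<^sup>2)"
    proof -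
      have "\<bar>phi n x\<bar>\<^sup>2 \<le> (A * D x)\<^sup>2"
        by (intro power_mono phi_bound[OF D] thn) auto
      then have "D x * (u\<^sup>2 * \<bar>phi n x\<bar>\<^sup>2) \<le> D x * (u\<^sup>2 * (A * D x)\<^sup>2)"
        using r by (intro mult_left_mono) auto
      moreover have "0 \<le> D x * (u\<^sup>2 * \<bar>phi n x\<bar>\<^sup>2)"
        using r by auto
      ultimately show ?thesis by linarith
    qed
    also have "\<dots> = (u\<^sup>2 * A\<^sup>2) * (D x)^3"
      by (simp add: power_mult_distrib power2_eq_square power3_eq_cube)
    also have "\<dots> \<le> (u\<^sup>2 * A\<^sup>2) * (D x)^4"
      using D_pow_le[OF D, of 3 4] by (intro mult_left_mono) auto
    finally show "norm (f n x) \<le> u\<^sup>2 * A\<^sup>2 * D x ^ 4" .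
  next
    fix x
    have "(\<lambda>n. of_nat n * R (?y n x) + complex_of_real (u\<^sup>2 * (phi n x)\<^sup>2 / 2)) \<longlonglongrightarrow> 0"
    proof (rule Lim_null_comparison)
      show "\<forall>\<^sub>F n in sequentially. norm (of_nat n * R (?y n x) + complex_of_real (u\<^sup>2 * (phi n x)\<^sup>2 / 2))
          \<le> \<bar>u * phi n x\<bar>^3 / 6 * (1 / sqrt (real n))"
        using eventually_ge_at_top[of 1]
      proof eventually_elim
        case (elim n)
        have e: "u\<^sup>2 * (phi n x)\<^sup>2 / 2 = real n * ((?y n x)\<^sup>2 / 2)"
          using elim by (simp add: power_divide power_mult_distrib)
        have "of_nat n * R (?y n x) + complex_of_real (u\<^sup>2 * (phi n x)\<^sup>2 / 2)
            = of_nat n * (R (?y n x) + complex_of_real ((?y n x)\<^sup>2 / 2))"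
          unfolding e by (simp only: of_real_mult of_real_of_nat_eq distrib_left)
        then have "norm (of_nat n * R (?y n x) + complex_of_real (u\<^sup>2 * (phi n x)\<^sup>2 / 2)) \<le> real n * (\<bar>?y n x\<bar>^3 / 6)"
          using R2[of "?y n x"] by (simp only: norm_mult norm_of_nat) (intro mult_left_mono, auto)
        also have "\<dots> = \<bar>u * phi n x\<bar>^3 / 6 * (1 / sqrt (real n))"
        proof -
          have "real n = sqrt (real n) * sqrt (real n)" by simp
          moreover have "sqrt (real n) > 0" using elim by simp
          moreover have "a * a * (\<bar>b / a\<bar>^3 / 6) = \<bar>b\<bar>^3 / 6 * (1 / a)" if "a > 0" for a b :: real
            using that by (simp add: power3_eq_cube field_simps)
          ultimately show ?thesis by metis
        qed
        finally show ?case .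
      qed
      have "(\<lambda>n. \<bar>u * phi n x\<bar>^3 / 6 * (1 / sqrt (real n))) \<longlonglongrightarrow> \<bar>u * phi0 x\<bar>^3 / 6 * 0"
        by (intro tendsto_intros phi_tendsto) (auto, real_asymp?)
      then show "(\<lambda>n. \<bar>u * phi n x\<bar>^3 / 6 * (1 / sqrt (real n))) \<longlonglongrightarrow> 0"
        by simp
    qed
    moreover have "(\<lambda>n. complex_of_real (u\<^sup>2 * (phi n x)\<^sup>2 / 2)) \<longlonglongrightarrow> complex_of_real (u\<^sup>2 * (phi0 x)\<^sup>2 / 2)"
      by (intro tendsto_intros phi_tendsto) auto
    ultimately have "(\<lambda>n. (of_nat n * R (?y n x) + complex_of_real (u\<^sup>2 * (phi n x)\<^sup>2 / 2))
        - complex_of_real (u\<^sup>2 * (phi n x)\<^sup>2 / 2)) \<longlonglongrightarrow> 0 - complex_of_real (u\<^sup>2 * (phi0 x)\<^sup>2 / 2)"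
      by (rule tendsto_diff)
    from tendsto_mult[OF tendsto_of_real[OF r_tendsto[of x]] this]
    show "(\<lambda>n. f n x) \<longlonglongrightarrow> complex_of_real (- (u\<^sup>2 * (phi0 x * phi0 x) / 2))"
      by (simp add: f_def power2_eq_square algebra_simps)
  next
    show "(\<lambda>x. complex_of_real (- (u\<^sup>2 * (phi0 x * phi0 x) / 2))) \<in> borel_measurable M"
      using phi0_measurable by measurable
    fix n assume "th n \<in> U"
    note [measurable] = phi_measurable[OF this] r_measurable[OF this]
    show "f n \<in> borel_measurable M"
      unfolding f_def[abs_def] by measurable
  qed
  moreover have "(LINT x|P \<theta>. complex_of_real (- (u\<^sup>2 * (phi0 x * phi0 x) / 2))) = complex_of_real (- (u\<^sup>2 * info \<theta> a0 a0 / 2))"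
    unfolding integral_complex_of_real info_def phi0_def by simp
  moreover have "\<forall>\<^sub>F n in sequentially. (LINT x|P \<theta>. f n x)
      = of_nat n * ((LINT x|P (th n). iexp (?y n x)) - 1)"
    using eventually_th[OF \<epsilon>(1)]
  proof eventually_elim
    case (elim n)
    then have U: "th n \<in> U" using \<epsilon> by auto
    note [measurable] = phi_measurable[OF this] r_measurable[OF this]
    interpret P2: prob_space "P (th n)" using prob_space_P[OF U] .
    have meas: "(\<lambda>x. R (?y n x)) \<in> borel_measurable M"
      by measurable
    have int: "integrable (P (th n)) (\<lambda>x. iexp (?y n x))"
      by (rule P2.integrable_iexp) auto
    have int2: "integrable (P (th n)) (phi n)" "(LINT x|P (th n). phi n x) = 0"
      using score_prod_integrable(2)[OF U, of "a n"] score_mean_zero[OF U, of "a n"]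
      by (simp_all add: phi_def[abs_def])
    have *: "(LINT x|P (th n). iexp (y x) - 1 - \<i> * complex_of_real (y x)) = (LINT x|P (th n). iexp (y x)) - 1"
      if "integrable (P (th n)) (\<lambda>x. iexp (y x))" "integrable (P (th n)) y" "(LINT x|P (th n). y x) = 0"
      for y :: "'x \<Rightarrow> real"
    proof -
      have "(LINT x|P (th n). complex_of_real (y x)) = 0"
        unfolding integral_complex_of_real that(3) by simp
      then show ?thesis
        using that P2.prob_space by simp
    qed
    have "(LINT x|P (th n). R (?y n x)) = (LINT x|P (th n). iexp (?y n x)) - 1"
      unfolding R_def by (rule *[OF int]) (use int2 in auto)
    moreover have "(LINT x|P (th n). R (?y n x)) = (LINT x|P \<theta>. complex_of_real (r n x) * R (?y n x))"
      using integral_P_change(1)[OF \<theta>_in U meas] by (simp add: r_def scaleR_conv_of_real)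
    ultimately show ?case
      unfolding f_def by simp
  qed
  ultimately show ?thesis
    using Lim_transform_eventually by fastforce
qed

end

context smooth_model
begin

lemma info_commute: "info \<theta> a b = info \<theta> b a"
  by (simp add: info_def mult.commute)

lemma info_add_right: "\<theta> \<in> U \<Longrightarrow> info \<theta> a (b + c) = info \<theta> a b + info \<theta> a c"
  using score_prod_integrable(1)[of \<theta>] by (simp add: info_def inner_add_left distrib_left)

lemma info_scale_right: "info \<theta> a (c *\<^sub>R b) = c * info \<theta> a b"
  by (simp add: info_def mult.left_commute)

lemma info_nonneg: "0 \<le> info \<theta> a a"
  by (simp add: info_def)

text \<open>The law moves with the parameter; rewriting over the fixed \<open>P \<theta>\<close>
  costs a density ratio bounded by \<open>D\<close>, so a multiple of \<open>D^3\<close>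
  dominates.\<close>

lemma info_continuous: "continuous_on U (\<lambda>\<theta>. info \<theta> a b)"
  unfolding continuous_on_sequentially
proof (intro allI ballI impI, elim conjE)
  fix \<theta>s \<theta> assume \<theta>: "\<theta> \<in> U" and \<theta>s: "\<forall>n. \<theta>s n \<in> U" and lim: "\<theta>s \<longlonglongrightarrow> \<theta>"
  \<comment> \<open>The zero path only gives access to \<open>dominates\<close>; the given sequence
    \<open>\<theta>s\<close> may approach \<open>\<theta>\<close> at any rate.\<close>
  interpret smooth_path M U p s \<theta> "\<lambda>_. 0" "norm (0::'p)"
    using smooth_path_const[OF \<theta>] .
  obtain \<epsilon> D where "dominates \<epsilon> D" using dominates_ex by blast
  then have D: "0 < \<epsilon>" "D \<in> borel_measurable M" "ball \<theta> \<epsilon> \<subseteq> U"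
    "\<And>x. 1 \<le> D x" "\<And>k. k \<le> 4 \<Longrightarrow> integrable (P \<theta>) (\<lambda>x. (D x)^k)"
    "\<And>\<theta>' x. \<theta>' \<in> ball \<theta> \<epsilon> \<Longrightarrow> norm (s \<theta>' x) \<le> D x"
    "\<And>\<theta>' x. \<theta>' \<in> ball \<theta> \<epsilon> \<Longrightarrow> p \<theta>' x \<le> D x * p \<theta> x"
    unfolding dominates_def by blast+
  have D0: "0 \<le> D x" for x using D(4)[of x] by simp
  define f where "f n x = (p (\<theta>s n) x / p \<theta> x) * ((a \<bullet> s (\<theta>s n) x) * (b \<bullet> s (\<theta>s n) x))" for n x
  have ev: "\<forall>\<^sub>F n in sequentially. \<theta>s n \<in> ball \<theta> \<epsilon>"
    using lim D(1) by (auto simp: tendsto_iff dist_commute)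
  have meas[measurable]: "f n \<in> borel_measurable M" for n
  proof -
    have U: "\<theta>s n \<in> U" using \<theta>s by auto
    note [measurable] = inner_s_measurable[OF U] p_measurable[OF U] p_measurable[OF \<theta>]
    show ?thesis unfolding f_def[abs_def] by measurable
  qed
  have "(\<lambda>n. integral\<^sup>L (P \<theta>) (f n)) \<longlonglongrightarrow> (LINT x|P \<theta>. (a \<bullet> s \<theta> x) * (b \<bullet> s \<theta> x))"
  proof (rule dominated_convergence_eventually)
    show "(\<lambda>x. (a \<bullet> s \<theta> x) * (b \<bullet> s \<theta> x)) \<in> borel_measurable (P \<theta>)"
      using inner_s_measurable[OF \<theta>, of a] inner_s_measurable[OF \<theta>, of b] by measurable
    show "integrable (P \<theta>) (\<lambda>x. norm a * norm b * D x ^ 3)"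
      using D(5)[of 3] by simp
    show "\<forall>\<^sub>F n in sequentially. f n \<in> borel_measurable (P \<theta>) \<and>
        (\<forall>x\<in>space (P \<theta>). norm (f n x) \<le> norm a * norm b * D x ^ 3)"
      using ev
    proof eventually_elim
      case (elim n)
      have "norm (f n x) \<le> norm a * norm b * D x ^ 3" for x
      proof -
        have "0 < p (\<theta>s n) x" "0 < p \<theta> x" using p_pos \<theta>s \<theta> by auto
        then have "\<bar>p (\<theta>s n) x / p \<theta> x\<bar> \<le> D x"
          using D(7)[OF elim, of x] by (simp add: divide_le_eq)
        then have "\<bar>p (\<theta>s n) x / p \<theta> x\<bar> * (\<bar>a \<bullet> s (\<theta>s n) x\<bar> * \<bar>b \<bullet> s (\<theta>s n) x\<bar>)
            \<le> D x * ((norm a * D x) * (norm b * D x))"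
          using D0[of x] D(6)[OF elim, of x] by (intro mult_mono inner_s_abs_le) auto
        then show ?thesis
          by (simp add: f_def abs_mult power3_eq_cube algebra_simps)
      qed
      moreover have "f n \<in> borel_measurable (P \<theta>)" by measurable
      ultimately show ?case by blast
    qed
    fix x
    have pc: "isCont (\<lambda>\<theta>. p \<theta> x) \<theta>"
      using p_deriv[OF \<theta>] by (rule has_derivative_continuous)
    have "(\<lambda>n. f n x) \<longlonglongrightarrow> (p \<theta> x / p \<theta> x) * ((a \<bullet> s \<theta> x) * (b \<bullet> s \<theta> x))"
      unfolding f_def using p_pos[OF \<theta>, of x]
      by (intro tendsto_mult tendsto_divide tendsto_inner tendsto_const
          isCont_tendsto_compose[OF pc lim] isCont_tendsto_compose[OF s_cont[OF \<theta>] lim]) auto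
    then show "(\<lambda>n. f n x) \<longlonglongrightarrow> (a \<bullet> s \<theta> x) * (b \<bullet> s \<theta> x)"
      using p_pos[OF \<theta>, of x] by simp
  qed
  moreover have "integral\<^sup>L (P \<theta>) (f n) = info (\<theta>s n) a b" for n
  proof -
    have U: "\<theta>s n \<in> U" using \<theta>s by auto
    have "(\<lambda>x. (a \<bullet> s (\<theta>s n) x) * (b \<bullet> s (\<theta>s n) x)) \<in> borel_measurable M"
      using inner_s_measurable[OF U, of a] inner_s_measurable[OF U, of b] by measurable
    from integral_P_change(1)[OF \<theta> U this] show ?thesis
      by (simp add: info_def f_def[abs_def])
  qed
  ultimately show "((\<lambda>\<theta>. info \<theta> a b) \<circ> \<theta>s) \<longlonglongrightarrow> info \<theta> a b"
    by (simp add: info_def[of \<theta>] comp_def)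
qed

end

section \<open>Product laws, sums of independent terms and likelihood ratios\<close>

context smooth_model
begin

definition Pn where "Pn n \<theta> = (\<Pi>\<^sub>M j\<in>{..<n}. P \<theta>)" for n :: nat

lemma sets_Pn [measurable_cong]: "sets (Pn n \<theta>) = sets (\<Pi>\<^sub>M j\<in>{..<n}. M)"
  unfolding Pn_def by (intro sets_PiM_cong) auto

lemma space_Pn: "space (Pn n \<theta>) = space (\<Pi>\<^sub>M j\<in>{..<n}. M)"
  by (rule sets_eq_imp_space_eq) (rule sets_Pn)

lemma prob_space_Pn: "\<theta> \<in> U \<Longrightarrow> prob_space (Pn n \<theta>)"
  unfolding Pn_def by (intro prob_space_PiM prob_space_P)

lemma product_prob_space_P: "\<theta> \<in> U \<Longrightarrow> product_prob_space (\<lambda>_::nat. P \<theta>)"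
  using prob_space_P[of \<theta>]
  by (auto simp: product_prob_space_def product_sigma_finite_def product_prob_space_axioms_def
      intro: prob_space_imp_sigma_finite)

lemma coordinate_measurable:
  assumes "f \<in> measurable M N" "j < n"
  shows "(\<lambda>X. f (X j)) \<in> measurable (Pn n \<theta>) N"
proof -
  have "(\<lambda>X. X j) \<in> measurable (Pn n \<theta>) M"
    using assms(2) by (subst measurable_cong_sets[OF sets_Pn refl]) (auto intro: measurable_component_singleton)
  from measurable_compose[OF this assms(1)] show ?thesis .
qed

lemma coordinate_sum_measurable:
  fixes f :: "'x \<Rightarrow> real"
  assumes "f \<in> borel_measurable M"
  shows "(\<lambda>X. \<Sum>j<n. f (X j)) \<in> borel_measurable (Pn n \<theta>)"
  using coordinate_measurable[OF assms] by (intro borel_measurable_sum) auto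

lemma Pn_prod_integral:
  fixes f :: "nat \<Rightarrow> 'x \<Rightarrow> 'b::{real_normed_field,banach,second_countable_topology}"
  assumes "\<theta> \<in> U" "\<And>j. j < n \<Longrightarrow> integrable (P \<theta>) (f j)"
  shows "(LINT X|Pn n \<theta>. (\<Prod>j<n. f j (X j))) = (\<Prod>j<n. LINT x|P \<theta>. f j x)"
    and "integrable (Pn n \<theta>) (\<lambda>X. \<Prod>j<n. f j (X j))"
proof -
  interpret product_prob_space "\<lambda>_::nat. P \<theta>"
    using product_prob_space_P[OF assms(1)] .
  show "(LINT X|Pn n \<theta>. (\<Prod>j<n. f j (X j))) = (\<Prod>j<n. LINT x|P \<theta>. f j x)"
    unfolding Pn_def by (rule product_integral_prod) (use assms(2) in auto)
  show "integrable (Pn n \<theta>) (\<lambda>X. \<Prod>j<n. f j (X j))"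
    unfolding Pn_def by (rule product_integrable_prod) (use assms(2) in auto)
qed

lemma Pn_two_integral:
  fixes f :: "'x \<Rightarrow> real"
  assumes "\<theta> \<in> U" "i < n" "j < n" "i \<noteq> j" "integrable (P \<theta>) f"
  shows "(LINT X|Pn n \<theta>. f (X i) * f (X j)) = (LINT x|P \<theta>. f x)\<^sup>2"
    and "integrable (Pn n \<theta>) (\<lambda>X. f (X i) * f (X j))"
proof -
  interpret prob_space "P \<theta>" using prob_space_P[OF assms(1)] .
  \<comment> \<open>All other factors are set to 1, so that the product formula isolates the two
    coordinates.\<close>
  define g where "g k = (if k = i \<or> k = j then f else (\<lambda>_. 1))" for k
  have pr: "(\<Prod>k<n. h k) = h i * h j" if "\<And>k. k \<noteq> i \<Longrightarrow> k \<noteq> j \<Longrightarrow> h k = 1" for h :: "nat \<Rightarrow> real"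
  proof -
    have "(\<Prod>k<n. h k) = (\<Prod>k\<in>{i, j}. h k)"
      using assms that by (intro prod.mono_neutral_right) auto
    then show ?thesis using assms(4) by simp
  qed
  have eq: "(\<Prod>k<n. g k (X k)) = f (X i) * f (X j)" for X :: "nat \<Rightarrow> 'x"
    by (subst pr) (auto simp: g_def)
  have int: "integrable (P \<theta>) (g k)" for k
    using assms(5) by (simp add: g_def)
  have "(\<Prod>k<n. LINT x|P \<theta>. g k x) = (LINT x|P \<theta>. f x)\<^sup>2"
    using prob_space by (subst pr) (auto simp: g_def power2_eq_square)
  then show "(LINT X|Pn n \<theta>. f (X i) * f (X j)) = (LINT x|P \<theta>. f x)\<^sup>2"
    using Pn_prod_integral(1)[OF assms(1), of n g] int by (simp add: eq)
  show "integrable (Pn n \<theta>) (\<lambda>X. f (X i) * f (X j))"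
    using Pn_prod_integral(2)[OF assms(1), of n g] int by (simp add: eq)
qed

lemma Pn_one_integral:
  fixes f :: "'x \<Rightarrow> real"
  assumes "\<theta> \<in> U" "i < n" "integrable (P \<theta>) f"
  shows "(LINT X|Pn n \<theta>. f (X i)) = (LINT x|P \<theta>. f x)"
    and "integrable (Pn n \<theta>) (\<lambda>X. f (X i))"
proof -
  have "P \<theta> = distr (Pn n \<theta>) (P \<theta>) (\<lambda>X. X i)"
    unfolding Pn_def using assms by (subst distr_PiM_component) (auto intro: prob_space_P)
  moreover have m: "(\<lambda>X. X i) \<in> measurable (Pn n \<theta>) (P \<theta>)"
    unfolding Pn_def using assms by (intro measurable_component_singleton) auto
  moreover have "f \<in> borel_measurable (P \<theta>)"
    using assms(3) by auto
  ultimately show "(LINT X|Pn n \<theta>. f (X i)) = (LINT x|P \<theta>. f x)"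
      "integrable (Pn n \<theta>) (\<lambda>X. f (X i))"
    using integral_distr[OF m, of f] integrable_distr_eq[OF m, of f] assms(3) by simp_all
qed

lemma Pn_sum_square:
  fixes f :: "'x \<Rightarrow> real"
  assumes "\<theta> \<in> U" "integrable (P \<theta>) f" "integrable (P \<theta>) (\<lambda>x. (f x)\<^sup>2)" "(LINT x|P \<theta>. f x) = 0"
  shows "(LINT X|Pn n \<theta>. (\<Sum>j<n. f (X j))\<^sup>2) = real n * (LINT x|P \<theta>. (f x)\<^sup>2)"
    and "integrable (Pn n \<theta>) (\<lambda>X. (\<Sum>j<n. f (X j))\<^sup>2)"
proof -
  have eq: "(\<Sum>j<n. f (X j))\<^sup>2 = (\<Sum>i<n. \<Sum>j<n. f (X i) * f (X j))" for X :: "nat \<Rightarrow> 'x"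
    by (simp add: power2_eq_square sum_product)
  have ij: "integrable (Pn n \<theta>) (\<lambda>X. f (X i) * f (X j)) \<and>
      (LINT X|Pn n \<theta>. f (X i) * f (X j)) = (if j = i then (LINT x|P \<theta>. (f x)\<^sup>2) else 0)"
    if "i < n" "j < n" for i j
  proof (cases "i = j")
    case True
    then show ?thesis
      using Pn_one_integral[OF assms(1) that(1) assms(3)] by (simp add: power2_eq_square)
  next
    case False
    then show ?thesis
      using Pn_two_integral[OF assms(1) that False assms(2)] assms(4) by simp
  qed
  show "integrable (Pn n \<theta>) (\<lambda>X. (\<Sum>j<n. f (X j))\<^sup>2)"
    unfolding eq using ij by (intro Bochner_Integration.integrable_sum) auto
  have "(LINT X|Pn n \<theta>. (\<Sum>j<n. f (X j))\<^sup>2) = (\<Sum>i<n. LINT X|Pn n \<theta>. (\<Sum>j<n. f (X i) * f (X j)))"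
    unfolding eq using ij by (intro Bochner_Integration.integral_sum Bochner_Integration.integrable_sum) auto
  also have "\<dots> = (\<Sum>i<n. \<Sum>j<n. LINT X|Pn n \<theta>. f (X i) * f (X j))"
    using ij by (intro sum.cong refl Bochner_Integration.integral_sum) auto
  also have "\<dots> = (\<Sum>i<n. \<Sum>j<n. if j = i then (LINT x|P \<theta>. (f x)\<^sup>2) else 0)"
    using ij by (intro sum.cong) auto
  also have "\<dots> = real n * (LINT x|P \<theta>. (f x)\<^sup>2)"
    by simp
  finally show "(LINT X|Pn n \<theta>. (\<Sum>j<n. f (X j))\<^sup>2) = real n * (LINT x|P \<theta>. (f x)\<^sup>2)" .
qed

lemma Pn_sum_tail:
  fixes f :: "'x \<Rightarrow> real"
  assumes "\<theta> \<in> U" "integrable (P \<theta>) f" "integrable (P \<theta>) (\<lambda>x. (f x)\<^sup>2)" "(LINT x|P \<theta>. f x) = 0"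
    and "0 < \<eta>"
  shows "measure (Pn n \<theta>) {X \<in> space (Pn n \<theta>). \<eta> \<le> \<bar>(1 / sqrt (real n)) * (\<Sum>j<n. f (X j))\<bar>}
     \<le> (LINT x|P \<theta>. (f x)\<^sup>2) / \<eta>\<^sup>2"
proof -
  interpret prob_space "Pn n \<theta>" using prob_space_Pn[OF assms(1)] .
  let ?S = "\<lambda>X. (1 / sqrt (real n)) * (\<Sum>j<n. f (X j))"
  have eq: "(?S X)\<^sup>2 = (\<Sum>j<n. f (X j))\<^sup>2 / real n" for X
    by (simp add: power_divide)
  have [measurable]: "(\<lambda>X. \<Sum>j<n. f (X j)) \<in> borel_measurable (Pn n \<theta>)"
    using assms(2) by (intro coordinate_sum_measurable) auto
  have "prob {X \<in> space (Pn n \<theta>). \<eta> \<le> \<bar>?S X\<bar>} \<le> expectation (\<lambda>X. (?S X)\<^sup>2) / \<eta>\<^sup>2"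
    using Pn_sum_square(2)[OF assms(1-4), of n] assms(5)
    by (intro second_moment_method) (auto simp: power_divide)
  also have "expectation (\<lambda>X. (?S X)\<^sup>2) \<le> (LINT x|P \<theta>. (f x)\<^sup>2)"
    unfolding eq using Pn_sum_square(1)[OF assms(1-4), of n] by simp
  finally show ?thesis
    using assms(5) by (simp add: divide_right_mono)
qed

definition LR where "LR \<theta> \<theta>' n X = (\<Prod>j<n. p \<theta>' (X j) / p \<theta> (X j))" for n :: nat

lemma LR_measurable:
  assumes "\<theta> \<in> U" "\<theta>' \<in> U"
  shows "LR \<theta> \<theta>' n \<in> borel_measurable (Pn n \<theta>'')"
proof -
  have "(\<lambda>x. p \<theta>' x / p \<theta> x) \<in> borel_measurable M"
    using assms p_measurable by measurable
  from coordinate_measurable[OF this] show ?thesis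
    unfolding LR_def[abs_def] by (intro borel_measurable_prod) auto
qed

lemma Pn_eq_density:
  assumes "\<theta> \<in> U" "\<theta>' \<in> U"
  shows "Pn n \<theta>' = density (Pn n \<theta>) (\<lambda>X. ennreal (LR \<theta> \<theta>' n X))"
proof -
  interpret A: product_prob_space "\<lambda>_::nat. P \<theta>"
    using product_prob_space_P[OF assms(1)] .
  interpret B: product_prob_space "\<lambda>_::nat. P \<theta>'"
    using product_prob_space_P[OF assms(2)] .
  let ?q = "\<lambda>x. p \<theta>' x / p \<theta> x"
  have q[measurable]: "?q \<in> borel_measurable M"
    using assms p_measurable by measurable
  have q0: "0 \<le> ?q x" for x
    using p_pos[OF assms(1), of x] p_pos[OF assms(2), of x] by simp
  have [measurable]: "LR \<theta> \<theta>' n \<in> borel_measurable (Pn n \<theta>)"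
    by (rule LR_measurable[OF assms])
  have "density (Pn n \<theta>) (\<lambda>X. ennreal (LR \<theta> \<theta>' n X)) = (\<Pi>\<^sub>M j\<in>{..<n}. P \<theta>')"
  proof (rule B.PiM_eqI)
    show "sets (density (Pn n \<theta>) (\<lambda>X. ennreal (LR \<theta> \<theta>' n X))) = sets (Pi\<^sub>M {..<n} (\<lambda>j. P \<theta>'))"
      by (simp add: sets_Pn cong: sets_PiM_cong)
    fix A assume A: "\<And>i. i \<in> {..<n} \<Longrightarrow> A i \<in> sets (P \<theta>')"
    then have [measurable]: "i < n \<Longrightarrow> A i \<in> sets M" for i by simp
    have box: "Pi\<^sub>E {..<n} A \<in> sets (Pn n \<theta>)"
      unfolding Pn_def using A by (intro sets_PiM_I_finite) auto
    have "emeasure (density (Pn n \<theta>) (\<lambda>X. ennreal (LR \<theta> \<theta>' n X))) (Pi\<^sub>E {..<n} A)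
        = (\<integral>\<^sup>+X. ennreal (LR \<theta> \<theta>' n X) * indicator (Pi\<^sub>E {..<n} A) X \<partial>Pn n \<theta>)"
      using box by (subst emeasure_density) auto
    also have "\<dots> = (\<integral>\<^sup>+X. (\<Prod>j<n. ennreal (?q (X j)) * indicator (A j) (X j)) \<partial>Pn n \<theta>)"
    proof (rule nn_integral_cong)
      \<comment> \<open>Points of the product space are extensional, so the indicator of the box
        factors into indicators of the coordinates below \<open>n\<close>.\<close>
      fix X assume "X \<in> space (Pn n \<theta>)"
      then have ext: "X \<in> extensional {..<n}" by (auto simp: space_Pn space_PiM PiE_def)
      have "(indicator (Pi\<^sub>E {..<n} A) X :: ennreal) = (\<Prod>j<n. indicator (A j) (X j))"
      proof (cases "\<forall>j<n. X j \<in> A j")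
        case True
        then have "X \<in> Pi\<^sub>E {..<n} A" using ext by (auto simp: PiE_def)
        with True show ?thesis by simp
      next
        case False
        then obtain j where j: "j < n" "X j \<notin> A j" by auto
        then have "X \<notin> Pi\<^sub>E {..<n} A" by auto
        moreover have "(\<Prod>j<n. indicator (A j) (X j)) = (0::ennreal)"
          using j by (intro prod_zero bexI[of _ j]) auto
        ultimately show ?thesis by simp
      qed
      moreover have "ennreal (LR \<theta> \<theta>' n X) = (\<Prod>j<n. ennreal (?q (X j)))"
        unfolding LR_def using q0 by (simp add: prod_ennreal)
      ultimately show "ennreal (LR \<theta> \<theta>' n X) * indicator (Pi\<^sub>E {..<n} A) X
          = (\<Prod>j<n. ennreal (?q (X j)) * indicator (A j) (X j))"
        by (simp add: prod.distrib)
    qed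
    also have "\<dots> = (\<Prod>j<n. \<integral>\<^sup>+x. ennreal (?q x) * indicator (A j) x \<partial>P \<theta>)"
      unfolding Pn_def by (rule A.product_nn_integral_prod) auto
    also have "\<dots> = (\<Prod>j<n. emeasure (P \<theta>') (A j))"
      unfolding P_eq_density[OF assms] by (intro prod.cong refl, subst emeasure_density) auto
    finally show "emeasure (density (Pn n \<theta>) (\<lambda>X. ennreal (LR \<theta> \<theta>' n X))) (Pi\<^sub>E {..<n} A)
        = (\<Prod>i\<in>{..<n}. emeasure (P \<theta>') (A i))" .
  qed simp
  then show ?thesis by (simp add: Pn_def)
qed

text \<open>The Hammersley--Chapman--Robbins inequality; the last factor is the chi-square divergence of
  the product laws.\<close>

lemma Pn_change_bound:
  assumes "\<theta> \<in> U" "\<theta>' \<in> U"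
    and chi: "integrable (P \<theta>) (\<lambda>x. (p \<theta>' x / p \<theta> x - 1)\<^sup>2)"
    and g: "g \<in> borel_measurable (Pn n \<theta>)" and B: "\<And>X. \<bar>g X\<bar> \<le> B"
  shows "((LINT X|Pn n \<theta>'. g X) - (LINT X|Pn n \<theta>. g X))\<^sup>2
    \<le> ((LINT X|Pn n \<theta>. (g X)\<^sup>2) - (LINT X|Pn n \<theta>. g X)\<^sup>2)
       * ((1 + (LINT x|P \<theta>. (p \<theta>' x / p \<theta> x - 1)\<^sup>2)) ^ n - 1)"
proof -
  interpret P1: prob_space "P \<theta>" using prob_space_P[OF assms(1)] .
  interpret P2: prob_space "P \<theta>'" using prob_space_P[OF assms(2)] .
  interpret N: prob_space "Pn n \<theta>" using prob_space_Pn[OF assms(1)] .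
  let ?q = "\<lambda>x. p \<theta>' x / p \<theta> x" and ?L = "LR \<theta> \<theta>' n"
  have [measurable]: "?q \<in> borel_measurable M"
    using assms p_measurable by measurable
  note [measurable] = g LR_measurable[OF assms(1,2), of n \<theta>]
  have q0: "0 < ?q x" for x
    using p_pos[OF assms(1), of x] p_pos[OF assms(2), of x] by simp
  have L0: "0 \<le> ?L X" for X
    unfolding LR_def using q0 by (intro prod_nonneg) (auto intro: less_imp_le)
  have q1: "integrable (P \<theta>) ?q" "(LINT x|P \<theta>. ?q x) = 1"
    using integral_P_change[OF assms(1,2), of "\<lambda>_. 1::real"] P2.prob_space by simp_all
  have "integrable (P \<theta>) (\<lambda>x. (q x)\<^sup>2) \<and> (LINT x|P \<theta>. (q x)\<^sup>2) = 1 + (LINT x|P \<theta>. (q x - 1)\<^sup>2)"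
    if "integrable (P \<theta>) q" "(LINT x|P \<theta>. q x) = 1" "integrable (P \<theta>) (\<lambda>x. (q x - 1)\<^sup>2)" for q :: "'x \<Rightarrow> real"
  proof -
    have "(q x)\<^sup>2 = (q x - 1)\<^sup>2 + 2 * q x - 1" for x
      by (simp add: power2_eq_square algebra_simps)
    then show ?thesis
      using that P1.prob_space by simp
  qed
  from this[OF q1 chi]
  have q2: "integrable (P \<theta>) (\<lambda>x. (?q x)\<^sup>2)"
      "(LINT x|P \<theta>. (?q x)\<^sup>2) = 1 + (LINT x|P \<theta>. (?q x - 1)\<^sup>2)"
    by blast+
  have LL: "(?L X)\<^sup>2 = (\<Prod>j<n. (?q (X j))\<^sup>2)" for X
    by (simp add: LR_def prod_power_distrib)
  have L2: "integrable (Pn n \<theta>) (\<lambda>X. (?L X)\<^sup>2)"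
      "(LINT X|Pn n \<theta>. (?L X)\<^sup>2) = (1 + (LINT x|P \<theta>. (?q x - 1)\<^sup>2)) ^ n"
    unfolding LL using Pn_prod_integral[OF assms(1), of n "\<lambda>_ x. (?q x)\<^sup>2"] q2 by simp_all
  have L1: "integrable (Pn n \<theta>) ?L" "(LINT X|Pn n \<theta>. ?L X) = 1"
    unfolding LR_def[abs_def] using Pn_prod_integral[OF assms(1), of n "\<lambda>_ x. ?q x"] q1 by simp_all
  have g1: "integrable (Pn n \<theta>) g"
    by (rule N.integrable_const_bound[where B=B]) (use B in auto)
  have g2: "integrable (Pn n \<theta>) (\<lambda>X. (g X)\<^sup>2)"
  proof (rule N.integrable_const_bound[where B="B\<^sup>2"])
    have "\<bar>g X\<bar>\<^sup>2 \<le> B\<^sup>2" for X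
      using B by (intro power_mono) auto
    then show "AE X in Pn n \<theta>. norm ((g X)\<^sup>2) \<le> B\<^sup>2" by simp
  qed measurable
  have Lg: "integrable (Pn n \<theta>) (\<lambda>X. g X * ?L X)"
    by (rule Cauchy_Schwarz_integral(1)) (use g2 L2 in auto)
  define m where "m = (LINT X|Pn n \<theta>. g X)"
  have "(LINT X|Pn n \<theta>'. g X) = (LINT X|Pn n \<theta>. g X * ?L X)"
    unfolding Pn_eq_density[OF assms(1,2)] using L0
    by (subst integral_density) (auto simp: mult.commute)
  \<comment> \<open>\<open>?L\<close> has mean 1, so \<open>g\<close> can be centred at
    \<open>m\<close> and \<open>?L\<close> at 1 before Cauchy--Schwarz is applied; this is what puts
    a variance and a chi-square divergence on the right.\<close>
  then have "(LINT X|Pn n \<theta>'. g X) - m = (LINT X|Pn n \<theta>. g X * ?L X - g X - m * ?L X + m)"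
    using Lg g1 L1 N.prob_space by (simp add: m_def)
  also have "\<dots> = (LINT X|Pn n \<theta>. (g X - m) * (?L X - 1))"
    by (simp add: algebra_simps)
  finally have "((LINT X|Pn n \<theta>'. g X) - m)\<^sup>2 = (LINT X|Pn n \<theta>. (g X - m) * (?L X - 1))\<^sup>2"
    by simp
  also have "\<dots> \<le> (LINT X|Pn n \<theta>. (g X - m)\<^sup>2) * (LINT X|Pn n \<theta>. (?L X - 1)\<^sup>2)"
  proof (rule Cauchy_Schwarz_integral(2))
    show "integrable (Pn n \<theta>) (\<lambda>X. (g X - m)\<^sup>2)" "integrable (Pn n \<theta>) (\<lambda>X. (?L X - 1)\<^sup>2)"
      unfolding power2_diff using g1 g2 L1 L2 by simp_all
  qed measurable
  also have "(LINT X|Pn n \<theta>. (g X - m)\<^sup>2) = (LINT X|Pn n \<theta>. (g X)\<^sup>2) - m\<^sup>2"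
    unfolding power2_diff using g1 g2 N.prob_space by (simp add: m_def power2_eq_square)
  also have "(LINT X|Pn n \<theta>. (?L X - 1)\<^sup>2) = (LINT X|Pn n \<theta>. (?L X)\<^sup>2) - 1"
    unfolding power2_diff using L1 L2(1) N.prob_space by simp
  also have "(LINT X|Pn n \<theta>. (?L X)\<^sup>2) = (1 + (LINT x|P \<theta>. (?q x - 1)\<^sup>2)) ^ n"
    by (rule L2(2))
  finally show ?thesis
    by (simp add: m_def)
qed

end

section \<open>Contiguity and asymptotic linearity along paths\<close>

context smooth_path
begin

lemma chi_square_eq:
  "n \<ge> 1 \<Longrightarrow> (LINT x|P \<theta>. (r n x - 1)\<^sup>2) = (LINT x|P \<theta>. (D' n x)\<^sup>2) / real n"
  by (simp add: power_mult_distrib)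

lemma chi_square_integrable:
  assumes "dominates \<epsilon> D" "th n \<in> ball \<theta> \<epsilon>" "n \<ge> 1"
  shows "integrable (P \<theta>) (\<lambda>x. (r n x - 1)\<^sup>2)" and "(LINT x|P \<theta>. (D' n x)\<^sup>2) \<le> C\<^sup>2 * (LINT x|P \<theta>. D x ^ 4)"
proof -
  have "th n \<in> U" using assms by (auto simp: dominates_def)
  note [measurable] = D'_measurable[OF this]
  have b1: "(D' n x)\<^sup>2 \<le> C\<^sup>2 * (D x)^4" for x
  proof -
    have "\<bar>D' n x\<bar>\<^sup>2 \<le> (C * (D x)^2)\<^sup>2"
      by (intro power_mono D'_bound[OF assms(1,2)]) auto
    also have "\<dots> = C\<^sup>2 * (D x)^4" by (simp add: power_mult_distrib flip: power_mult)
    finally show ?thesis by simp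
  qed
  have int: "integrable (P \<theta>) (\<lambda>x. (D' n x)\<^sup>2)"
    using b1 by (intro dominates_integrable[OF assms(1), where K="C\<^sup>2"]) auto
  then show "integrable (P \<theta>) (\<lambda>x. (r n x - 1)\<^sup>2)"
    using assms(3) by (simp add: power_mult_distrib)
  have "(LINT x|P \<theta>. (D' n x)\<^sup>2) \<le> (LINT x|P \<theta>. C\<^sup>2 * D x ^ 4)"
    using int b1 assms(1) by (intro integral_mono) (auto simp: dominates_def)
  then show "(LINT x|P \<theta>. (D' n x)\<^sup>2) \<le> C\<^sup>2 * (LINT x|P \<theta>. D x ^ 4)"
    by simp
qed

text \<open>\<open>(1 + d / n)^n \<le> exp d\<close>, where \<open>d / n\<close> is the chi-square
  divergence for one observation. The variance factor is nonnegative, so this estimate may be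
  multiplied by it.\<close>

lemma path_change_bound:
  assumes "dominates \<epsilon> D" "th n \<in> ball \<theta> \<epsilon>" "n \<ge> 1"
    and "g \<in> borel_measurable (Pn n \<theta>)" "\<And>X. \<bar>g X\<bar> \<le> B"
  shows "((LINT X|Pn n (th n). g X) - (LINT X|Pn n \<theta>. g X))\<^sup>2
    \<le> ((LINT X|Pn n \<theta>. (g X)\<^sup>2) - (LINT X|Pn n \<theta>. g X)\<^sup>2)
       * (exp (LINT x|P \<theta>. (D' n x)\<^sup>2) - 1)"
proof -
  interpret N: prob_space "Pn n \<theta>" using prob_space_Pn[OF \<theta>_in] .
  note [measurable] = assms(4)
  have U: "th n \<in> U" using assms by (auto simp: dominates_def)
  let ?d = "LINT x|P \<theta>. (D' n x)\<^sup>2"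
  have g1: "integrable (Pn n \<theta>) g"
    by (rule N.integrable_const_bound[where B=B]) (use assms(5) in auto)
  have g2: "integrable (Pn n \<theta>) (\<lambda>X. (g X)\<^sup>2)"
  proof (rule N.integrable_const_bound[where B="B\<^sup>2"])
    have "\<bar>g X\<bar>\<^sup>2 \<le> B\<^sup>2" for X
      using assms(5) by (intro power_mono) auto
    then show "AE X in Pn n \<theta>. norm ((g X)\<^sup>2) \<le> B\<^sup>2" by simp
  qed measurable
  have var: "0 \<le> (LINT X|Pn n \<theta>. (g X)\<^sup>2) - (LINT X|Pn n \<theta>. g X)\<^sup>2"
    using N.variance_eq[OF g1 g2] N.variance_positive[of g] by simp
  have "0 \<le> ?d" by simp
  then have "(1 + ?d / real n) ^ n \<le> exp (?d / real n) ^ n"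
    by (intro power_mono exp_ge_add_one_self) auto
  also have "\<dots> = exp ?d"
    using assms(3) by (simp flip: exp_of_nat_mult)
  finally have "(1 + ?d / real n) ^ n - 1 \<le> exp ?d - 1" by simp
  from mult_left_mono[OF this var] show ?thesis
    using Pn_change_bound[OF \<theta>_in U chi_square_integrable(1)[OF assms(1-3), unfolded r_def] assms(4,5)]
      chi_square_eq[OF assms(3)] unfolding r_def by simp
qed

text \<open>An indicator equals its square, so with \<open>a\<close> and \<open>b\<close> the two
  probabilities the change bound reads \<open>(b - a)^2 \<le> a * K\<close>, where \<open>K\<close>
  is free of \<open>n\<close>. Hence \<open>b \<le> a + sqrt (a * K)\<close>.\<close>

lemma contiguity:
  assumes A: "\<And>n. A n \<in> sets (Pn n \<theta>)" and lim: "(\<lambda>n. measure (Pn n \<theta>) (A n)) \<longlonglongrightarrow> 0"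
  shows "(\<lambda>n. measure (Pn n (th n)) (A n)) \<longlonglongrightarrow> 0"
proof -
  obtain \<epsilon> D where D: "dominates \<epsilon> D" using dominates_ex by blast
  then have \<epsilon>: "0 < \<epsilon>" "ball \<theta> \<epsilon> \<subseteq> U" by (auto simp: dominates_def)
  define K where "K = exp (C\<^sup>2 * (LINT x|P \<theta>. D x ^ 4)) - 1"
  show ?thesis
  proof (rule Lim_null_comparison)
    show "\<forall>\<^sub>F n in sequentially. norm (measure (Pn n (th n)) (A n))
        \<le> measure (Pn n \<theta>) (A n) + sqrt (measure (Pn n \<theta>) (A n) * K)"
      using eventually_th[OF \<epsilon>(1)] eventually_ge_at_top[of 1]
    proof eventually_elim
      case (elim n)
      then have U: "th n \<in> U" using \<epsilon> by auto
      interpret N: prob_space "Pn n \<theta>" using prob_space_Pn[OF \<theta>_in] .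
      interpret N': prob_space "Pn n (th n)" using prob_space_Pn[OF U] .
      let ?a = "measure (Pn n \<theta>) (A n)" and ?b = "measure (Pn n (th n)) (A n)"
      have A': "A n \<in> sets (Pn n (th n))" using A[of n] by (simp add: sets_Pn)
      have i2: "(indicat_real (A n) X)\<^sup>2 = indicat_real (A n) X" for X
        by (simp add: indicator_def)
      have "(?b - ?a)\<^sup>2 \<le> (?a - ?a\<^sup>2) * (exp (LINT x|P \<theta>. (D' n x)\<^sup>2) - 1)"
        using path_change_bound[OF D elim, of "indicat_real (A n)" 1] A[of n] A' by (simp add: i2)
      also have "\<dots> \<le> ?a * K"
        using chi_square_integrable(2)[OF D elim] by (intro mult_mono) (auto simp: K_def)
      finally have "\<bar>?b - ?a\<bar> \<le> sqrt (?a * K)"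
        by (rule real_le_rsqrt[OF order_trans[OF eq_refl[OF power2_abs]]])
      then show ?case by simp
    qed
    have "(\<lambda>n. measure (Pn n \<theta>) (A n) + sqrt (measure (Pn n \<theta>) (A n) * K)) \<longlonglongrightarrow> 0 + sqrt (0 * K)"
      by (intro tendsto_add tendsto_real_sqrt tendsto_mult lim tendsto_const)
    then show "(\<lambda>n. measure (Pn n \<theta>) (A n) + sqrt (measure (Pn n \<theta>) (A n) * K)) \<longlonglongrightarrow> 0"
      by simp
  qed
qed

end

context smooth_path_dir
begin

definition Z where
  "Z n X = (1 / sqrt (real n)) * (\<Sum>j<n. phi n (X j)) - (1 / sqrt (real n)) * (\<Sum>j<n. phi0 (X j)) + info \<theta> a0 (t n)"

text \<open>The difference of the scores is centred at \<open>m\<close>, the mean of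
  \<open>phi n\<close>. The centred sum has variance at most the squared distance of
  \<open>phi n\<close> and \<open>phi0\<close> in mean square, which vanishes; the mean contributes
  \<open>sqrt n * m\<close>, which cancels \<open>info \<theta> a0 (t n)\<close> in the limit. Each
  part takes half of \<open>\<eta>\<close>.\<close>

lemma asymptotic_linearity:
  assumes "0 < \<eta>"
  shows "(\<lambda>n. measure (Pn n \<theta>) {X \<in> space (Pn n \<theta>). \<eta> \<le> \<bar>Z n X\<bar>}) \<longlonglongrightarrow> 0"
proof (rule Lim_null_comparison)
  obtain \<epsilon> D where D: "dominates \<epsilon> D" using dominates_ex by blast
  then have \<epsilon>: "0 < \<epsilon>" "ball \<theta> \<epsilon> \<subseteq> U" by (auto simp: dominates_def)
  interpret P1: prob_space "P \<theta>" using prob_space_P[OF \<theta>_in] .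
  have "\<forall>\<^sub>F n in sequentially. \<bar>sqrt (real n) * (LINT x|P \<theta>. phi n x) + info \<theta> a0 (t n)\<bar> < \<eta> / 2"
    using phi_mean_limit assms by (auto simp: tendsto_iff dist_norm elim!: allE[of _ "\<eta> / 2"])
  then show "\<forall>\<^sub>F n in sequentially. norm (measure (Pn n \<theta>) {X \<in> space (Pn n \<theta>). \<eta> \<le> \<bar>Z n X\<bar>})
      \<le> (LINT x|P \<theta>. (phi n x - phi0 x)\<^sup>2) / (\<eta> / 2)\<^sup>2"
    using eventually_th[OF \<epsilon>(1)] eventually_ge_at_top[of 1]
  proof eventually_elim
    case (elim n)
    then have U: "th n \<in> U" using \<epsilon> by auto
    interpret N: prob_space "Pn n \<theta>" using prob_space_Pn[OF \<theta>_in] .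
    note meas[measurable] = phi_measurable[OF U] phi0_measurable
    define m where "m = (LINT x|P \<theta>. phi n x)"
    define h where "h x = phi n x - phi0 x" for x
    define f where "f x = h x - m" for x
    have p0: "integrable (P \<theta>) phi0" "integrable (P \<theta>) (\<lambda>x. (phi0 x)\<^sup>2)" "(LINT x|P \<theta>. phi0 x) = 0"
      using score_prod_integrable(1)[OF \<theta>_in, of a0 a0] score_prod_integrable(2)[OF \<theta>_in, of a0] score_mean_zero[OF \<theta>_in, of a0]
      by (simp_all add: phi0_def[abs_def] power2_eq_square)
    note pn = phi_integrable[OF D elim(2)]
    have cross: "integrable (P \<theta>) (\<lambda>x. phi n x * phi0 x)"
      by (rule Cauchy_Schwarz_integral(1)) (use pn p0 in auto)
    have h1: "integrable (P \<theta>) h" "(LINT x|P \<theta>. h x) = m"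
      using pn p0 by (simp_all add: h_def[abs_def] m_def)
    have h2: "integrable (P \<theta>) (\<lambda>x. (h x)\<^sup>2)"
      using pn(2) p0(2) integrable_mult_right[OF cross, of 2]
      by (simp add: h_def power2_diff mult.assoc)
    have f: "integrable (P \<theta>) f" "(LINT x|P \<theta>. f x) = 0"
      using h1 P1.prob_space by (simp_all add: f_def[abs_def])
    have f2: "integrable (P \<theta>) (\<lambda>x. (f x)\<^sup>2)"
      using h1 h2 by (simp add: f_def power2_diff)
    have fle: "(LINT x|P \<theta>. (f x)\<^sup>2) \<le> (LINT x|P \<theta>. (h x)\<^sup>2)"
      using P1.variance_eq[OF h1(1) h2] h1(2) by (simp add: f_def)
    have Zf: "Z n X = (1 / sqrt (real n)) * (\<Sum>j<n. f (X j)) + (sqrt (real n) * m + info \<theta> a0 (t n))" for X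
    proof -
      have "(\<Sum>j<n. f (X j)) = (\<Sum>j<n. phi n (X j)) - (\<Sum>j<n. phi0 (X j)) - real n * m"
        by (simp add: f_def h_def sum_subtractf)
      moreover have "(1 / sqrt (real n)) * (real n * m) = sqrt (real n) * m"
        using real_div_sqrt[of "real n"] by (metis mult.assoc mult.left_neutral of_nat_0_le_iff times_divide_eq_left)
      ultimately show ?thesis
        by (simp add: Z_def right_diff_distrib)
    qed
    have "measure (Pn n \<theta>) {X \<in> space (Pn n \<theta>). \<eta> \<le> \<bar>Z n X\<bar>}
        \<le> measure (Pn n \<theta>) {X \<in> space (Pn n \<theta>). \<eta> / 2 \<le> \<bar>(1 / sqrt (real n)) * (\<Sum>j<n. f (X j))\<bar>}"
    proof (rule N.finite_measure_mono)
      have [measurable]: "(\<lambda>X. \<Sum>j<n. f (X j)) \<in> borel_measurable (Pn n \<theta>)"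
        using f(1) by (intro coordinate_sum_measurable) auto
      show "{X \<in> space (Pn n \<theta>). \<eta> / 2 \<le> \<bar>(1 / sqrt (real n)) * (\<Sum>j<n. f (X j))\<bar>} \<in> sets (Pn n \<theta>)"
        by measurable
      show "{X \<in> space (Pn n \<theta>). \<eta> \<le> \<bar>Z n X\<bar>}
        \<subseteq> {X \<in> space (Pn n \<theta>). \<eta> / 2 \<le> \<bar>(1 / sqrt (real n)) * (\<Sum>j<n. f (X j))\<bar>}"
        unfolding Zf using elim(1) unfolding m_def[symmetric] by (intro Collect_mono) linarith
    qed
    also have "\<dots> \<le> (LINT x|P \<theta>. (f x)\<^sup>2) / (\<eta> / 2)\<^sup>2"
      by (rule Pn_sum_tail[OF \<theta>_in f(1) f2 f(2)]) (use assms in simp)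
    also have "\<dots> \<le> (LINT x|P \<theta>. (h x)\<^sup>2) / (\<eta> / 2)\<^sup>2"
      using fle by (intro divide_right_mono) auto
    finally show ?case
      by (simp add: h_def)
  qed
  show "(\<lambda>n. (LINT x|P \<theta>. (phi n x - phi0 x)\<^sup>2) / (\<eta> / 2)\<^sup>2) \<longlonglongrightarrow> 0"
    using tendsto_divide[OF phi_diff_L2 tendsto_const[of "(\<eta> / 2)\<^sup>2"]] assms by simp
qed

end

section \<open>Weak convergence on the real line\<close>

text \<open>For small \<open>n\<close> a perturbed parameter may leave the parameter space, where
  the law need not be a probability measure. Replacing those terms by \<open>L\<close> gives a
  sequence to which limit theorems for real distributions apply.\<close>

lemma weak_conv_m_eventually_real_distribution:
  assumes "weak_conv_m M L" "real_distribution L" "\<forall>\<^sub>F n in sequentially. real_distribution (M n)"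
  shows "\<exists>M'. (\<forall>n. real_distribution (M' n)) \<and> weak_conv_m M' L \<and> (\<forall>\<^sub>F n in sequentially. M' n = M n)"
proof (intro exI conjI allI)
  let ?M = "\<lambda>n. if real_distribution (M n) then M n else L"
  show "real_distribution (?M n)" for n
    using assms(2) by simp
  show eq: "\<forall>\<^sub>F n in sequentially. ?M n = M n"
    using assms(3) by eventually_elim simp
  show "weak_conv_m ?M L"
    unfolding weak_conv_m_def weak_conv_def
  proof (intro allI impI)
    fix x assume "isCont (cdf L) x"
    then have "(\<lambda>n. cdf (M n) x) \<longlonglongrightarrow> cdf L x"
      using assms(1) by (simp add: weak_conv_m_def weak_conv_def)
    moreover have "\<forall>\<^sub>F n in sequentially. cdf (M n) x = cdf (?M n) x"
      using eq by eventually_elim simp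
    ultimately show "(\<lambda>n. cdf (?M n) x) \<longlonglongrightarrow> cdf L x"
      by (rule Lim_transform_eventually)
  qed
qed

lemma weak_conv_m_cong:
  assumes "weak_conv_m M L" "\<forall>\<^sub>F n in sequentially. M n = M' n"
  shows "weak_conv_m M' L"
  unfolding weak_conv_m_def weak_conv_def
proof (intro allI impI)
  fix x assume "isCont (cdf L) x"
  then have "(\<lambda>n. cdf (M n) x) \<longlonglongrightarrow> cdf L x"
    using assms(1) by (simp add: weak_conv_m_def weak_conv_def)
  moreover have "\<forall>\<^sub>F n in sequentially. cdf (M n) x = cdf (M' n) x"
    using assms(2) by eventually_elim simp
  ultimately show "(\<lambda>n. cdf (M' n) x) \<longlonglongrightarrow> cdf L x"
    by (rule Lim_transform_eventually)
qed

lemma weak_conv_m_integral: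
  fixes g :: "real \<Rightarrow> real"
  assumes "weak_conv_m M L" "real_distribution L" "\<forall>\<^sub>F n in sequentially. real_distribution (M n)"
    and "\<And>x. isCont g x" "\<And>x. \<bar>g x\<bar> \<le> B"
  shows "(\<lambda>n. integral\<^sup>L (M n) g) \<longlonglongrightarrow> integral\<^sup>L L g"
proof -
  obtain M' where M': "\<And>n. real_distribution (M' n)" "weak_conv_m M' L" "\<forall>\<^sub>F n in sequentially. M' n = M n"
    using weak_conv_m_eventually_real_distribution[OF assms(1-3)] by blast
  have "(\<lambda>n. integral\<^sup>L (M' n) g) \<longlonglongrightarrow> integral\<^sup>L L g"
    by (rule weak_conv_imp_integral_bdd_continuous_conv[OF M'(1) assms(2) M'(2), of g B])
       (use assms(4,5) in auto)
  moreover have "\<forall>\<^sub>F n in sequentially. integral\<^sup>L (M' n) g = integral\<^sup>L (M n) g"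
    using M'(3) by eventually_elim simp
  ultimately show ?thesis
    by (rule Lim_transform_eventually)
qed

lemma levy_continuity_eventually:
  assumes "\<forall>\<^sub>F n in sequentially. real_distribution (M n)" "real_distribution L"
    and char: "\<And>u. (\<lambda>n. char (M n) u) \<longlonglongrightarrow> char L u"
  shows "weak_conv_m M L"
proof -
  let ?M = "\<lambda>n. if real_distribution (M n) then M n else L"
  have eq: "\<forall>\<^sub>F n in sequentially. ?M n = M n"
    using assms(1) by eventually_elim simp
  have "weak_conv_m ?M L"
  proof (rule levy_continuity)
    fix u
    have "\<forall>\<^sub>F n in sequentially. char (M n) u = char (?M n) u"
      using eq by eventually_elim simp
    with char[of u] show "(\<lambda>n. char (?M n) u) \<longlonglongrightarrow> char L u"
      by (rule Lim_transform_eventually)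
  qed (use assms in auto)
  then show ?thesis
    using eq by (rule weak_conv_m_cong)
qed

text \<open>Off the event the integrands differ by at most \<open>|u| * \<eta>\<close>, as
  \<open>iexp\<close> is 1-Lipschitz, and on it by at most 2.\<close>

lemma (in prob_space) char_close:
  assumes [measurable]: "A \<in> borel_measurable M" "B \<in> borel_measurable M" and "0 \<le> \<eta>"
  shows "norm ((CLINT x|M. iexp (u * A x)) - (CLINT x|M. iexp (u * B x)))
    \<le> \<bar>u\<bar> * \<eta> + 2 * prob {x \<in> space M. \<eta> \<le> \<bar>A x - B x\<bar>}"
proof -
  let ?S = "{x \<in> space M. \<eta> \<le> \<bar>A x - B x\<bar>}"
  have int: "integrable M (\<lambda>x. iexp (u * A x))" "integrable M (\<lambda>x. iexp (u * B x))"
    by (rule integrable_iexp; measurable)+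
  have pt: "norm (iexp (u * A x) - iexp (u * B x)) \<le> \<bar>u\<bar> * \<eta> + 2 * indicat_real ?S x" if "x \<in> space M" for x
  proof (cases "x \<in> ?S")
    case True
    have "norm (iexp (u * A x) - iexp (u * B x)) \<le> norm (iexp (u * A x)) + norm (iexp (u * B x))"
      by (rule norm_triangle_ineq4)
    also have "\<dots> = 2" by simp
    finally show ?thesis using True assms(3) by (simp add: add_increasing)
  next
    case False
    have "iexp (u * A x) - iexp (u * B x) = iexp (u * B x) * (iexp (u * (A x - B x)) - 1)"
      by (simp add: algebra_simps flip: exp_add)
    then have "norm (iexp (u * A x) - iexp (u * B x)) = norm (iexp (u * (A x - B x)) - 1)"
      by (simp only: norm_mult norm_exp_i_times mult_1)
    also have "\<dots> \<le> \<bar>u * (A x - B x)\<bar>"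
      using iexp_approx1[of "u * (A x - B x)" 0] by simp
    also have "\<dots> \<le> \<bar>u\<bar> * \<eta>"
      using False that unfolding abs_mult by (intro mult_left_mono) auto
    finally show ?thesis using False by simp
  qed
  have "norm ((CLINT x|M. iexp (u * A x)) - (CLINT x|M. iexp (u * B x)))
      = norm (CLINT x|M. iexp (u * A x) - iexp (u * B x))"
    using int by simp
  also have "\<dots> \<le> (LINT x|M. norm (iexp (u * A x) - iexp (u * B x)))"
    by (rule integral_norm_bound)
  also have "\<dots> \<le> (LINT x|M. \<bar>u\<bar> * \<eta> + 2 * indicat_real ?S x)"
  proof (rule integral_mono)
    show "integrable M (\<lambda>x. norm (iexp (u * A x) - iexp (u * B x)))"
      using int by (intro integrable_norm Bochner_Integration.integrable_diff)
    show "integrable M (\<lambda>x. \<bar>u\<bar> * \<eta> + 2 * indicat_real ?S x)"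
      by (intro Bochner_Integration.integrable_add integrable_mult_right integrable_const integrable_real_indicator)
         (auto simp: less_top[symmetric])
  qed (rule pt)
  also have "\<dots> = \<bar>u\<bar> * \<eta> + 2 * prob ?S"
    using prob_space by (subst Bochner_Integration.integral_add) (auto simp: less_top[symmetric] integrable_real_indicator)
  finally show ?thesis .
qed

text \<open>Reduction to the standard normal law by scaling with \<open>\<sigma>\<close>.\<close>

lemma char_normal_density:
  assumes "0 < \<sigma>"
  shows "char (density lborel (\<lambda>x. ennreal (normal_density 0 \<sigma> x))) u = complex_of_real (exp (- (\<sigma>\<^sup>2 * u\<^sup>2 / 2)))"
proof -
  interpret N: prob_space std_normal_distribution
    by (rule prob_space_normal_density) simp
  have "distributed std_normal_distribution lborel (\<lambda>x. x) (normal_density 0 1)"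
    by (auto simp: distributed_def distr_id2)
  from N.normal_density_affine[OF this, of \<sigma> 0] assms
  have "distributed std_normal_distribution lborel (\<lambda>x. \<sigma> * x) (normal_density 0 \<sigma>)"
    by simp
  then have eq: "density lborel (\<lambda>x. ennreal (normal_density 0 \<sigma> x)) = distr std_normal_distribution lborel (\<lambda>x. \<sigma> * x)"
    by (simp add: distributed_def)
  have "char (density lborel (\<lambda>x. ennreal (normal_density 0 \<sigma> x))) u = char std_normal_distribution (u * \<sigma>)"
    unfolding eq char_def by (subst integral_distr) (auto simp: mult.assoc)
  then show ?thesis
    by (simp add: char_std_normal_distribution power_mult_distrib mult.commute)
qed

lemma real_distribution_normal_density:
  "0 < \<sigma> \<Longrightarrow> real_distribution (density lborel (\<lambda>x. ennreal (normal_density 0 \<sigma> x)))"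
  using prob_space_normal_density[of \<sigma> 0] by (auto simp: real_distribution_def real_distribution_axioms_def)

section \<open>Efficient scores and one-step estimators\<close>

text \<open>\<open>e\<close> is the functional to be estimated and \<open>a \<theta>\<close>
  represents it, up to the factor \<open>G \<theta>\<close>, in the information inner product: the
  score in direction \<open>a \<theta>\<close> is uncorrelated with the score in any direction
  \<open>h\<close> with \<open>e \<bullet> h = 0\<close>. So \<open>a \<theta>\<close> is the least
  favourable direction, and the normalisation \<open>e \<bullet> a \<theta> = 1\<close> makes
  \<open>G \<theta>\<close> the efficient information.\<close>

locale efficient_model = smooth_model M U p s
  for M :: "'x measure" and U :: "'p::euclidean_space set"
    and p :: "'p \<Rightarrow> 'x \<Rightarrow> real" and s :: "'p \<Rightarrow> 'x \<Rightarrow> 'p" +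
  fixes e :: 'p and a :: "'p \<Rightarrow> 'p" and G :: "'p \<Rightarrow> real"
  assumes a_cont: "continuous_on U a" and G_cont: "continuous_on U G"
    and G_pos: "\<And>\<theta>. \<theta> \<in> U \<Longrightarrow> 0 < G \<theta>"
    and info_a: "\<And>\<theta> h. \<theta> \<in> U \<Longrightarrow> info \<theta> (a \<theta>) h = G \<theta> * (e \<bullet> h)"
    and e_a: "\<And>\<theta>. \<theta> \<in> U \<Longrightarrow> e \<bullet> a \<theta> = 1"
begin

definition Delta where "Delta n \<theta> X = (1 / sqrt (real n)) * (\<Sum>j<n. a \<theta> \<bullet> s \<theta> (X j))"

lemma info_a_a: "\<theta> \<in> U \<Longrightarrow> info \<theta> (a \<theta>) (a \<theta>) = G \<theta>"
  by (simp add: info_a e_a)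

lemma Delta_measurable: "\<theta> \<in> U \<Longrightarrow> Delta n \<theta> \<in> borel_measurable (Pn n \<theta>')"
proof -
  assume "\<theta> \<in> U"
  have [measurable]: "(\<lambda>X. \<Sum>j<n. a \<theta> \<bullet> s \<theta> (X j)) \<in> borel_measurable (Pn n \<theta>')"
    by (rule coordinate_sum_measurable[OF inner_s_measurable[OF \<open>\<theta> \<in> U\<close>]])
  show ?thesis
    unfolding Delta_def[abs_def] by measurable
qed

lemma Delta_tail:
  assumes "\<theta> \<in> U" "0 < \<eta>"
  shows "measure (Pn n \<theta>) {X \<in> space (Pn n \<theta>). \<eta> \<le> \<bar>Delta n \<theta> X\<bar>} \<le> G \<theta> / \<eta>\<^sup>2"
proof -
  have sq: "(a \<theta> \<bullet> s \<theta> x)\<^sup>2 = (a \<theta> \<bullet> s \<theta> x) * (a \<theta> \<bullet> s \<theta> x)" for x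
    by (rule power2_eq_square)
  have "(LINT x|P \<theta>. (a \<theta> \<bullet> s \<theta> x)\<^sup>2) = G \<theta>"
    unfolding sq using info_a_a[OF assms(1)] by (simp add: info_def)
  with Pn_sum_tail[OF assms(1) score_prod_integrable(2)[OF assms(1), of "a \<theta>"] _ score_mean_zero[OF assms(1)] assms(2), of n]
  show ?thesis
    unfolding Delta_def sq using score_prod_integrable(1)[OF assms(1)] by simp
qed

text \<open>The error in the linear expansion of the efficient central sequence. The slope is
  \<open>- G \<theta>\<close>, and only \<open>e \<bullet> (\<theta>' - \<theta>)\<close> enters,
  since nuisance shifts are orthogonal to the efficient score.\<close>

definition R where
  "R n \<theta> \<theta>' X = Delta n \<theta>' X - Delta n \<theta> X + G \<theta> * (sqrt (real n) * (e \<bullet> (\<theta>' - \<theta>)))"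

lemma R_measurable: "\<theta> \<in> U \<Longrightarrow> \<theta>' \<in> U \<Longrightarrow> R n \<theta> \<theta>' \<in> borel_measurable (Pn n \<theta>'')"
  unfolding R_def[abs_def] using Delta_measurable by measurable

lemma path_dir_exists:
  assumes "\<theta> \<in> U" "\<And>n. norm (t n) \<le> C"
  shows "\<exists>A. smooth_path_dir M U p s \<theta> t C
    (\<lambda>n. if \<theta> + (1 / sqrt (real n)) *\<^sub>R t n \<in> U then a (\<theta> + (1 / sqrt (real n)) *\<^sub>R t n) else a \<theta>) (a \<theta>) A"
proof -
  interpret smooth_path M U p s \<theta> t C
    by unfold_locales (use assms in auto)
  let ?a = "\<lambda>n. if th n \<in> U then a (th n) else a \<theta>"
  have "isCont a \<theta>"
    using a_cont open_U assms(1) by (simp add: continuous_on_eq_continuous_at)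
  then have "(\<lambda>n. a (th n)) \<longlonglongrightarrow> a \<theta>"
    using th_tendsto by (rule isCont_tendsto_compose)
  moreover have "\<forall>\<^sub>F n in sequentially. a (th n) = ?a n"
    using eventually_th_in by eventually_elim simp
  ultimately have lim: "?a \<longlonglongrightarrow> a \<theta>"
    by (rule Lim_transform_eventually)
  then have "Bseq ?a"
    by (rule convergent_imp_Bseq[OF convergentI])
  then obtain A where A: "\<And>n. norm (?a n) \<le> A"
    by (auto simp: Bseq_def)
  have "norm (a \<theta>) \<le> max A (norm (a \<theta>))" "norm (?a n) \<le> max A (norm (a \<theta>))" for n
    using A[of n] by auto
  with lim have "smooth_path_dir M U p s \<theta> t C ?a (a \<theta>) (max A (norm (a \<theta>)))"
    by unfold_locales auto
  then show ?thesis
    unfolding th_def by blast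
qed

lemma Delta_linear:
  assumes "\<theta> \<in> U" "\<And>n. norm (t n) \<le> C" "0 < \<eta>"
  shows "(\<lambda>n. measure (Pn n \<theta>) {X \<in> space (Pn n \<theta>). \<eta> \<le> \<bar>R n \<theta> (\<theta> + (1 / sqrt (real n)) *\<^sub>R t n) X\<bar>}) \<longlonglongrightarrow> 0"
proof -
  obtain A where "smooth_path_dir M U p s \<theta> t C
    (\<lambda>n. if \<theta> + (1 / sqrt (real n)) *\<^sub>R t n \<in> U then a (\<theta> + (1 / sqrt (real n)) *\<^sub>R t n) else a \<theta>) (a \<theta>) A"
    using path_dir_exists[of \<theta> t C, OF assms(1,2)] by blast
  then interpret smooth_path_dir M U p s \<theta> t C
    "\<lambda>n. if \<theta> + (1 / sqrt (real n)) *\<^sub>R t n \<in> U then a (\<theta> + (1 / sqrt (real n)) *\<^sub>R t n) else a \<theta>" "a \<theta>" A .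
  have "\<forall>\<^sub>F n in sequentially. measure (Pn n \<theta>) {X \<in> space (Pn n \<theta>). \<eta> \<le> \<bar>Z n X\<bar>}
      = measure (Pn n \<theta>) {X \<in> space (Pn n \<theta>). \<eta> \<le> \<bar>R n \<theta> (\<theta> + (1 / sqrt (real n)) *\<^sub>R t n) X\<bar>}"
    using eventually_th_in eventually_ge_at_top[of 1]
  proof eventually_elim
    case (elim n)
    have "Z n X = R n \<theta> (\<theta> + (1 / sqrt (real n)) *\<^sub>R t n) X" for X
      using elim info_a[OF assms(1), of "t n"]
      by (simp add: Z_def R_def Delta_def phi_def phi0_def th_def)
    then show ?case by simp
  qed
  with asymptotic_linearity[OF assms(3)] show ?thesis
    by (rule Lim_transform_eventually)
qed

text \<open>The worst point of each finite set forms a deterministic path, to which the expansion along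
  paths applies; the bound on the cardinality then gives a bound uniform over the set.\<close>

lemma Delta_linear_finite:
  fixes K :: "nat \<Rightarrow> 'p set"
  assumes "\<theta> \<in> U" "0 < \<eta>"
    and K: "\<forall>\<^sub>F n in sequentially. finite (K n) \<and> card (K n) \<le> N"
    and KU: "\<forall>\<^sub>F n in sequentially. K n \<subseteq> U"
    and Kc: "\<And>n. K n \<subseteq> ball \<theta> (c / sqrt (real n))"
  shows "(\<lambda>n. measure (Pn n \<theta>) {X \<in> space (Pn n \<theta>). \<exists>\<theta>'\<in>K n. \<eta> \<le> \<bar>R n \<theta> \<theta>' X\<bar>}) \<longlonglongrightarrow> 0"
proof -
  define q where "q n \<theta>' = measure (Pn n \<theta>) {X \<in> space (Pn n \<theta>). \<eta> \<le> \<bar>R n \<theta> \<theta>' X\<bar>}" for n \<theta>'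
  \<comment> \<open>Where \<open>K n\<close> is empty or infinite the default
    \<open>\<theta>\<close> makes \<open>t n = 0\<close>, so that the path is defined and bounded
    for every \<open>n\<close>.\<close>
  define w where "w n = (if finite (K n) \<and> K n \<noteq> {}
      then SOME w. w \<in> K n \<and> (\<forall>\<theta>'\<in>K n. q n \<theta>' \<le> q n w) else \<theta>)" for n
  have wK: "w n \<in> K n \<and> (\<forall>\<theta>'\<in>K n. q n \<theta>' \<le> q n (w n))" if "finite (K n)" "K n \<noteq> {}" for n
  proof -
    have "Max (q n ` K n) \<in> q n ` K n" using that by simp
    then obtain v where "v \<in> K n" "q n v = Max (q n ` K n)" by auto
    then have "\<exists>v. v \<in> K n \<and> (\<forall>\<theta>'\<in>K n. q n \<theta>' \<le> q n v)"
      using that by (intro exI[of _ v]) auto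
    from someI_ex[OF this] show ?thesis using that by (simp add: w_def)
  qed
  define t where "t n = sqrt (real n) *\<^sub>R (w n - \<theta>)" for n
  have tb: "norm (t n) \<le> \<bar>c\<bar>" for n
  proof (cases "finite (K n) \<and> K n \<noteq> {} \<and> n \<noteq> 0")
    case True
    then have "dist \<theta> (w n) < c / sqrt (real n)"
      using wK[of n] Kc[of n] by auto
    then have "sqrt (real n) * norm (w n - \<theta>) \<le> c"
      using True by (simp add: dist_norm norm_minus_commute field_simps)
    then show ?thesis by (simp add: t_def)
  next
    case False
    then show ?thesis by (auto simp: t_def w_def)
  qed
  have wt: "w n = \<theta> + (1 / sqrt (real n)) *\<^sub>R t n" if "n \<ge> 1" for n
    using that by (simp add: t_def)
  have "(\<lambda>n. measure (Pn n \<theta>) {X \<in> space (Pn n \<theta>). \<eta> \<le> \<bar>R n \<theta> (\<theta> + (1 / sqrt (real n)) *\<^sub>R t n) X\<bar>}) \<longlonglongrightarrow> 0"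
    by (rule Delta_linear[OF assms(1) tb assms(2)])
  moreover have "\<forall>\<^sub>F n in sequentially. measure (Pn n \<theta>) {X \<in> space (Pn n \<theta>). \<eta> \<le> \<bar>R n \<theta> (\<theta> + (1 / sqrt (real n)) *\<^sub>R t n) X\<bar>} = q n (w n)"
    using eventually_ge_at_top[of 1] by eventually_elim (simp add: q_def wt[symmetric])
  ultimately have "(\<lambda>n. q n (w n)) \<longlonglongrightarrow> 0"
    by (rule Lim_transform_eventually)
  then have lim: "(\<lambda>n. real N * q n (w n)) \<longlonglongrightarrow> 0"
    using tendsto_mult[OF tendsto_const[of "real N"]] by fastforce
  show ?thesis
  proof (rule Lim_null_comparison[OF _ lim])
    show "\<forall>\<^sub>F n in sequentially. norm (measure (Pn n \<theta>) {X \<in> space (Pn n \<theta>). \<exists>\<theta>'\<in>K n. \<eta> \<le> \<bar>R n \<theta> \<theta>' X\<bar>}) \<le> real N * q n (w n)"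
      using K KU
    proof eventually_elim
      case (elim n)
      interpret N: prob_space "Pn n \<theta>" using prob_space_Pn[OF assms(1)] .
      let ?S = "\<lambda>\<theta>'. {X \<in> space (Pn n \<theta>). \<eta> \<le> \<bar>R n \<theta> \<theta>' X\<bar>}"
      have S: "?S \<theta>' \<in> sets (Pn n \<theta>)" if "\<theta>' \<in> K n" for \<theta>'
      proof -
        have [measurable]: "R n \<theta> \<theta>' \<in> borel_measurable (Pn n \<theta>)"
          using that elim by (intro R_measurable assms) auto
        show ?thesis by measurable
      qed
      have "{X \<in> space (Pn n \<theta>). \<exists>\<theta>'\<in>K n. \<eta> \<le> \<bar>R n \<theta> \<theta>' X\<bar>} = (\<Union>\<theta>'\<in>K n. ?S \<theta>')"
        by auto
      then have "measure (Pn n \<theta>) {X \<in> space (Pn n \<theta>). \<exists>\<theta>'\<in>K n. \<eta> \<le> \<bar>R n \<theta> \<theta>' X\<bar>} \<le> (\<Sum>\<theta>'\<in>K n. q n \<theta>')"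
        using N.finite_measure_subadditive_finite[of "K n" ?S, OF _ image_subsetI[OF S]] elim by (simp add: q_def)
      also have "\<dots> \<le> (\<Sum>\<theta>'\<in>K n. q n (w n))"
        using elim wK[of n] by (intro sum_mono) auto
      also have "\<dots> = real (card (K n)) * q n (w n)"
        by simp
      also have "\<dots> \<le> real N * q n (w n)"
        using elim by (intro mult_right_mono) (auto simp: q_def)
      finally show ?case by simp
    qed
  qed
qed

end

text \<open>\<open>T\<close> is tied to the one-step formula only for \<open>n \<ge> 1\<close> on
  the sample space, where the estimate is known to lie in \<open>U\<close>.\<close>

locale one_step = efficient_model M U p s e a G
  for M :: "'x measure" and U :: "'p::euclidean_space set"
    and p :: "'p \<Rightarrow> 'x \<Rightarrow> real" and s :: "'p \<Rightarrow> 'x \<Rightarrow> 'p"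
    and e :: 'p and a :: "'p \<Rightarrow> 'p" and G :: "'p \<Rightarrow> real" +
  fixes est :: "nat \<Rightarrow> (nat \<Rightarrow> 'x) \<Rightarrow> 'p" and T :: "nat \<Rightarrow> (nat \<Rightarrow> 'x) \<Rightarrow> real"
  assumes est_measurable: "\<And>n. 1 \<le> n \<Longrightarrow> est n \<in> borel_measurable (\<Pi>\<^sub>M j\<in>{..<n}. M)"
    and est_in: "\<And>n X. 1 \<le> n \<Longrightarrow> X \<in> space (\<Pi>\<^sub>M j\<in>{..<n}. M) \<Longrightarrow> est n X \<in> U"
    and est_consistent: "\<And>\<theta> \<epsilon>. \<theta> \<in> U \<Longrightarrow> 0 < \<epsilon> \<Longrightarrow> \<exists>C. \<forall>\<^sub>F n in sequentially.
        measure (Pn n \<theta>) {X \<in> space (Pn n \<theta>). C < norm (sqrt (real n) *\<^sub>R (est n X - \<theta>))} \<le> \<epsilon>"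
    and est_discrete: "\<And>\<theta> c. \<theta> \<in> U \<Longrightarrow> 0 < c \<Longrightarrow> \<exists>N. \<forall>\<^sub>F n in sequentially.
        finite (est n ` space (\<Pi>\<^sub>M j\<in>{..<n}. M) \<inter> ball \<theta> (c / sqrt (real n))) \<and>
        card (est n ` space (\<Pi>\<^sub>M j\<in>{..<n}. M) \<inter> ball \<theta> (c / sqrt (real n))) \<le> N"
    and T_measurable: "\<And>n. 1 \<le> n \<Longrightarrow> T n \<in> borel_measurable (\<Pi>\<^sub>M j\<in>{..<n}. M)"
    and T_eq: "\<And>n X. 1 \<le> n \<Longrightarrow> X \<in> space (\<Pi>\<^sub>M j\<in>{..<n}. M) \<Longrightarrow>
        T n X = e \<bullet> est n X + (1 / sqrt (real n)) * (inverse (G (est n X)) * Delta n (est n X) X)"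
begin

lemma est_measurable_Pn: "1 \<le> n \<Longrightarrow> est n \<in> borel_measurable (Pn n \<theta>)"
  using est_measurable measurable_cong_sets[OF sets_Pn refl] by blast

lemma T_measurable_Pn: "1 \<le> n \<Longrightarrow> T n \<in> borel_measurable (Pn n \<theta>)"
  using T_measurable measurable_cong_sets[OF sets_Pn refl] by blast

text \<open>Let \<open>\<tau>\<close> be \<open>sqrt n * (e \<bullet> (est - \<theta>))\<close>, the
  error of the preliminary estimate. Linearity turns the central sequence at the estimate into
  \<open>Delta n \<theta> - g * \<tau>\<close> up to \<open>R\<close>, so the correction with factor
  \<open>inverse g\<close> cancels \<open>\<tau>\<close>. Discreteness confines the estimate to a
  finite set of bounded size, over which \<open>R\<close> is uniformly small.\<close>

lemma one_step_expansion:
  assumes \<theta>: "\<theta> \<in> U" and \<eta>: "0 < \<eta>"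
  shows "(\<lambda>n. measure (Pn n \<theta>) {X \<in> space (Pn n \<theta>).
      \<eta> \<le> \<bar>sqrt (real n) * (T n X - e \<bullet> \<theta>) - inverse (G \<theta>) * Delta n \<theta> X\<bar>}) \<longlonglongrightarrow> 0"
proof (rule tendstoI)
  fix \<delta> :: real assume \<delta>: "0 < \<delta>"
  define g where "g = G \<theta>"
  have g: "0 < g" using G_pos[OF \<theta>] by (simp add: g_def)
  obtain C0 where C0: "\<forall>\<^sub>F n in sequentially.
        measure (Pn n \<theta>) {X \<in> space (Pn n \<theta>). C0 < norm (sqrt (real n) *\<^sub>R (est n X - \<theta>))} \<le> \<delta> / 4"
    using est_consistent[OF \<theta>, of "\<delta> / 4"] \<delta> by auto
  define C where "C = max C0 0"
  \<comment> \<open>Chebyshev's bound \<open>g / B^2\<close> for the central sequence is made equal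
    to \<open>\<delta> / 4\<close>.\<close>
  define B where "B = sqrt (4 * g / \<delta>)"
  have B: "0 < B" "g / B\<^sup>2 = \<delta> / 4"
    using g \<delta> by (simp_all add: B_def)
  \<comment> \<open>The extra 1 turns the weak bound \<open>C\<close> into membership in an open
    ball.\<close>
  define c where "c = C + 1"
  have c: "0 < c" by (simp add: c_def C_def)
  obtain N where N: "\<forall>\<^sub>F n in sequentially.
        finite (est n ` space (\<Pi>\<^sub>M j\<in>{..<n}. M) \<inter> ball \<theta> (c / sqrt (real n))) \<and>
        card (est n ` space (\<Pi>\<^sub>M j\<in>{..<n}. M) \<inter> ball \<theta> (c / sqrt (real n))) \<le> N"
    using est_discrete[OF \<theta> c] by auto
  define K where "K n = est n ` space (\<Pi>\<^sub>M j\<in>{..<n}. M) \<inter> ball \<theta> (c / sqrt (real n))" for n :: nat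
  \<comment> \<open>Outside the exceptional events \<open>|Delta - g * \<tau>| \<le> L\<close>. The
    tolerance \<open>\<kappa>\<close> for the inverse information at the estimate then costs
    \<open>\<kappa> * L = \<eta> / 4\<close>, and the tolerance \<open>\<eta>1\<close> for
    \<open>R\<close> costs another \<open>\<eta> / 4\<close>.\<close>
  define L where "L = B + g * (norm e * C) + 1"
  have L: "0 < L" unfolding L_def using B g by (intro add_pos_nonneg add_nonneg_pos) (auto simp: C_def)
  define \<kappa> where "\<kappa> = \<eta> / (4 * L)"
  have \<kappa>: "0 < \<kappa>" using \<eta> L by (simp add: \<kappa>_def)
  define \<eta>1 where "\<eta>1 = \<eta> / (4 * (inverse g + \<kappa>))"
  have \<eta>1: "0 < \<eta>1" using \<eta> g \<kappa> by (simp add: \<eta>1_def add_pos_pos)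
  have "continuous_on U (\<lambda>\<theta>. inverse (G \<theta>))"
    using G_cont G_pos by (intro continuous_on_inverse) (auto simp: less_imp_neq[THEN not_sym])
  then have "isCont (\<lambda>\<theta>. inverse (G \<theta>)) \<theta>"
    using open_U \<theta> by (simp add: continuous_on_eq_continuous_at)
  then obtain \<rho> where \<rho>: "0 < \<rho>" "\<And>\<theta>'. dist \<theta>' \<theta> < \<rho> \<Longrightarrow> \<bar>inverse (G \<theta>') - inverse g\<bar> < \<kappa>"
    using \<kappa> unfolding continuous_at_eps_delta g_def dist_real_def by blast
  have small: "\<forall>\<^sub>F n in sequentially. c / sqrt (real n) < \<rho>"
  proof -
    have "(\<lambda>n. c / sqrt (real n)) \<longlonglongrightarrow> 0" by real_asymp
    then show ?thesis using \<rho>(1) by (rule order_tendstoD)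
  qed
  have "(\<lambda>n. measure (Pn n \<theta>) {X \<in> space (Pn n \<theta>). \<exists>\<theta>'\<in>K n. \<eta>1 \<le> \<bar>R n \<theta> \<theta>' X\<bar>}) \<longlonglongrightarrow> 0"
  proof (rule Delta_linear_finite[OF \<theta> \<eta>1])
    show "\<forall>\<^sub>F n in sequentially. finite (K n) \<and> card (K n) \<le> N"
      using N by (simp add: K_def)
    show "\<forall>\<^sub>F n in sequentially. K n \<subseteq> U"
      using eventually_ge_at_top[of 1] by eventually_elim (use est_in in \<open>auto simp: K_def\<close>)
  qed (auto simp: K_def)
  then have bad: "\<forall>\<^sub>F n in sequentially. measure (Pn n \<theta>) {X \<in> space (Pn n \<theta>). \<exists>\<theta>'\<in>K n. \<eta>1 \<le> \<bar>R n \<theta> \<theta>' X\<bar>} < \<delta> / 4"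
    using \<delta> by (intro order_tendstoD(2)) auto
  from C0 bad small N eventually_ge_at_top[of 1]
  show "\<forall>\<^sub>F n in sequentially. dist (measure (Pn n \<theta>) {X \<in> space (Pn n \<theta>).
      \<eta> \<le> \<bar>sqrt (real n) * (T n X - e \<bullet> \<theta>) - inverse (G \<theta>) * Delta n \<theta> X\<bar>}) 0 < \<delta>"
  proof eventually_elim
    case (elim n)
    note n = elim(5)
    interpret N: prob_space "Pn n \<theta>" using prob_space_Pn[OF \<theta>] .
    note [measurable] = est_measurable_Pn[OF n] T_measurable_Pn[OF n] Delta_measurable[OF \<theta>]
    let ?W = "\<lambda>X. sqrt (real n) * (T n X - e \<bullet> \<theta>) - inverse (G \<theta>) * Delta n \<theta> X"
    let ?A = "{X \<in> space (Pn n \<theta>). C0 < norm (sqrt (real n) *\<^sub>R (est n X - \<theta>))}"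
    let ?B = "{X \<in> space (Pn n \<theta>). B \<le> \<bar>Delta n \<theta> X\<bar>}"
    let ?D = "{X \<in> space (Pn n \<theta>). \<exists>\<theta>'\<in>K n. \<eta>1 \<le> \<bar>R n \<theta> \<theta>' X\<bar>}"
    have KU: "K n \<subseteq> U" using n est_in by (auto simp: K_def)
    have "?D = (\<Union>\<theta>'\<in>K n. {X \<in> space (Pn n \<theta>). \<eta>1 \<le> \<bar>R n \<theta> \<theta>' X\<bar>})" by auto
    also have "\<dots> \<in> sets (Pn n \<theta>)"
    proof (rule sets.finite_UN)
      show "finite (K n)" using elim(4) by (simp add: K_def)
      fix \<theta>' assume "\<theta>' \<in> K n"
      then have [measurable]: "R n \<theta> \<theta>' \<in> borel_measurable (Pn n \<theta>)"
        using KU by (intro R_measurable \<theta>) auto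
      show "{X \<in> space (Pn n \<theta>). \<eta>1 \<le> \<bar>R n \<theta> \<theta>' X\<bar>} \<in> sets (Pn n \<theta>)" by measurable
    qed
    finally have D: "?D \<in> sets (Pn n \<theta>)" .
    have A: "?A \<in> sets (Pn n \<theta>)" and B': "?B \<in> sets (Pn n \<theta>)" by measurable
    have "\<bar>?W X\<bar> < \<eta>" if X: "X \<in> space (Pn n \<theta>)" and "X \<notin> ?A" "X \<notin> ?B" "X \<notin> ?D" for X
    proof -
      have XM: "X \<in> space (\<Pi>\<^sub>M j\<in>{..<n}. M)" using X by (simp add: space_Pn)
      define \<theta>' where "\<theta>' = est n X"
      define \<tau> where "\<tau> = sqrt (real n) * (e \<bullet> (\<theta>' - \<theta>))"
      have sn: "0 < sqrt (real n)" using n by simp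
      have nC: "sqrt (real n) * norm (\<theta>' - \<theta>) \<le> C"
        using that by (auto simp: \<theta>'_def C_def)
      then have "norm (\<theta>' - \<theta>) \<le> C / sqrt (real n)" using sn by (simp add: field_simps)
      also have "\<dots> < c / sqrt (real n)" using sn by (simp add: c_def divide_strict_right_mono)
      finally have dist: "dist \<theta> \<theta>' < c / sqrt (real n)" by (simp add: dist_norm norm_minus_commute)
      then have K: "\<theta>' \<in> K n" using XM by (auto simp: K_def \<theta>'_def)
      then have R: "\<bar>R n \<theta> \<theta>' X\<bar> < \<eta>1" using that by auto
      have Del: "\<bar>Delta n \<theta> X\<bar> < B" using that by auto
      have "\<bar>\<tau>\<bar> \<le> sqrt (real n) * (norm e * norm (\<theta>' - \<theta>))"
        using Cauchy_Schwarz_ineq2[of e "\<theta>' - \<theta>"] by (simp add: \<tau>_def abs_mult mult_left_mono)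
      also have "\<dots> = norm e * (sqrt (real n) * norm (\<theta>' - \<theta>))" by simp
      also have "\<dots> \<le> norm e * C" using nC by (intro mult_left_mono) auto
      finally have \<tau>: "\<bar>\<tau>\<bar> \<le> norm e * C" .
      have k: "\<bar>inverse (G \<theta>') - inverse g\<bar> < \<kappa>"
        using \<rho>(2)[of \<theta>'] dist elim(3) by (simp add: dist_commute)
      have Teq: "sqrt (real n) * (T n X - e \<bullet> \<theta>) = \<tau> + inverse (G \<theta>') * Delta n \<theta>' X"
        using T_eq[OF n XM] sn by (simp add: \<tau>_def \<theta>'_def field_simps inner_diff_right)
      have DR: "Delta n \<theta>' X = R n \<theta> \<theta>' X + Delta n \<theta> X - g * \<tau>"
        by (simp add: R_def g_def \<tau>_def)
      \<comment> \<open>The leftover \<open>(1 - inverse (G \<theta>') * g) * \<tau>\<close> equals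
        \<open>- (inverse (G \<theta>') - inverse g) * (g * \<tau>)\<close>, so it joins the first
        product.\<close>
      have "?W X = (inverse (G \<theta>') - inverse g) * (Delta n \<theta> X - g * \<tau>) + inverse (G \<theta>') * R n \<theta> \<theta>' X"
        unfolding Teq DR g_def[symmetric] using g by (simp add: algebra_simps)
      then have "\<bar>?W X\<bar> \<le> \<bar>inverse (G \<theta>') - inverse g\<bar> * \<bar>Delta n \<theta> X - g * \<tau>\<bar> + \<bar>inverse (G \<theta>')\<bar> * \<bar>R n \<theta> \<theta>' X\<bar>"
        by (metis abs_mult abs_triangle_ineq)
      also have "\<dots> \<le> \<kappa> * L + (inverse g + \<kappa>) * \<eta>1"
      proof (intro add_mono mult_mono)
        have "\<bar>g * \<tau>\<bar> \<le> g * (norm e * C)" using \<tau> g by (simp add: abs_mult)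
        then show "\<bar>Delta n \<theta> X - g * \<tau>\<bar> \<le> L" using Del by (simp add: L_def)
        have "0 < inverse g" using g by simp
        with k show "\<bar>inverse (G \<theta>')\<bar> \<le> inverse g + \<kappa>" by linarith
        with \<open>0 < inverse g\<close> \<kappa> show "0 \<le> inverse g + \<kappa>" by linarith
      qed (use k \<kappa> R in auto)
      also have "\<dots> = \<eta> / 4 + \<eta> / 4"
      proof -
        have "\<kappa> * L = \<eta> / 4" using L by (simp add: \<kappa>_def)
        have "inverse g + \<kappa> > 0" using g \<kappa> by (simp add: add_pos_pos)
        moreover have "x * (\<eta> / (4 * x)) = \<eta> / 4" if "x > 0" for x :: real using that by simp
        ultimately have "(inverse g + \<kappa>) * \<eta>1 = \<eta> / 4" unfolding \<eta>1_def by blast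
        with \<open>\<kappa> * L = \<eta> / 4\<close> show ?thesis by simp
      qed
      finally show ?thesis using \<eta> by simp
    qed
    then have "{X \<in> space (Pn n \<theta>). \<eta> \<le> \<bar>?W X\<bar>} \<subseteq> ?A \<union> ?B \<union> ?D"
      by (force simp: not_less[symmetric])
    then have "measure (Pn n \<theta>) {X \<in> space (Pn n \<theta>). \<eta> \<le> \<bar>?W X\<bar>} \<le> measure (Pn n \<theta>) (?A \<union> ?B \<union> ?D)"
      using A B' D by (intro N.finite_measure_mono) auto
    also have "\<dots> \<le> measure (Pn n \<theta>) ?A + measure (Pn n \<theta>) ?B + measure (Pn n \<theta>) ?D"
      using measure_Un_le[OF sets.Un[OF A B'] D] measure_Un_le[OF A B'] by linarith
    also have "\<dots> < \<delta>"
    proof -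
      have "measure (Pn n \<theta>) ?B \<le> \<delta> / 4"
        using Delta_tail[OF \<theta> B(1), of n] unfolding g_def[symmetric] B(2) .
      with elim(1,2) show ?thesis using \<delta> by linarith
    qed
    finally show ?case by (simp add: measure_nonneg)
  qed
qed

end

context one_step
begin

text \<open>Under \<open>Pn n \<theta>\<close> the statistic \<open>S\<close> is close to
  \<open>B\<close>, a multiple of the efficient score taken at the alternative \<open>th n\<close>.
  Contiguity carries this over to \<open>Pn n (th n)\<close>, where \<open>B\<close> is a sum of
  independent centred terms with characteristic function \<open>w n ^ n\<close>.\<close>

lemma one_step_regular:
  assumes \<theta>: "\<theta> \<in> U"
  shows "weak_conv_m
    (\<lambda>n. distr (Pn n (\<theta> + (1 / sqrt (real n)) *\<^sub>R h)) borel (\<lambda>X. sqrt (real n) * (T n X - e \<bullet> \<theta>) - e \<bullet> h))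
    (density lborel (\<lambda>y. ennreal (normal_density 0 (sqrt (inverse (G \<theta>))) y)))"
proof -
  obtain A where "smooth_path_dir M U p s \<theta> (\<lambda>_. h) (norm h)
    (\<lambda>n. if \<theta> + (1 / sqrt (real n)) *\<^sub>R h \<in> U then a (\<theta> + (1 / sqrt (real n)) *\<^sub>R h) else a \<theta>) (a \<theta>) A"
    using path_dir_exists[of \<theta> "\<lambda>_. h" "norm h", OF \<theta>] by blast
  then interpret smooth_path_dir M U p s \<theta> "\<lambda>_. h" "norm h"
    "\<lambda>n. if \<theta> + (1 / sqrt (real n)) *\<^sub>R h \<in> U then a (\<theta> + (1 / sqrt (real n)) *\<^sub>R h) else a \<theta>" "a \<theta>" A .
  define g where "g = G \<theta>"
  have g: "0 < g" using G_pos[OF \<theta>] by (simp add: g_def)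
  define S where "S n X = sqrt (real n) * (T n X - e \<bullet> \<theta>) - e \<bullet> h" for n X
  define B where "B n X = inverse g * Delta n (th n) X" for n X
  \<comment> \<open>The empty set for \<open>n = 0\<close> and for \<open>th n\<close> outside
    \<open>U\<close> makes \<open>Bad\<close> measurable for every \<open>n\<close>, as
    \<open>contiguity\<close> demands.\<close>
  define Bad where "Bad \<eta> n = (if n = 0 \<or> th n \<notin> U then {} else {X \<in> space (Pn n \<theta>). \<eta> \<le> \<bar>S n X - B n X\<bar>})" for \<eta> n
  have S_meas: "S n \<in> borel_measurable (Pn n \<theta>')" if "1 \<le> n" for n \<theta>'
    unfolding S_def[abs_def] using T_measurable_Pn[OF that] by measurable
  have B_meas: "B n \<in> borel_measurable (Pn n \<theta>')" if "th n \<in> U" for n \<theta>'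
    unfolding B_def[abs_def] using Delta_measurable[OF that] by measurable
  have Bad_sets: "Bad \<eta> n \<in> sets (Pn n \<theta>)" for \<eta> n
  proof (cases "n = 0 \<or> th n \<notin> U")
    case False
    then have [measurable]: "S n \<in> borel_measurable (Pn n \<theta>)" "B n \<in> borel_measurable (Pn n \<theta>)"
      using S_meas B_meas by auto
    show ?thesis unfolding Bad_def using False by simp
  qed (simp add: Bad_def)
  have Bad_lim: "(\<lambda>n. measure (Pn n (th n)) (Bad \<eta> n)) \<longlonglongrightarrow> 0" if \<eta>: "0 < \<eta>" for \<eta>
  proof (rule contiguity[OF Bad_sets])
    let ?W = "\<lambda>n X. sqrt (real n) * (T n X - e \<bullet> \<theta>) - inverse (G \<theta>) * Delta n \<theta> X"
    let ?a = "\<lambda>n. measure (Pn n \<theta>) {X \<in> space (Pn n \<theta>). \<eta> / 2 \<le> \<bar>?W n X\<bar>}"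
    let ?b = "\<lambda>n. measure (Pn n \<theta>) {X \<in> space (Pn n \<theta>). g * \<eta> / 2 \<le> \<bar>R n \<theta> (th n) X\<bar>}"
    have "(\<lambda>n. ?a n + ?b n) \<longlonglongrightarrow> 0 + 0"
    proof (rule tendsto_add)
      show "?a \<longlonglongrightarrow> 0" using one_step_expansion[OF \<theta>, of "\<eta> / 2"] \<eta> by simp
      show "?b \<longlonglongrightarrow> 0"
        using Delta_linear[OF \<theta>, of "\<lambda>_. h" "norm h" "g * \<eta> / 2"] g \<eta> unfolding th_def by simp
    qed
    then have lim: "(\<lambda>n. ?a n + ?b n) \<longlonglongrightarrow> 0" by simp
    show "(\<lambda>n. measure (Pn n \<theta>) (Bad \<eta> n)) \<longlonglongrightarrow> 0"
    proof (rule Lim_null_comparison[OF _ lim])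
      show "\<forall>\<^sub>F n in sequentially. norm (measure (Pn n \<theta>) (Bad \<eta> n)) \<le> ?a n + ?b n"
        using eventually_ge_at_top[of 1] eventually_th_in
      proof eventually_elim
        case (elim n)
        interpret N: prob_space "Pn n \<theta>" using prob_space_Pn[OF \<theta>] .
        have n: "0 < sqrt (real n)" using elim by simp
        note [measurable] = T_measurable_Pn[OF elim(1)] Delta_measurable[OF \<theta>] R_measurable[OF \<theta> elim(2)]
        \<comment> \<open>The drift of \<open>Delta\<close> from \<open>\<theta>\<close> to
          \<open>th n\<close> is \<open>- g * (e \<bullet> h)\<close>; divided by \<open>g\<close>
          it matches the centring of \<open>S\<close> at \<open>e \<bullet> h\<close>.\<close>
        have SB: "S n X - B n X = ?W n X - inverse g * R n \<theta> (th n) X" for X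
        proof -
          have "sqrt (real n) * (e \<bullet> (th n - \<theta>)) = e \<bullet> h"
            using n by (simp add: th_def)
          then have DR: "Delta n (th n) X = R n \<theta> (th n) X + Delta n \<theta> X - g * (e \<bullet> h)"
            by (simp add: R_def g_def)
          then show ?thesis
            using g unfolding S_def B_def g_def[symmetric] DR by (simp add: algebra_simps)
        qed
        have sub: "Bad \<eta> n \<subseteq> {X \<in> space (Pn n \<theta>). \<eta> / 2 \<le> \<bar>?W n X\<bar>} \<union> {X \<in> space (Pn n \<theta>). g * \<eta> / 2 \<le> \<bar>R n \<theta> (th n) X\<bar>}"
        proof
          fix X assume X: "X \<in> Bad \<eta> n"
          then have 1: "X \<in> space (Pn n \<theta>)" "\<eta> \<le> \<bar>?W n X - inverse g * R n \<theta> (th n) X\<bar>"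
            by (auto simp: Bad_def SB split: if_splits)
          have "\<eta> / 2 \<le> \<bar>?W n X\<bar> \<or> \<eta> / 2 \<le> \<bar>inverse g * R n \<theta> (th n) X\<bar>"
            using 1(2) by linarith
          moreover have "\<bar>inverse g * R n \<theta> (th n) X\<bar> = \<bar>R n \<theta> (th n) X\<bar> / g"
            using g by (simp add: abs_mult field_simps)
          moreover have "\<eta> / 2 \<le> \<bar>R n \<theta> (th n) X\<bar> / g \<Longrightarrow> g * \<eta> / 2 \<le> \<bar>R n \<theta> (th n) X\<bar>"
            using g by (simp add: field_simps)
          ultimately show "X \<in> {X \<in> space (Pn n \<theta>). \<eta> / 2 \<le> \<bar>?W n X\<bar>} \<union> {X \<in> space (Pn n \<theta>). g * \<eta> / 2 \<le> \<bar>R n \<theta> (th n) X\<bar>}"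
            using 1(1) by auto
        qed
        have sets: "{X \<in> space (Pn n \<theta>). \<eta> / 2 \<le> \<bar>?W n X\<bar>} \<in> sets (Pn n \<theta>)"
            "{X \<in> space (Pn n \<theta>). g * \<eta> / 2 \<le> \<bar>R n \<theta> (th n) X\<bar>} \<in> sets (Pn n \<theta>)"
          by measurable
        have "measure (Pn n \<theta>) (Bad \<eta> n) \<le> measure (Pn n \<theta>) ({X \<in> space (Pn n \<theta>). \<eta> / 2 \<le> \<bar>?W n X\<bar>} \<union> {X \<in> space (Pn n \<theta>). g * \<eta> / 2 \<le> \<bar>R n \<theta> (th n) X\<bar>})"
          using sets by (intro N.finite_measure_mono sub) auto
        also have "\<dots> \<le> ?a n + ?b n"
          by (rule measure_Un_le[OF sets])
        finally show ?case by simp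
      qed
    qed
  qed
  let ?Mn = "\<lambda>n. distr (Pn n (th n)) borel (S n)"
  let ?L = "density lborel (\<lambda>y. ennreal (normal_density 0 (sqrt (inverse g)) y))"
  have "weak_conv_m ?Mn ?L"
  proof (rule levy_continuity_eventually)
    show "\<forall>\<^sub>F n in sequentially. real_distribution (?Mn n)"
      using eventually_ge_at_top[of 1] eventually_th_in
    proof eventually_elim
      case (elim n)
      interpret N: prob_space "Pn n (th n)" using prob_space_Pn[OF elim(2)] .
      show ?case
        by (rule N.real_distribution_distr) (rule S_meas[OF elim(1)])
    qed
    show "real_distribution ?L"
      using g by (intro real_distribution_normal_density) simp
    fix u
    define v where "v = u * inverse g"
    define w where "w n = (CLINT x|P (th n). iexp (v * phi n x / sqrt (real n)))" for n
    have "(\<lambda>n. w n ^ n) \<longlonglongrightarrow> complex_of_real (exp (- (v\<^sup>2 * info \<theta> (a \<theta>) (a \<theta>) / 2)))"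
    proof (rule tendsto_power_exp)
      show "\<forall>\<^sub>F n in sequentially. norm (w n) \<le> 1"
        using eventually_th_in
      proof eventually_elim
        case (elim n)
        interpret P2: prob_space "P (th n)" using prob_space_P[OF elim] .
        have "norm (w n) \<le> (LINT x|P (th n). norm (iexp (v * phi n x / sqrt (real n))))"
          unfolding w_def by (rule integral_norm_bound)
        also have "\<dots> = 1" using P2.prob_space by simp
        finally show ?case .
      qed
      show "- (v\<^sup>2 * info \<theta> (a \<theta>) (a \<theta>) / 2) \<le> 0"
        by (simp add: info_nonneg)
      show "(\<lambda>n. of_nat n * (w n - 1)) \<longlonglongrightarrow> complex_of_real (- (v\<^sup>2 * info \<theta> (a \<theta>) (a \<theta>) / 2))"
        unfolding w_def by (rule char_phi_limit)
    qed
    moreover have "v\<^sup>2 * info \<theta> (a \<theta>) (a \<theta>) / 2 = (sqrt (inverse g))\<^sup>2 * u\<^sup>2 / 2"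
      using g info_a_a[OF \<theta>] by (simp add: v_def g_def[symmetric] power2_eq_square field_simps)
    moreover have "char ?L u = complex_of_real (exp (- ((sqrt (inverse g))\<^sup>2 * u\<^sup>2 / 2)))"
      using g by (intro char_normal_density) simp
    ultimately have w_lim: "(\<lambda>n. w n ^ n) \<longlonglongrightarrow> char ?L u"
      by simp
    have wB: "\<forall>\<^sub>F n in sequentially. w n ^ n = (CLINT X|Pn n (th n). iexp (u * B n X))"
      using eventually_th_in
    proof eventually_elim
      case (elim n)
      interpret P2: prob_space "P (th n)" using prob_space_P[OF elim] .
      note [measurable] = phi_measurable[OF elim]
      let ?f = "\<lambda>x. iexp (v * phi n x / sqrt (real n))"
      have int: "integrable (P (th n)) ?f"
        by (rule P2.integrable_iexp) auto
      have "iexp (u * B n X) = (\<Prod>j<n. ?f (X j))" for X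
      proof -
        have "u * B n X = (\<Sum>j<n. v * phi n (X j) / sqrt (real n))"
          using elim by (simp add: B_def Delta_def phi_def v_def th_def sum_distrib_left sum_divide_distrib algebra_simps)
        then show ?thesis
          by (simp add: sum_distrib_left exp_sum)
      qed
      then have "(CLINT X|Pn n (th n). iexp (u * B n X)) = (\<Prod>j<n. w n)"
        using Pn_prod_integral(1)[OF elim, of n "\<lambda>_. ?f"] int by (simp only: w_def)
      then show ?case by simp
    qed
    have diff: "(\<lambda>n. char (?Mn n) u - (CLINT X|Pn n (th n). iexp (u * B n X))) \<longlonglongrightarrow> 0"
    proof (rule tendstoI)
      fix \<epsilon> :: real assume \<epsilon>: "0 < \<epsilon>"
      \<comment> \<open>The summand 1 avoids division by zero. The two parts of
        \<open>char_close\<close> are then at most \<open>\<epsilon> / 4\<close> and below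
        \<open>\<epsilon> / 2\<close>.\<close>
      define \<eta> where "\<eta> = \<epsilon> / (4 * (\<bar>u\<bar> + 1))"
      have \<eta>: "0 < \<eta>" using \<epsilon> by (simp add: \<eta>_def)
      have "\<bar>u\<bar> * \<eta> \<le> (\<bar>u\<bar> + 1) * \<eta>" using \<eta> by simp
      also have "\<dots> = \<epsilon> / 4"
      proof -
        have "x * (\<epsilon> / (4 * x)) = \<epsilon> / 4" if "x > 0" for x :: real using that by simp
        from this[of "\<bar>u\<bar> + 1"] show ?thesis unfolding \<eta>_def by linarith
      qed
      finally have u\<eta>: "\<bar>u\<bar> * \<eta> \<le> \<epsilon> / 4" .
      have "\<forall>\<^sub>F n in sequentially. measure (Pn n (th n)) (Bad \<eta> n) < \<epsilon> / 4"
        using Bad_lim[OF \<eta>] \<epsilon> by (intro order_tendstoD(2)) auto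
      then show "\<forall>\<^sub>F n in sequentially. dist (char (?Mn n) u - (CLINT X|Pn n (th n). iexp (u * B n X))) 0 < \<epsilon>"
        using eventually_ge_at_top[of 1] eventually_th_in
      proof eventually_elim
        case (elim n)
        interpret N: prob_space "Pn n (th n)" using prob_space_Pn[OF elim(3)] .
        note [measurable] = S_meas[OF elim(2)] B_meas[OF elim(3)]
        have "char (?Mn n) u = (CLINT X|Pn n (th n). iexp (u * S n X))"
          unfolding char_def by (subst integral_distr) auto
        moreover have "Bad \<eta> n = {X \<in> space (Pn n (th n)). \<eta> \<le> \<bar>S n X - B n X\<bar>}"
          using elim by (simp add: Bad_def space_Pn)
        ultimately have "norm (char (?Mn n) u - (CLINT X|Pn n (th n). iexp (u * B n X)))
            \<le> \<bar>u\<bar> * \<eta> + 2 * measure (Pn n (th n)) (Bad \<eta> n)"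
          using N.char_close[of "S n" "B n" \<eta> u] \<eta> by simp
        then show ?case
          using u\<eta> elim(1) \<epsilon> unfolding dist_norm diff_0_right by linarith
      qed
    qed
    have "(\<lambda>n. CLINT X|Pn n (th n). iexp (u * B n X)) \<longlonglongrightarrow> char ?L u"
      using w_lim wB by (rule Lim_transform_eventually)
    from tendsto_add[OF diff this] show "(\<lambda>n. char (?Mn n) u) \<longlonglongrightarrow> char ?L u"
      by simp
  qed
  then show ?thesis
    unfolding S_def[abs_def] th_def g_def .
qed

end

section \<open>The information bound for regular estimators\<close>

context efficient_model
begin

text \<open>Regularity identifies the limits of all expectations: \<open>S n\<close> has limit law
  \<open>L\<close> under \<open>Pn n \<theta>\<close>, and \<open>L\<close> shifted by
  \<open>e \<bullet> h\<close> under \<open>Pn n (th n)\<close>. By \<open>D'_sq_limit\<close> the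
  chi-square factor tends to \<open>exp (info \<theta> h h) - 1\<close>.\<close>

lemma regular_bounded_inequality:
  assumes \<theta>: "\<theta> \<in> U" and T': "\<And>n. 1 \<le> n \<Longrightarrow> T' n \<in> borel_measurable (\<Pi>\<^sub>M j\<in>{..<n}. M)"
    and L: "real_distribution L"
    and conv: "\<And>h. weak_conv_m
      (\<lambda>n. distr (Pn n (\<theta> + (1 / sqrt (real n)) *\<^sub>R h)) borel (\<lambda>X. sqrt (real n) * (T' n X - e \<bullet> \<theta>) - e \<bullet> h)) L"
    and g: "\<And>y. isCont g y" "\<And>y. \<bar>g y\<bar> \<le> B"
  shows "((LINT y|L. g (y + e \<bullet> h)) - (LINT y|L. g y))\<^sup>2
    \<le> ((LINT y|L. (g y)\<^sup>2) - (LINT y|L. g y)\<^sup>2) * (exp (info \<theta> h h) - 1)"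
proof -
  interpret smooth_path M U p s \<theta> "\<lambda>_. h" "norm h"
    using smooth_path_const[OF \<theta>] .
  obtain \<epsilon> D where D: "dominates \<epsilon> D" using dominates_ex by blast
  then have \<epsilon>: "0 < \<epsilon>" "ball \<theta> \<epsilon> \<subseteq> U" by (auto simp: dominates_def)
  define S where "S n X = sqrt (real n) * (T' n X - e \<bullet> \<theta>)" for n X
  have S_meas: "S n \<in> borel_measurable (Pn n \<theta>')" if "1 \<le> n" for n \<theta>'
  proof -
    have [measurable]: "T' n \<in> borel_measurable (Pn n \<theta>')"
      using T'[OF that] measurable_cong_sets[OF sets_Pn refl] by blast
    show ?thesis unfolding S_def[abs_def] by measurable
  qed
  have g_meas: "g' \<in> borel_measurable borel" if "\<And>y. isCont g' y" for g' :: "real \<Rightarrow> real"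
    using that by (intro borel_measurable_continuous_onI continuous_at_imp_continuous_on) auto
  \<comment> \<open>Stated for all directions and test functions: it is applied with
    \<open>h\<close> and with 0, and to \<open>g\<close> and its square.\<close>
  have lim: "(\<lambda>n. LINT X|Pn n (\<theta> + (1 / sqrt (real n)) *\<^sub>R k). g' (S n X)) \<longlonglongrightarrow> (LINT y|L. g' (y + e \<bullet> k))"
    if g': "\<And>y. isCont g' y" "\<And>y. \<bar>g' y\<bar> \<le> B'" for g' :: "real \<Rightarrow> real" and B' k
  proof -
    interpret K: smooth_path M U p s \<theta> "\<lambda>_. k" "norm k"
      using smooth_path_const[OF \<theta>] .
    let ?Q = "\<lambda>n. distr (Pn n (K.th n)) borel (\<lambda>X. S n X - e \<bullet> k)"
    have "weak_conv_m ?Q L"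
      using conv[of k] unfolding K.th_def S_def .
    moreover have "\<forall>\<^sub>F n in sequentially. real_distribution (?Q n)"
      using eventually_ge_at_top[of 1] K.eventually_th_in
    proof eventually_elim
      case (elim n)
      interpret N: prob_space "Pn n (K.th n)" using prob_space_Pn[OF elim(2)] .
      note [measurable] = S_meas[OF elim(1)]
      show ?case by (rule N.real_distribution_distr) measurable
    qed
    moreover have "isCont (\<lambda>y. g' (y + e \<bullet> k)) y" for y
      by (rule isCont_o2[OF _ g'(1)]) (intro continuous_intros)
    ultimately have "(\<lambda>n. LINT y|?Q n. g' (y + e \<bullet> k)) \<longlonglongrightarrow> (LINT y|L. g' (y + e \<bullet> k))"
      by (intro weak_conv_m_integral[OF _ L, where B=B'] g'(2)) auto
    moreover have "\<forall>\<^sub>F n in sequentially. (LINT y|?Q n. g' (y + e \<bullet> k)) = (LINT X|Pn n (K.th n). g' (S n X))"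
      using eventually_ge_at_top[of 1]
    proof eventually_elim
      case (elim n)
      note [measurable] = S_meas[OF elim(1)] g_meas[OF g'(1)]
      show ?case by (subst integral_distr) auto
    qed
    ultimately show ?thesis
      unfolding K.th_def by (rule Lim_transform_eventually)
  qed
  have g2: "isCont (\<lambda>y. (g y)\<^sup>2) y" "\<bar>(g y)\<^sup>2\<bar> \<le> B\<^sup>2" for y
    using g(1)[of y] power_mono[OF g(2)[of y], of 2] by (auto intro: continuous_intros)
  have l1: "(\<lambda>n. LINT X|Pn n (th n). g (S n X)) \<longlonglongrightarrow> (LINT y|L. g (y + e \<bullet> h))"
    using lim[of g B h, OF g] by (simp add: th_def)
  have l0: "(\<lambda>n. LINT X|Pn n \<theta>. g (S n X)) \<longlonglongrightarrow> (LINT y|L. g y)"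
    using lim[of g B 0, OF g] by simp
  have l2: "(\<lambda>n. LINT X|Pn n \<theta>. (g (S n X))\<^sup>2) \<longlonglongrightarrow> (LINT y|L. (g y)\<^sup>2)"
    using lim[of "\<lambda>y. (g y)\<^sup>2" "B\<^sup>2" 0, OF g2] by simp
  have d: "(\<lambda>n. LINT x|P \<theta>. (D' n x)\<^sup>2) \<longlonglongrightarrow> info \<theta> h h"
    using D'_sq_limit by (simp add: LIM_zero_iff)
  show ?thesis
  proof (rule tendsto_le[OF sequentially_bot])
    show "(\<lambda>n. ((LINT X|Pn n (th n). g (S n X)) - (LINT X|Pn n \<theta>. g (S n X)))\<^sup>2)
        \<longlonglongrightarrow> ((LINT y|L. g (y + e \<bullet> h)) - (LINT y|L. g y))\<^sup>2"
      by (intro tendsto_power tendsto_diff l1 l0)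
    show "(\<lambda>n. ((LINT X|Pn n \<theta>. (g (S n X))\<^sup>2) - (LINT X|Pn n \<theta>. g (S n X))\<^sup>2) * (exp (LINT x|P \<theta>. (D' n x)\<^sup>2) - 1))
        \<longlonglongrightarrow> ((LINT y|L. (g y)\<^sup>2) - (LINT y|L. g y)\<^sup>2) * (exp (info \<theta> h h) - 1)"
      by (intro tendsto_mult tendsto_power tendsto_diff tendsto_exp tendsto_const l2 l0 d)
    show "\<forall>\<^sub>F n in sequentially. ((LINT X|Pn n (th n). g (S n X)) - (LINT X|Pn n \<theta>. g (S n X)))\<^sup>2
        \<le> ((LINT X|Pn n \<theta>. (g (S n X))\<^sup>2) - (LINT X|Pn n \<theta>. g (S n X))\<^sup>2) * (exp (LINT x|P \<theta>. (D' n x)\<^sup>2) - 1)"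
      using eventually_th[OF \<epsilon>(1)] eventually_ge_at_top[of 1]
    proof eventually_elim
      case (elim n)
      have "(\<lambda>X. g (S n X)) \<in> borel_measurable (Pn n \<theta>)"
        using S_meas[OF elim(2), of \<theta>] g_meas[OF g(1)] by measurable
      from path_change_bound[OF D elim this, of B] g(2) show ?case by simp
    qed
  qed
qed

lemma regular_variance_bound:
  assumes \<theta>: "\<theta> \<in> U" and T': "\<And>n. 1 \<le> n \<Longrightarrow> T' n \<in> borel_measurable (\<Pi>\<^sub>M j\<in>{..<n}. M)"
    and L: "real_distribution L" and L2: "integrable L (\<lambda>y. y\<^sup>2)"
    and conv: "\<And>h. weak_conv_m
      (\<lambda>n. distr (Pn n (\<theta> + (1 / sqrt (real n)) *\<^sub>R h)) borel (\<lambda>X. sqrt (real n) * (T' n X - e \<bullet> \<theta>) - e \<bullet> h)) L"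
  shows "inverse (G \<theta>) \<le> prob_space.variance L (\<lambda>y. y)"
proof -
  interpret L: real_distribution L by fact
  have L1: "integrable L (\<lambda>y. y)"
    by (rule L.square_integrable_imp_integrable[OF _ L2]) simp
  define V where "V = L.variance (\<lambda>y. y)"
  have V: "V = (LINT y|L. y\<^sup>2) - (LINT y|L. y)\<^sup>2"
    unfolding V_def by (rule L.variance_eq[OF L1 L2])
  \<comment> \<open>Truncation at \<open>m\<close> is bounded, continuous and 1-Lipschitz, so its
    increments are dominated by \<open>|e \<bullet> h|\<close> and its square by
    \<open>y^2\<close>.\<close>
  define g where "g m y = max (- real m) (min (real m) y)" for m :: nat and y
  have gy: "(\<lambda>m. g m y) \<longlonglongrightarrow> y" for y
  proof (rule tendsto_eventually)
    show "\<forall>\<^sub>F m in sequentially. g m y = y"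
      using eventually_ge_at_top[of "nat \<lceil>\<bar>y\<bar>\<rceil>"]
    proof eventually_elim
      case (elim m)
      then have "\<bar>y\<bar> \<le> real m" by linarith
      then show ?case by (auto simp: g_def)
    qed
  qed
  have g_abs: "\<bar>g m y\<bar> \<le> \<bar>y\<bar>" "\<bar>g m y\<bar> \<le> real m" "\<bar>g m (y + c) - g m y\<bar> \<le> \<bar>c\<bar>" for m y c
    by (auto simp: g_def)
  have g_cont: "isCont (g m) y" for m y
    unfolding g_def by (intro continuous_intros)
  have [measurable]: "g m \<in> borel_measurable borel" for m
    unfolding g_def[abs_def] by measurable
  have key: "(e \<bullet> h)\<^sup>2 \<le> V * (exp (info \<theta> h h) - 1)" for h
  proof (rule tendsto_le[OF sequentially_bot])
    have "(\<lambda>m. LINT y|L. g m (y + e \<bullet> h) - g m y) \<longlonglongrightarrow> (LINT y|L. e \<bullet> h)"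
    proof (rule integral_dominated_convergence[where w="\<lambda>_. \<bar>e \<bullet> h\<bar>"])
      show "AE y in L. (\<lambda>m. g m (y + e \<bullet> h) - g m y) \<longlonglongrightarrow> e \<bullet> h"
      proof (rule AE_I2)
        fix y
        show "(\<lambda>m. g m (y + e \<bullet> h) - g m y) \<longlonglongrightarrow> e \<bullet> h"
          using tendsto_diff[OF gy[of "y + e \<bullet> h"] gy[of y]] by simp
      qed
    qed (auto simp: g_abs)
    then have l1: "(\<lambda>m. LINT y|L. g m (y + e \<bullet> h) - g m y) \<longlonglongrightarrow> e \<bullet> h"
      using L.prob_space by simp
    have l0: "(\<lambda>m. LINT y|L. g m y) \<longlonglongrightarrow> (LINT y|L. y)"
    proof (rule integral_dominated_convergence[where w="\<lambda>y. \<bar>y\<bar>"])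
      show "AE y in L. (\<lambda>m. g m y) \<longlonglongrightarrow> y"
        by (rule AE_I2) (rule gy)
      show "AE y in L. norm (g m y) \<le> \<bar>y\<bar>" for m
        by (rule AE_I2) (simp add: g_abs(1))
      show "integrable L (\<lambda>y. \<bar>y\<bar>)"
        using L1 by (rule integrable_abs)
    qed measurable
    have sq: "(g m y)\<^sup>2 \<le> y\<^sup>2" for m y
      using g_abs(1)[of m y] by (rule abs_le_square_iff[THEN iffD1])
    have l2: "(\<lambda>m. LINT y|L. (g m y)\<^sup>2) \<longlonglongrightarrow> (LINT y|L. y\<^sup>2)"
    proof (rule integral_dominated_convergence[where w="\<lambda>y. y\<^sup>2"])
      show "AE y in L. (\<lambda>m. (g m y)\<^sup>2) \<longlonglongrightarrow> y\<^sup>2"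
        by (rule AE_I2) (rule tendsto_power[OF gy])
      show "AE y in L. norm ((g m y)\<^sup>2) \<le> y\<^sup>2" for m
        by (rule AE_I2) (simp add: sq)
      show "integrable L (\<lambda>y. y\<^sup>2)" by (rule L2)
    qed measurable
    show "(\<lambda>m. (LINT y|L. g m (y + e \<bullet> h) - g m y)\<^sup>2) \<longlonglongrightarrow> (e \<bullet> h)\<^sup>2"
      by (intro tendsto_power l1)
    show "(\<lambda>m. ((LINT y|L. (g m y)\<^sup>2) - (LINT y|L. g m y)\<^sup>2) * (exp (info \<theta> h h) - 1)) \<longlonglongrightarrow> V * (exp (info \<theta> h h) - 1)"
      unfolding V by (intro tendsto_mult tendsto_diff tendsto_power tendsto_const l2 l0)
    have "(LINT y|L. g m (y + e \<bullet> h) - g m y) = (LINT y|L. g m (y + e \<bullet> h)) - (LINT y|L. g m y)" for m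
      by (intro Bochner_Integration.integral_diff L.integrable_const_bound[where B="real m"])
         (auto simp: g_abs)
    then show "\<forall>\<^sub>F m in sequentially. (LINT y|L. g m (y + e \<bullet> h) - g m y)\<^sup>2
        \<le> ((LINT y|L. (g m y)\<^sup>2) - (LINT y|L. g m y)\<^sup>2) * (exp (info \<theta> h h) - 1)"
      using regular_bounded_inequality[OF \<theta> T' L conv g_cont g_abs(2)] by simp
  qed
  \<comment> \<open>Here \<open>n\<close> only shrinks the shift:
    \<open>h = a \<theta> / sqrt n\<close> has \<open>(e \<bullet> h)^2 = 1 / n\<close> and
    \<open>info \<theta> h h = G \<theta> / n\<close>, and
    \<open>n * (exp (G \<theta> / n) - 1)\<close> tends to \<open>G \<theta>\<close>.\<close>
  have "1 \<le> V * G \<theta>"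
  proof (rule tendsto_lowerbound)
    have G: "0 < G \<theta>" by (rule G_pos[OF \<theta>])
    have "(\<lambda>n. (exp (G \<theta> / real n) - 1) * real n) \<longlonglongrightarrow> G \<theta>"
      using G by real_asymp
    then show "(\<lambda>n. V * ((exp (G \<theta> / real n) - 1) * real n)) \<longlonglongrightarrow> V * G \<theta>"
      by (intro tendsto_mult tendsto_const)
    show "\<forall>\<^sub>F n in sequentially. 1 \<le> V * ((exp (G \<theta> / real n) - 1) * real n)"
      using eventually_ge_at_top[of 1]
    proof eventually_elim
      case (elim n)
      have "info \<theta> ((1 / sqrt (real n)) *\<^sub>R a \<theta>) ((1 / sqrt (real n)) *\<^sub>R a \<theta>)
          = (1 / sqrt (real n)) * ((1 / sqrt (real n)) * info \<theta> (a \<theta>) (a \<theta>))"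
        by (simp add: info_scale_right info_commute[of \<theta> "(1 / sqrt (real n)) *\<^sub>R a \<theta>"])
      also have "\<dots> = G \<theta> / real n"
        using elim info_a_a[OF \<theta>] by (simp add: field_simps)
      finally have i: "info \<theta> ((1 / sqrt (real n)) *\<^sub>R a \<theta>) ((1 / sqrt (real n)) *\<^sub>R a \<theta>) = G \<theta> / real n" .
      have "(e \<bullet> ((1 / sqrt (real n)) *\<^sub>R a \<theta>))\<^sup>2 = 1 / real n"
        using e_a[OF \<theta>] by (simp add: power_divide)
      with key[of "(1 / sqrt (real n)) *\<^sub>R a \<theta>"] have "1 / real n \<le> V * (exp (G \<theta> / real n) - 1)"
        unfolding i by simp
      then show ?case
        using elim by (simp add: field_simps)
    qed
  qed simp
  then show ?thesis
    using G_pos[OF \<theta>] unfolding V_def[symmetric] by (simp add: field_simps)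
qed

end

section \<open>Positive definite matrices\<close>

lemma pos_def_sym: "pos_def A \<Longrightarrow> transpose A = A"
  by (simp add: pos_def_def)

lemma pos_def_pos: "pos_def A \<Longrightarrow> x \<noteq> 0 \<Longrightarrow> 0 < x \<bullet> (A *v x)"
  by (simp add: pos_def_def)

lemma sym_dot: "transpose A = A \<Longrightarrow> x \<bullet> (A *v y) = (A *v x) \<bullet> y" for A :: "real^'k^'k"
  by (metis dot_lmul_matrix vector_transpose_matrix)

lemma matrix_inv_inverse:
  assumes "invertible A"
  shows "A ** matrix_inv A = mat 1" "matrix_inv A ** A = mat 1"
  using someI_ex[OF assms[unfolded invertible_def]] by (auto simp: matrix_inv_def)

lemma matrix_inv_mult_vec:
  fixes A :: "real^'k^'k"
  assumes "invertible A"
  shows "A *v (matrix_inv A *v x) = x" "matrix_inv A *v (A *v x) = x"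
  by (simp_all add: matrix_vector_mul_assoc matrix_inv_inverse[OF assms])

lemma pos_def_invertible:
  assumes "pos_def A"
  shows "invertible A"
  unfolding invertible_left_inverse matrix_left_invertible_ker
proof (intro allI impI)
  fix x assume "A *v x = 0"
  then show "x = 0"
    using pos_def_pos[OF assms, of x] by (cases "x = 0") simp_all
qed

lemma pos_def_matrix_inv:
  assumes "pos_def A"
  shows "pos_def (matrix_inv A)"
  unfolding pos_def_def
proof (intro conjI allI impI)
  note inv = matrix_inv_inverse[OF pos_def_invertible[OF assms]]
    matrix_inv_mult_vec[OF pos_def_invertible[OF assms]]
  have "transpose (matrix_inv A) ** A = transpose (A ** matrix_inv A)"
    by (simp add: matrix_transpose_mul pos_def_sym[OF assms])
  then have "transpose (matrix_inv A) ** A = mat 1"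
    by (simp add: inv transpose_mat)
  then have "transpose (matrix_inv A) ** A ** matrix_inv A = matrix_inv A"
    by simp
  then show "transpose (matrix_inv A) = matrix_inv A"
    by (simp add: inv flip: matrix_mul_assoc)
  fix x :: "real^'a" assume "x \<noteq> 0"
  define z where "z = matrix_inv A *v x"
  have "A *v z = x" by (simp add: z_def inv)
  with \<open>x \<noteq> 0\<close> have "z \<noteq> 0" by auto
  from pos_def_pos[OF assms this] show "0 < x \<bullet> (matrix_inv A *v x)"
    unfolding z_def[symmetric] \<open>A *v z = x\<close> by (simp add: inner_commute)
qed

text \<open>The constant is the minimum of the quadratic form on the unit sphere.\<close>

lemma pos_def_coercive:
  fixes A :: "real^'k^'k"
  assumes "pos_def A"
  shows "\<exists>c>0. \<forall>x. c * (norm x)\<^sup>2 \<le> x \<bullet> (A *v x)"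
proof -
  have "compact (sphere (0::real^'k) 1)" by simp
  moreover have "sphere (0::real^'k) 1 \<noteq> {}" by simp
  moreover have "continuous_on (sphere 0 1) (\<lambda>x. x \<bullet> (A *v x))"
    by (intro continuous_intros linear_continuous_on matrix_vector_mul_linear linear_linear[THEN iffD1])
       (auto intro!: linear_continuous_on matrix_vector_mul_bounded_linear)
  ultimately obtain u where u: "u \<in> sphere 0 1" "\<And>x. x \<in> sphere 0 1 \<Longrightarrow> u \<bullet> (A *v u) \<le> x \<bullet> (A *v x)"
    using continuous_attains_inf[of "sphere (0::real^'k) 1" "\<lambda>x. x \<bullet> (A *v x)"] by auto
  have "0 < u \<bullet> (A *v u)"
    using u(1) by (intro pos_def_pos[OF assms]) auto
  moreover have "(u \<bullet> (A *v u)) * (norm x)\<^sup>2 \<le> x \<bullet> (A *v x)" for x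
  proof (cases "x = 0")
    case False
    let ?y = "(1 / norm x) *\<^sub>R x"
    have "?y \<in> sphere 0 1" using False by simp
    from u(2)[OF this] have "(u \<bullet> (A *v u)) * (norm x)\<^sup>2 \<le> (?y \<bullet> (A *v ?y)) * (norm x)\<^sup>2"
      by (intro mult_right_mono) auto
    also have "\<dots> = x \<bullet> (A *v x)"
      using False by (simp add: matrix_vector_mult_scaleR power2_eq_square)
    finally show ?thesis .
  qed simp
  ultimately show ?thesis by blast
qed

text \<open>If \<open>E = I - \<alpha>A\<close> has operator norm \<open>r < 1\<close>, then \<open>Y \<mapsto> (E + Y\<^sup>2)/2\<close> is a contraction of the ball
  of radius \<open>r\<close>, and its fixed point satisfies \<open>(I - Y)\<^sup>2 = \<alpha>A\<close>.\<close>

lemma pos_def_sqrt_exists: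
  fixes A :: "real^'k^'k"
  assumes "pos_def A"
  shows "\<exists>B. pos_def B \<and> B ** B = A"
proof -
  obtain c where c: "0 < c" "\<And>x. c * (norm x)\<^sup>2 \<le> x \<bullet> (A *v x)"
    using pos_def_coercive[OF assms] by blast
  define F where "F = Blinfun ((*v) A)"
  have F: "blinfun_apply F x = A *v x" for x
    unfolding F_def by (subst bounded_linear_Blinfun_apply) (auto intro: matrix_vector_mul_bounded_linear)
  \<comment> \<open>Adding \<open>c\<close> to the operator norm gives \<open>c / k \<le> 1\<close>,
    so that the radicand of \<open>r\<close> is nonnegative.\<close>
  define k where "k = norm F + c"
  have k: "0 < k" "c \<le> k" "norm (A *v x) \<le> k * norm x" for x
  proof -
    show "0 < k" "c \<le> k" using c(1) by (auto simp: k_def add_nonneg_pos)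
    have "norm (A *v x) \<le> norm F * norm x" using norm_blinfun[of F x] by (simp add: F)
    also have "\<dots> \<le> k * norm x" using c(1) by (intro mult_right_mono) (auto simp: k_def)
    finally show "norm (A *v x) \<le> k * norm x" .
  qed
  \<comment> \<open>This value minimises \<open>1 - 2 * \<alpha> * c + \<alpha>^2 * k^2\<close>; the
    minimum is \<open>1 - (c / k)^2 = r^2\<close>.\<close>
  define \<alpha> where "\<alpha> = c / k\<^sup>2"
  have \<alpha>: "0 < \<alpha>" using c k by (simp add: \<alpha>_def)
  define r where "r = sqrt (1 - (c / k)\<^sup>2)"
  have ck: "0 < c / k" "c / k \<le> 1" using c k by auto
  then have ck2: "(c / k)\<^sup>2 \<le> 1" "0 < (c / k)\<^sup>2" by (auto simp: power_le_one)
  have r: "0 \<le> r" "r < 1" "r\<^sup>2 = 1 - (c / k)\<^sup>2"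
    using ck2 by (auto simp: r_def)
  define E where "E = id_blinfun - \<alpha> *\<^sub>R F"
  have Ex: "blinfun_apply E x = x - \<alpha> *\<^sub>R (A *v x)" for x
    by (simp add: E_def blinfun.diff_left blinfun.scaleR_left F)
  have "norm E \<le> r"
  proof (rule norm_blinfun_bound[OF r(1)])
    fix x
    have "(norm (blinfun_apply E x))\<^sup>2 = (norm x)\<^sup>2 - 2 * \<alpha> * (x \<bullet> (A *v x)) + \<alpha>\<^sup>2 * (norm (A *v x))\<^sup>2"
      unfolding Ex power2_norm_eq_inner
      by (simp add: inner_diff_left inner_diff_right inner_commute power2_eq_square algebra_simps)
    also have "\<dots> \<le> (norm x)\<^sup>2 - 2 * \<alpha> * (c * (norm x)\<^sup>2) + \<alpha>\<^sup>2 * (k * norm x)\<^sup>2"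
      using \<alpha> c(2)[of x] k(3)[of x] by (intro add_mono diff_mono mult_left_mono power_mono) auto
    also have "\<dots> = (1 - 2 * \<alpha> * c + \<alpha>\<^sup>2 * k\<^sup>2) * (norm x)\<^sup>2"
      by (simp add: power_mult_distrib algebra_simps)
    also have "1 - 2 * \<alpha> * c + \<alpha>\<^sup>2 * k\<^sup>2 = r\<^sup>2"
      using k(1) unfolding r(3) by (simp add: \<alpha>_def power2_eq_square field_simps)
    finally have "(norm (blinfun_apply E x))\<^sup>2 \<le> (r * norm x)\<^sup>2"
      by (simp add: power_mult_distrib)
    then show "norm (blinfun_apply E x) \<le> r * norm x"
      by (rule power2_le_imp_le) (use r in simp)
  qed
  \<comment> \<open>Self-adjointness is a closed condition preserved by \<open>f\<close>, so the
    fixed point has it and \<open>I - Y\<close> is symmetric.\<close>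
  define sa where "sa Y \<longleftrightarrow> (\<forall>x y. x \<bullet> blinfun_apply Y y = blinfun_apply Y x \<bullet> y)" for Y :: "(real^'k) \<Rightarrow>\<^sub>L (real^'k)"
  define S where "S = {Y :: (real^'k) \<Rightarrow>\<^sub>L (real^'k). norm Y \<le> r \<and> sa Y}"
  define f where "f Y = (1/2) *\<^sub>R (E + (Y o\<^sub>L Y))" for Y
  have saE: "sa E"
    unfolding sa_def Ex using sym_dot[OF pos_def_sym[OF assms]]
    by (simp add: inner_diff_left inner_diff_right)
  have comp: "norm (Y o\<^sub>L Z) \<le> norm Y * norm Z" for Y Z :: "(real^'k) \<Rightarrow>\<^sub>L (real^'k)"
    by (rule norm_blinfun_compose)
  have "\<exists>!Y. Y \<in> S \<and> f Y = Y"
  proof (rule Banach_fix)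
    have "S = cball 0 r \<inter> (\<Inter>x. \<Inter>y. {Y. x \<bullet> blinfun_apply Y y = blinfun_apply Y x \<bullet> y})"
      by (auto simp: S_def sa_def)
    moreover have "closed \<dots>"
      by (intro closed_Int closed_INT ballI closed_cball closed_Collect_eq continuous_intros)
    ultimately show "Topological_Spaces.complete S" by (simp add: complete_eq_closed)
    show "S \<noteq> {}" using saE \<open>norm E \<le> r\<close> by (auto simp: S_def)
    show "0 \<le> r" "r < 1" using r by auto
    show "f ` S \<subseteq> S"
    proof
      fix W assume "W \<in> f ` S"
      then obtain Y where Y: "norm Y \<le> r" "sa Y" "W = f Y" by (auto simp: S_def)
      have "norm (f Y) \<le> (1/2) * (norm E + norm (Y o\<^sub>L Y))"
        using norm_triangle_ineq[of E "Y o\<^sub>L Y"] by (simp add: f_def)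
      also have "\<dots> \<le> (1/2) * (r + r * r)"
        using \<open>norm E \<le> r\<close> order_trans[OF comp[of Y Y] mult_mono[OF Y(1) Y(1)]] r by simp
      also have "\<dots> \<le> r" using r mult_left_mono[of r 1 r] by simp
      finally have "norm W \<le> r" using Y by simp
      moreover have "sa W"
        using Y(2) saE unfolding Y(3) sa_def f_def
        by (simp add: blinfun.add_left blinfun.scaleR_left inner_add_left inner_add_right)
      ultimately show "W \<in> S" by (simp add: S_def)
    qed
    fix Y Z assume "Y \<in> S" "Z \<in> S"
    then have YZ: "norm Y \<le> r" "norm Z \<le> r" by (auto simp: S_def)
    have "f Y - f Z = (1/2) *\<^sub>R ((Y o\<^sub>L (Y - Z)) + ((Y - Z) o\<^sub>L Z))"
      unfolding f_def by (intro blinfun_eqI)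
        (simp add: blinfun.add_left blinfun.diff_left blinfun.scaleR_left blinfun.diff_right algebra_simps)
    then have "dist (f Y) (f Z) \<le> (1/2) * (norm (Y o\<^sub>L (Y - Z)) + norm ((Y - Z) o\<^sub>L Z))"
      using norm_triangle_ineq[of "Y o\<^sub>L (Y - Z)" "(Y - Z) o\<^sub>L Z"] by (simp add: dist_norm)
    also have "\<dots> \<le> (1/2) * (r * norm (Y - Z) + norm (Y - Z) * r)"
      using YZ r by (intro mult_left_mono add_mono order_trans[OF comp] mult_mono) auto
    finally show "dist (f Y) (f Z) \<le> r * dist Y Z"
      by (simp add: dist_norm algebra_simps)
  qed
  then obtain Y where Y: "norm Y \<le> r" "sa Y" "f Y = Y" by (auto simp: S_def)
  define B where "B = (1 / sqrt \<alpha>) *\<^sub>R (mat 1 - matrix (blinfun_apply Y))"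
  have Yx: "matrix (blinfun_apply Y) *v x = blinfun_apply Y x" for x
    using matrix_works[of "blinfun_apply Y" x]
    by (simp add: linear_matrix_vector_mul_eq blinfun.bounded_linear_right bounded_linear.linear)
  have Bx: "B *v x = (1 / sqrt \<alpha>) *\<^sub>R (x - blinfun_apply Y x)" for x
    by (simp add: B_def Yx scaleR_matrix_vector_assoc[symmetric] matrix_vector_mult_diff_rdistrib)
  have "B ** B = A"
  proof (rule matrix_eq[THEN iffD2], rule allI)
    fix x
    have Y2: "blinfun_apply Y (blinfun_apply Y x) = 2 *\<^sub>R blinfun_apply Y x - (x - \<alpha> *\<^sub>R (A *v x))"
    proof -
      have "blinfun_apply (f Y) x = blinfun_apply Y x" by (simp add: Y(3))
      then have "(1/2) *\<^sub>R (x - \<alpha> *\<^sub>R (A *v x) + blinfun_apply Y (blinfun_apply Y x)) = blinfun_apply Y x"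
        by (simp add: f_def blinfun.add_left blinfun.scaleR_left Ex)
      then have "2 *\<^sub>R blinfun_apply Y x = 2 *\<^sub>R ((1/2) *\<^sub>R (x - \<alpha> *\<^sub>R (A *v x) + blinfun_apply Y (blinfun_apply Y x)))"
        by (simp only:)
      then show ?thesis by simp
    qed
    have "(B ** B) *v x = (1 / \<alpha>) *\<^sub>R (x - blinfun_apply Y x - blinfun_apply Y (x - blinfun_apply Y x))"
      using \<alpha> by (simp add: Bx blinfun.scaleR_right blinfun.diff_right scaleR_diff_right scaleR_add_right flip: matrix_vector_mul_assoc)
    also have "\<dots> = (1 / \<alpha>) *\<^sub>R (\<alpha> *\<^sub>R (A *v x))"
      unfolding blinfun.diff_right Y2 by (simp add: scaleR_2)
    also have "\<dots> = A *v x" using \<alpha> by simp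
    finally show "(B ** B) *v x = A *v x" .
  qed
  moreover have "pos_def B"
    unfolding pos_def_def
  proof (intro conjI allI impI)
    have "(transpose B *v x) \<bullet> y = (B *v x) \<bullet> y" for x y
    proof -
      have "(transpose B *v x) \<bullet> y = x \<bullet> (B *v y)"
        by (metis dot_lmul_matrix transpose_matrix_vector)
      also have "\<dots> = (B *v x) \<bullet> y"
        using Y(2) by (simp add: Bx sa_def inner_diff_left inner_diff_right)
      finally show ?thesis .
    qed
    then have "transpose B *v x = B *v x" for x
      by (rule vector_eq_rdot[THEN iffD1, OF allI])
    then show "transpose B = B" by (simp add: matrix_eq)
    fix x :: "real^'k" assume "x \<noteq> 0"
    \<comment> \<open>\<open>norm Y \<le> r < 1\<close> makes \<open>I - Y\<close> positive
      definite, so the fixed point yields the positive square root.\<close>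
    have "x \<bullet> blinfun_apply Y x \<le> norm x * (r * norm x)"
      using norm_cauchy_schwarz[of x "blinfun_apply Y x"] norm_blinfun[of Y x] mult_right_mono[OF Y(1), of "norm x"]
      by (meson mult_left_mono norm_ge_zero order_trans)
    also have "\<dots> < norm x * norm x"
      using r \<open>x \<noteq> 0\<close> by simp
    finally have "0 < x \<bullet> x - x \<bullet> blinfun_apply Y x" by (simp add: dot_square_norm power2_eq_square)
    then show "0 < x \<bullet> (B *v x)"
      using \<alpha> by (simp add: Bx inner_diff_right)
  qed
  ultimately show ?thesis by blast
qed

text \<open>The trace is the sum of the quadratic form of \<open>B\<close> over the columns of
  \<open>D\<close>.\<close>

lemma trace_sandwich_nonneg:
  fixes B D :: "real^'k^'k"
  assumes "pos_def B" "transpose D = D"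
  shows "0 \<le> trace (D ** B ** D)" and "trace (D ** B ** D) = 0 \<Longrightarrow> D = 0"
proof -
  have tr: "trace (D ** B ** D) = (\<Sum>i\<in>UNIV. (D *v axis i 1) \<bullet> (B *v (D *v axis i 1)))"
  proof -
    have "(D ** B ** D) $ i $ i = axis i 1 \<bullet> ((D ** B ** D) *v axis i 1)" for i
      by (simp add: inner_axis' matrix_vector_mult_basis column_def)
    also have "axis i 1 \<bullet> ((D ** B ** D) *v axis i 1) = (D *v axis i 1) \<bullet> (B *v (D *v axis i 1))" for i
      by (simp add: sym_dot[OF assms(2)] flip: matrix_vector_mul_assoc)
    finally show ?thesis by (simp add: trace_def)
  qed
  have nn: "0 \<le> y \<bullet> (B *v y)" for y
    using pos_def_pos[OF assms(1), of y] by (cases "y = 0") auto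
  show "0 \<le> trace (D ** B ** D)"
    unfolding tr by (intro sum_nonneg nn)
  assume "trace (D ** B ** D) = 0"
  then have "(D *v axis i 1) \<bullet> (B *v (D *v axis i 1)) = 0" for i
    unfolding tr by (simp add: sum_nonneg_eq_0_iff nn)
  then have "D *v axis i 1 = 0" for i
    using pos_def_pos[OF assms(1), of "D *v axis i 1"] by force
  then have "column i D = 0" for i
    by (simp add: matrix_vector_mult_basis)
  then show "D = 0"
    by (simp add: column_def vec_eq_iff)
qed

text \<open>\<open>B(B - C) + (B - C)C = B\<^sup>2 - C\<^sup>2\<close>; multiplying by \<open>B - C\<close> and taking traces gives two
  nonnegative terms.\<close>

lemma pos_def_sqrt_unique:
  fixes B C :: "real^'k^'k"
  assumes "pos_def B" "pos_def C" "B ** B = C ** C"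
  shows "B = C"
proof -
  define D where "D = B - C"
  have D: "transpose D = D"
  proof -
    have "transpose D = transpose B - transpose C"
      by (simp add: D_def transpose_def vec_eq_iff)
    then show ?thesis
      by (simp add: D_def pos_def_sym[OF assms(1)] pos_def_sym[OF assms(2)])
  qed
  have "B ** D + D ** C = 0"
  proof -
    have "B ** (B - C) = B ** B - B ** C" "(B - C) ** C = B ** C - C ** C"
      by (simp_all add: matrix_matrix_mult_def vec_eq_iff sum_subtractf algebra_simps)
    then show ?thesis using assms(3) by (simp add: D_def)
  qed
  then have "D ** (B ** D + D ** C) = 0" by simp
  then have "trace (D ** B ** D) + trace (D ** (D ** C)) = 0"
    by (simp only: matrix_add_ldistrib matrix_mul_assoc flip: trace_add) (simp add: trace_def)
  moreover have "trace (D ** (D ** C)) = trace (D ** C ** D)"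
    by (rule trace_mul_sym)
  ultimately have "trace (D ** B ** D) = 0"
    using trace_sandwich_nonneg(1)[OF assms(1) D] trace_sandwich_nonneg(1)[OF assms(2) D] by linarith
  then have "D = 0"
    by (rule trace_sandwich_nonneg(2)[OF assms(1) D])
  then show ?thesis by (simp add: D_def)
qed

lemma inv_sqrt_pos_def:
  assumes "pos_def A"
  shows "pos_def (inv_sqrt A)" "inv_sqrt A ** inv_sqrt A = matrix_inv A"
proof -
  obtain B where B: "pos_def B" "B ** B = matrix_inv A"
    using pos_def_sqrt_exists[OF pos_def_matrix_inv[OF assms]] by blast
  have "pos_def (inv_sqrt A) \<and> inv_sqrt A ** inv_sqrt A = matrix_inv A"
    unfolding inv_sqrt_def by (rule theI[of _ B]) (use B in \<open>auto intro: pos_def_sqrt_unique\<close>)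
  then show "pos_def (inv_sqrt A)" "inv_sqrt A ** inv_sqrt A = matrix_inv A" by auto
qed

lemma norm_inv_sqrt:
  assumes "pos_def A"
  shows "(norm (inv_sqrt A *v y))\<^sup>2 = y \<bullet> (matrix_inv A *v y)"
  unfolding power2_norm_eq_inner inv_sqrt_pos_def(2)[OF assms, symmetric]
  by (simp add: sym_dot[OF pos_def_sym[OF inv_sqrt_pos_def(1)[OF assms]]] flip: matrix_vector_mul_assoc)

text \<open>The determinant is the square of the nonzero determinant of a positive definite square
  root.\<close>

lemma pos_def_det_pos:
  assumes "pos_def A"
  shows "0 < det A"
proof -
  obtain B where B: "pos_def B" "B ** B = A"
    using pos_def_sqrt_exists[OF assms] by blast
  then have "det B \<noteq> 0"
    using pos_def_invertible[OF B(1)] by (simp add: invertible_det_nz)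
  then show ?thesis
    using B(2) by (auto simp: det_mul not_less order.strict_iff_order simp flip: power2_eq_square)
qed

lemma det_inv_sqrt:
  assumes "pos_def A"
  shows "det (inv_sqrt A) = det A powr (- 1 / 2)"
proof -
  have "det (inv_sqrt A) * det (inv_sqrt A) * det A = det (matrix_inv A ** A)"
    by (simp add: inv_sqrt_pos_def(2)[OF assms, symmetric] det_mul)
  also have "\<dots> = 1"
    by (simp add: matrix_inv_inverse[OF pos_def_invertible[OF assms]])
  finally have "(det (inv_sqrt A))\<^sup>2 = inverse (det A)"
    using pos_def_det_pos[OF assms] by (simp add: power2_eq_square field_simps)
  then have "det (inv_sqrt A) = sqrt (inverse (det A))"
    using pos_def_det_pos[OF inv_sqrt_pos_def(1)[OF assms]] by (simp add: real_sqrt_unique)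
  also have "\<dots> = det A powr (- 1 / 2)"
    using pos_def_det_pos[OF assms] by (simp add: powr_minus powr_half_sqrt real_sqrt_inverse flip: minus_divide_left)
  finally show ?thesis .
qed

section \<open>Linear change of variables\<close>

text \<open>The library's change of variables requires a well-ordered index type; a copy of the index
  type, well-ordered by its finite linear order, provides one.\<close>

typedef 'k wcopy = "UNIV :: 'k set"
  by simp

instantiation wcopy :: (linorder) linorder
begin

definition "x \<le> y \<longleftrightarrow> Rep_wcopy x \<le> Rep_wcopy y"
definition "x < y \<longleftrightarrow> Rep_wcopy x < Rep_wcopy y"

instance
  by intro_classes (auto simp: less_eq_wcopy_def less_wcopy_def less_le Rep_wcopy_inject)

end

instance wcopy :: (finite) finite
proof
  have "inj (Rep_wcopy :: 'a wcopy \<Rightarrow> 'a)"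
    by (simp add: inj_def Rep_wcopy_inject)
  then show "finite (UNIV :: 'a wcopy set)"
    by (rule inj_on_finite[where B = UNIV]) simp_all
qed

instance wcopy :: ("{finite,linorder}") wellorder
proof
  fix P :: "'a wcopy \<Rightarrow> bool" and a :: "'a wcopy"
  assume IH: "\<And>x. (\<And>y. y < x \<Longrightarrow> P y) \<Longrightarrow> P x"
  show "P a"
  proof (induction a rule: measure_induct_rule[where f = "\<lambda>a. card {y. y < a}"])
    case (less a)
    show ?case
    proof (rule IH)
      fix y assume "y < a"
      then have "{z. z < y} \<subset> {z. z < a}" by auto
      then have "card {z. z < y} < card {z. z < a}" by (intro psubset_card_mono) auto
      then show "P y" by (rule less)
    qed
  qed
qed

lemma bij_Rep_wcopy: "bij Rep_wcopy" and bij_Abs_wcopy: "bij Abs_wcopy"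
  by (auto intro!: o_bij[of Abs_wcopy] o_bij[of Rep_wcopy] simp: fun_eq_iff Rep_wcopy_inverse Abs_wcopy_inverse)

lemma all_wcopy: "(\<forall>i. Q i) \<longleftrightarrow> (\<forall>j. Q (Abs_wcopy j))"
  using bij_Abs_wcopy by (metis bij_pointE)

definition to_w :: "real^'k \<Rightarrow> real^('k wcopy)" where "to_w x = (\<chi> i. x $ Rep_wcopy i)"
definition of_w :: "real^('k wcopy) \<Rightarrow> real^'k" where "of_w y = (\<chi> i. y $ Abs_wcopy i)"

lemma to_w_of_w [simp]: "to_w (of_w y) = y" and of_w_to_w [simp]: "of_w (to_w x) = x"
  by (simp_all add: to_w_def of_w_def vec_eq_iff Rep_wcopy_inverse Abs_wcopy_inverse)

lemma to_w_measurable [measurable]: "to_w \<in> borel_measurable borel"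
  and of_w_measurable [measurable]: "of_w \<in> borel_measurable borel"
proof -
  have "linear (to_w :: real^'k \<Rightarrow> _)" "linear (of_w :: _ \<Rightarrow> real^'k)"
    by (auto simp: to_w_def of_w_def vec_eq_iff intro!: linearI)
  then show "to_w \<in> borel_measurable (borel :: (real^'k) measure)" "of_w \<in> borel_measurable (borel :: (real^'k wcopy) measure)"
    by (auto intro!: borel_measurable_continuous_onI linear_continuous_on simp: linear_conv_bounded_linear)
qed

lemma prod_Basis_vec:
  fixes x :: "real^'n"
  shows "(\<Prod>b\<in>Basis. x \<bullet> b) = (\<Prod>i\<in>UNIV. x $ i)"
proof -
  have "bij_betw (\<lambda>i. axis i 1 :: real^'n) UNIV Basis"
    by (auto simp: bij_betw_def inj_def axis_eq_axis Basis_vec_def)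
  from prod.reindex_bij_betw[OF this, of "\<lambda>b. x \<bullet> b"] show ?thesis
    by (simp add: inner_axis)
qed

lemma distr_to_w: "distr lborel borel (to_w :: real^'k \<Rightarrow> _) = lborel"
proof (rule lborel_eqI[symmetric])
  fix l u :: "real^'k wcopy"
  assume le: "\<And>b. b \<in> Basis \<Longrightarrow> l \<bullet> b \<le> u \<bullet> b"
  then have le': "l $ i \<le> u $ i" for i
    using le[of "axis i 1"] by (simp add: inner_axis axis_in_Basis_iff)
  have lew: "of_w l \<bullet> b \<le> of_w u \<bullet> b" if "b \<in> Basis" for b
    using that le' by (auto simp: Basis_vec_def inner_axis of_w_def)
  have "to_w -` box l u = box (of_w l) (of_w u :: real^'k)"
    by (simp add: set_eq_iff mem_box_cart to_w_def of_w_def all_wcopy Abs_wcopy_inverse)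
  then have "emeasure (distr lborel borel (to_w :: real^'k \<Rightarrow> _)) (box l u) = emeasure lborel (box (of_w l) (of_w u :: real^'k))"
    by (simp add: emeasure_distr)
  also have "\<dots> = (\<Prod>b\<in>Basis. (of_w u - of_w l :: real^'k) \<bullet> b)"
    using lew by (simp add: emeasure_lborel_box_eq)
  also have "(\<Prod>b\<in>Basis. (of_w u - of_w l :: real^'k) \<bullet> b) = (\<Prod>i\<in>UNIV. (u - l) $ Abs_wcopy i)"
    unfolding prod_Basis_vec by (simp add: of_w_def)
  also have "\<dots> = (\<Prod>i\<in>UNIV. (u - l) $ i)"
    by (rule prod.reindex_bij_betw[OF bij_Abs_wcopy])
  also have "\<dots> = (\<Prod>b\<in>Basis. (u - l) \<bullet> b)"
    by (rule prod_Basis_vec[symmetric])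
  finally show "emeasure (distr lborel borel (to_w :: real^'k \<Rightarrow> _)) (box l u) = (\<Prod>b\<in>Basis. (u - l) \<bullet> b)" .
qed simp

definition mat_w :: "real^'k^'k \<Rightarrow> real^('k wcopy)^('k wcopy)"
  where "mat_w A = (\<chi> i j. A $ Rep_wcopy i $ Rep_wcopy j)"

lemma to_w_mult: "to_w (A *v x) = mat_w A *v to_w x"
  unfolding to_w_def mat_w_def matrix_vector_mult_def
  by (simp add: vec_eq_iff sum.reindex_bij_betw[OF bij_Rep_wcopy, of "\<lambda>j. A $ _ $ j * x $ j"])

text \<open>Conjugation by the bijection \<open>Rep_wcopy\<close> maps the permutations of one index
  type onto those of the other and preserves signs, so the Leibniz sums agree term by term.\<close>

lemma det_mat_w: "det (mat_w A) = det (A :: real^'k^'k)"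
proof -
  let ?r = "Rep_wcopy :: 'k wcopy \<Rightarrow> 'k"
  let ?m = "map_permutation UNIV ?r"
  have inj: "inj ?r" and surj: "range ?r = UNIV"
    using bij_Rep_wcopy by (auto simp: bij_def)
  have m_perm: "?m p permutes UNIV" if "p permutes UNIV" for p
    using map_permutation_permutes[OF bij_Rep_wcopy that] .
  have m_app: "?m p (?r i) = ?r (p i)" for p i
    by (rule map_permutation_apply[OF inj UNIV_I])
  have m_bij: "bij_betw ?m {p. p permutes UNIV} {p. p permutes UNIV}"
  proof (rule bij_betw_byWitness[where f' = "map_permutation UNIV (inv ?r)"])
    have bi: "bij (inv ?r)" using bij_Rep_wcopy by (rule bij_imp_bij_inv)
    show "\<forall>p\<in>{p. p permutes UNIV}. map_permutation UNIV (inv ?r) (?m p) = p"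
    proof (intro ballI ext)
      fix p i assume "p \<in> {p. p permutes (UNIV :: 'k wcopy set)}"
      have "map_permutation UNIV (inv ?r) (?m p) (inv ?r (?r i)) = inv ?r (?m p (?r i))"
        by (rule map_permutation_apply[OF bij_is_inj[OF bi] UNIV_I])
      then show "map_permutation UNIV (inv ?r) (?m p) i = p i"
        by (simp add: m_app inv_f_f[OF inj])
    qed
    show "\<forall>q\<in>{p. p permutes UNIV}. ?m (map_permutation UNIV (inv ?r) q) = q"
    proof (intro ballI ext)
      fix q i assume "q \<in> {p. p permutes (UNIV :: 'k set)}"
      have "?m (map_permutation UNIV (inv ?r) q) (?r (inv ?r i)) = ?r (map_permutation UNIV (inv ?r) q (inv ?r i))"
        by (rule m_app)
      also have "map_permutation UNIV (inv ?r) q (inv ?r i) = inv ?r (q i)"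
        by (rule map_permutation_apply[OF bij_is_inj[OF bi] UNIV_I])
      finally show "?m (map_permutation UNIV (inv ?r) q) i = q i"
        using surj by (simp add: f_inv_into_f)
    qed
    show "?m ` {p. p permutes UNIV} \<subseteq> {p. p permutes UNIV}" using m_perm by auto
    show "map_permutation UNIV (inv ?r) ` {p. p permutes UNIV} \<subseteq> {p. p permutes UNIV}"
      using map_permutation_permutes[OF bi] by auto
  qed
  have "det A = (\<Sum>p\<in>{p. p permutes UNIV}. of_int (sign (?m p)) * (\<Prod>i\<in>UNIV. A $ i $ ?m p i))"
    unfolding det_def by (rule sum.reindex_bij_betw[OF m_bij, symmetric])
  also have "\<dots> = (\<Sum>p\<in>{p. p permutes UNIV}. of_int (sign p) * (\<Prod>i\<in>UNIV. mat_w A $ i $ p i))"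
  proof (rule sum.cong[OF refl])
    fix p assume "p \<in> {p. p permutes (UNIV :: 'k wcopy set)}"
    then have "sign (?m p) = sign p"
      using inj by (intro sign_map_permutation) auto
    moreover have "(\<Prod>i\<in>UNIV. A $ i $ ?m p i) = (\<Prod>i\<in>UNIV. A $ ?r i $ ?m p (?r i))"
      by (rule prod.reindex_bij_betw[OF bij_Rep_wcopy, symmetric])
    ultimately show "of_int (sign (?m p)) * (\<Prod>i\<in>UNIV. A $ i $ ?m p i) = of_int (sign p) * (\<Prod>i\<in>UNIV. mat_w A $ i $ p i)"
      by (simp add: m_app mat_w_def)
  qed
  also have "\<dots> = det (mat_w A)"
    by (simp add: det_def)
  finally show ?thesis ..
qed

text \<open>It suffices to compare the measures of boxes: the preimage of a box is its image under
  the inverse matrix, whose volume carries the factor \<open>|det (matrix_inv A)|\<close>.\<close>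

lemma lborel_linear_wellorder:
  fixes A :: "real^'n::{finite,wellorder}^'n::_"
  assumes "det A \<noteq> 0"
  shows "lborel = density (distr lborel borel ((*v) A)) (\<lambda>_. ennreal \<bar>det A\<bar>)"
proof (rule lborel_eqI)
  have inv: "invertible A" using assms by (simp add: invertible_det_nz)
  have [measurable]: "(*v) A \<in> borel_measurable borel"
    by (intro borel_measurable_continuous_onI linear_continuous_on matrix_vector_mul_bounded_linear)
  fix l u :: "real^'n::_" assume le: "\<And>b. b \<in> Basis \<Longrightarrow> l \<bullet> b \<le> u \<bullet> b"
  let ?B = "matrix_inv A"
  have vi: "(*v) A -` box l u = (*v) ?B ` box l u"
  proof (intro set_eqI iffI)
    fix x assume "x \<in> (*v) A -` box l u"
    then show "x \<in> (*v) ?B ` box l u"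
      by (intro image_eqI[of _ _ "A *v x"]) (auto simp: matrix_inv_mult_vec[OF inv])
  qed (auto simp: matrix_inv_mult_vec[OF inv])
  have borel: "(*v) A -` box l u \<in> sets borel"
    using measurable_sets[of "(*v) A" borel borel "box l u"] by simp
  have bl: "box l u \<in> lmeasurable" by simp
  have 1: "(*v) ?B ` box l u \<in> lmeasurable"
    by (rule measurable_linear_image[OF _ bl]) simp
  have 2: "measure lebesgue ((*v) ?B ` box l u) = \<bar>det ?B\<bar> * measure lebesgue (box l u)"
    using measure_linear_image[OF _ bl, of "(*v) ?B"] by (simp add: matrix_of_matrix_vector_mul)
  have "emeasure lborel ((*v) A -` box l u) = emeasure lebesgue ((*v) A -` box l u)"
    using borel by simp
  also have "\<dots> = ennreal (\<bar>det ?B\<bar> * measure lebesgue (box l u))"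
    unfolding vi 2[symmetric] using 1 by (intro emeasure_eq_measure2) (auto simp: fmeasurable_def)
  finally have em: "emeasure lborel ((*v) A -` box l u) = ennreal (\<bar>det ?B\<bar> * measure lebesgue (box l u))" .
  have "det A * det ?B = 1"
    using matrix_inv_inverse(1)[OF inv] by (metis det_I det_mul)
  then have dd: "\<bar>det A\<bar> * \<bar>det ?B\<bar> = 1" by (simp flip: abs_mult)
  have "emeasure (density (distr lborel borel ((*v) A)) (\<lambda>_. ennreal \<bar>det A\<bar>)) (box l u)
      = ennreal \<bar>det A\<bar> * emeasure lborel ((*v) A -` box l u)"
    by (simp add: emeasure_density nn_integral_cmult_indicator emeasure_distr)
  also have "\<dots> = ennreal (\<bar>det A\<bar> * (\<bar>det ?B\<bar> * measure lebesgue (box l u)))"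
    unfolding em by (simp add: ennreal_mult)
  also have "\<bar>det A\<bar> * (\<bar>det ?B\<bar> * measure lebesgue (box l u)) = measure lebesgue (box l u)"
    using dd by (simp flip: mult.assoc)
  also have "measure lebesgue (box l u) = (\<Prod>b\<in>Basis. (u - l) \<bullet> b)"
    using le by (simp add: measure_lborel_box_eq)
  finally show "emeasure (density (distr lborel borel ((*v) A)) (\<lambda>_. ennreal \<bar>det A\<bar>)) (box l u) = (\<Prod>b\<in>Basis. (u - l) \<bullet> b)" .
qed simp

lemma matrix_vector_mult_measurable [measurable]:
  "(*v) (A :: real^'n^'m) \<in> borel_measurable borel"
  by (intro borel_measurable_continuous_onI linear_continuous_on matrix_vector_mul_bounded_linear)

lemma nn_integral_linear:
  fixes A :: "real^'k::{finite,linorder}^'k::_"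
  assumes "det A \<noteq> 0" and [measurable]: "f \<in> borel_measurable borel"
  shows "(\<integral>\<^sup>+x. f x \<partial>lborel) = ennreal \<bar>det A\<bar> * (\<integral>\<^sup>+x. f (A *v x) \<partial>lborel)"
proof -
  have tr: "(\<integral>\<^sup>+y. g y \<partial>lborel) = (\<integral>\<^sup>+x. g (to_w x) \<partial>lborel)" if [measurable]: "g \<in> borel_measurable borel" for g :: "real^'k wcopy \<Rightarrow> ennreal"
    unfolding distr_to_w[symmetric] by (subst nn_integral_distr) auto
  have "(\<integral>\<^sup>+x. f x \<partial>lborel) = (\<integral>\<^sup>+x. f (of_w (to_w x)) \<partial>lborel)"
    by simp
  also have "\<dots> = (\<integral>\<^sup>+y. f (of_w y) \<partial>lborel)"
    by (subst tr) auto
  also have "\<dots> = ennreal \<bar>det (mat_w A)\<bar> * (\<integral>\<^sup>+y. f (of_w (mat_w A *v y)) \<partial>lborel)"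
    using assms(1)
    by (subst lborel_linear_wellorder[of "mat_w A"]) (auto simp: det_mat_w nn_integral_density nn_integral_cmult nn_integral_distr)
  also have "\<dots> = ennreal \<bar>det A\<bar> * (\<integral>\<^sup>+x. f (of_w (mat_w A *v to_w x)) \<partial>lborel)"
    unfolding det_mat_w by (subst tr) auto
  also have "\<dots> = ennreal \<bar>det A\<bar> * (\<integral>\<^sup>+x. f (A *v x) \<partial>lborel)"
    by (simp flip: to_w_mult)
  finally show ?thesis .
qed

section \<open>Normalisation of the Student density\<close>

lemma nn_integral_Gamma_scaled:
  fixes a z :: real
  assumes "0 < a" "0 < z"
  shows "(\<integral>\<^sup>+t. ennreal (t powr (a - 1) * exp (- (z * t))) * indicator {0..} t \<partial>lborel) = ennreal (Gamma a * z powr (- a))"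
proof -
  let ?f = "\<lambda>z t. ennreal (t powr (a - 1) * exp (- (z * t))) * indicator {0..} t"
  have "((\<lambda>t. t powr (a - 1) * exp (- (1 * t))) has_integral Gamma a) {0..}"
    using Gamma_integral_real[OF assms(1)] by (simp add: exp_minus divide_inverse)
  then have 1: "(\<integral>\<^sup>+t. ?f 1 t \<partial>lborel) = ennreal (Gamma a)"
    by (intro nn_integral_has_integral_lebesgue') auto
  have "(\<integral>\<^sup>+t. ?f 1 t \<partial>lborel) = ennreal \<bar>z\<bar> * (\<integral>\<^sup>+t. ?f 1 (0 + z * t) \<partial>lborel)"
    by (rule nn_integral_real_affine) (use assms in auto)
  also have "(\<integral>\<^sup>+t. ?f 1 (0 + z * t) \<partial>lborel) = (\<integral>\<^sup>+t. ennreal (z powr (a - 1)) * ?f z t \<partial>lborel)"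
  proof (rule nn_integral_cong)
    fix t :: real
    show "?f 1 (0 + z * t) = ennreal (z powr (a - 1)) * ?f z t"
      using assms by (cases "t \<ge> 0") (auto simp: powr_mult ennreal_mult' mult_less_0_iff zero_le_mult_iff mult.assoc split: split_indicator)
  qed
  also have "\<dots> = ennreal (z powr (a - 1)) * (\<integral>\<^sup>+t. ?f z t \<partial>lborel)"
    by (rule nn_integral_cmult) measurable
  finally have "ennreal (z powr a) * (\<integral>\<^sup>+t. ?f z t \<partial>lborel) = ennreal (Gamma a)"
    using assms 1 by (simp add: powr_diff flip: mult.assoc ennreal_mult')
  then have "ennreal (z powr (- a)) * (ennreal (z powr a) * (\<integral>\<^sup>+t. ?f z t \<partial>lborel)) = ennreal (z powr (- a)) * ennreal (Gamma a)"
    by simp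
  moreover have "ennreal (z powr (- a)) * ennreal (z powr a) = 1"
    using assms by (simp add: ennreal_mult'[symmetric] powr_add[symmetric])
  ultimately show ?thesis
    using assms by (simp add: ennreal_mult'[symmetric] mult.commute flip: mult.assoc)
qed

lemma nn_integral_gaussian_1d:
  fixes t :: real
  assumes "0 < t"
  shows "(\<integral>\<^sup>+x. ennreal (exp (- (t * x\<^sup>2))) \<partial>lborel) = ennreal (sqrt (pi / t))"
proof -
  define \<sigma> where "\<sigma> = 1 / sqrt (2 * t)"
  have \<sigma>: "0 < \<sigma>" "2 * \<sigma>\<^sup>2 = 1 / t" using assms by (simp_all add: \<sigma>_def power_divide)
  interpret prob_space "density lborel (normal_density 0 \<sigma>)"
    by (rule prob_space_normal_density[OF \<sigma>(1)])
  have 1: "(\<integral>\<^sup>+x. ennreal (normal_density 0 \<sigma> x) \<partial>lborel) = 1"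
    using emeasure_space_1 by (simp add: emeasure_density)
  have "2 * pi * \<sigma>\<^sup>2 = pi * (2 * \<sigma>\<^sup>2)" by simp
  then have "2 * pi * \<sigma>\<^sup>2 = pi / t" unfolding \<sigma>(2) by simp
  then have e: "exp (- (t * x\<^sup>2)) = sqrt (pi / t) * normal_density 0 \<sigma> x" for x
    using assms \<sigma>(2) by (simp add: normal_density_def mult.commute)
  have "(\<integral>\<^sup>+x. ennreal (exp (- (t * x\<^sup>2))) \<partial>lborel) = (\<integral>\<^sup>+x. ennreal (sqrt (pi / t)) * ennreal (normal_density 0 \<sigma> x) \<partial>lborel)"
    unfolding e using assms by (simp add: ennreal_mult')
  also have "\<dots> = ennreal (sqrt (pi / t)) * 1"
    by (subst nn_integral_cmult) (auto simp: 1)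
  finally show ?thesis by simp
qed

lemma nn_integral_gaussian:
  fixes t :: real
  assumes "0 < t"
  shows "(\<integral>\<^sup>+y. ennreal (exp (- (t * (norm (y :: real^'k))\<^sup>2))) \<partial>lborel) = ennreal ((pi / t) powr (real CARD('k) / 2))"
proof -
  have e: "ennreal (exp (- (t * (norm y)\<^sup>2))) = (\<Prod>b\<in>Basis. ennreal (exp (- (t * (y \<bullet> b)\<^sup>2))))" for y :: "real^'k"
  proof -
    have "(norm y)\<^sup>2 = (\<Sum>b\<in>Basis. (y \<bullet> b)\<^sup>2)"
      unfolding power2_norm_eq_inner by (subst euclidean_inner) (simp add: power2_eq_square)
    then have "exp (- (t * (norm y)\<^sup>2)) = (\<Prod>b\<in>Basis. exp (- (t * (y \<bullet> b)\<^sup>2)))"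
      by (simp add: sum_distrib_left exp_sum flip: sum_negf)
    then show ?thesis by (simp add: prod_ennreal)
  qed
  have "(\<integral>\<^sup>+y. ennreal (exp (- (t * (norm (y :: real^'k))\<^sup>2))) \<partial>lborel) = (\<Prod>b\<in>(Basis :: (real^'k) set). \<integral>\<^sup>+x. ennreal (exp (- (t * x\<^sup>2))) \<partial>lborel)"
    unfolding e by (rule nn_integral_lborel_prod) auto
  also have "\<dots> = ennreal (sqrt (pi / t)) ^ CARD('k)"
    by (simp add: nn_integral_gaussian_1d[OF assms])
  also have "\<dots> = ennreal ((sqrt (pi / t)) ^ CARD('k))"
    using assms by (simp add: ennreal_power)
  also have "(sqrt (pi / t)) ^ CARD('k) = (pi / t) powr (real CARD('k) / 2)"
  proof -
    have "0 < pi / t" using assms by simp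
    then have "(sqrt (pi / t)) ^ CARD('k) = ((pi / t) powr (1 / 2)) powr real CARD('k)"
      by (subst powr_realpow) (auto simp: powr_half_sqrt)
    then show ?thesis by (simp add: powr_powr)
  qed
  finally show ?thesis .
qed

text \<open>\<open>Gamma a * q powr (- a)\<close> is the integral of
  \<open>t powr (a - 1) * exp (- (q * t))\<close> over \<open>t \<ge> 0\<close>, which makes the
  integrand a mixture of Gaussians. Exchanging the integrals leaves the Gaussian integral
  \<open>(pi / t) powr (k / 2)\<close> and then a Gamma integral with parameter
  \<open>a - k / 2\<close>, whence the condition on \<open>a\<close>.\<close>

lemma nn_integral_radial:
  fixes a :: real
  assumes "real CARD('k) / 2 < a"
  shows "(\<integral>\<^sup>+y. ennreal ((1 + (norm (y :: real^'k))\<^sup>2) powr (- a)) \<partial>lborel)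
    = ennreal (pi powr (real CARD('k) / 2) * Gamma (a - real CARD('k) / 2) / Gamma a)"
proof -
  let ?k = "real CARD('k) / 2"
  have a: "0 < a" "0 < a - ?k" using assms by (auto intro: le_less_trans[rotated])
  have Ga: "0 < Gamma a" "0 < Gamma (a - ?k)" using a by (auto intro: Gamma_real_pos)
  let ?f = "\<lambda>z t. ennreal (t powr (a - 1) * exp (- (z * t))) * indicator {0..} t"
  have "ennreal (Gamma a) * (\<integral>\<^sup>+y. ennreal ((1 + (norm (y :: real^'k))\<^sup>2) powr (- a)) \<partial>lborel)
      = (\<integral>\<^sup>+y. ennreal (Gamma a * (1 + (norm (y :: real^'k))\<^sup>2) powr (- a)) \<partial>lborel)"
    using Ga by (subst nn_integral_cmult[symmetric]) (auto simp: ennreal_mult')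
  also have "\<dots> = (\<integral>\<^sup>+y. (\<integral>\<^sup>+t. ?f (1 + (norm (y :: real^'k))\<^sup>2) t \<partial>lborel) \<partial>lborel)"
    using a by (subst nn_integral_Gamma_scaled) (auto simp: add_pos_nonneg)
  also have "\<dots> = (\<integral>\<^sup>+t. (\<integral>\<^sup>+y. ?f (1 + (norm (y :: real^'k))\<^sup>2) t \<partial>lborel) \<partial>lborel)"
    by (rule lborel_pair.Fubini'[symmetric]) measurable
  also have "\<dots> = (\<integral>\<^sup>+t. ennreal (pi powr ?k) * (ennreal (t powr ((a - ?k) - 1) * exp (- (1 * t))) * indicator {0..} t) \<partial>lborel)"
  proof (rule nn_integral_cong_AE)
    have "AE t in lborel. t \<noteq> (0::real)" by (rule AE_lborel_singleton)
    then show "AE t in lborel. (\<integral>\<^sup>+y. ?f (1 + (norm (y :: real^'k))\<^sup>2) t \<partial>lborel)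
        = ennreal (pi powr ?k) * (ennreal (t powr ((a - ?k) - 1) * exp (- (1 * t))) * indicator {0..} t)"
    proof eventually_elim
      case (elim t)
      show ?case
      proof (cases "0 < t")
        case True
        have *: "?f (1 + (norm y)\<^sup>2) t = ennreal (t powr (a - 1) * exp (- t)) * ennreal (exp (- (t * (norm y)\<^sup>2)))" for y :: "real^'k"
        proof -
          have "exp (- ((1 + (norm y)\<^sup>2) * t)) = exp (- t) * exp (- (t * (norm y)\<^sup>2))"
            unfolding exp_add[symmetric] by (simp add: algebra_simps)
          then show ?thesis
            using True by (simp add: ennreal_mult'[symmetric] mult.assoc)
        qed
        have "(\<integral>\<^sup>+y. ?f (1 + (norm (y :: real^'k))\<^sup>2) t \<partial>lborel)
            = (\<integral>\<^sup>+y. ennreal (t powr (a - 1) * exp (- t)) * ennreal (exp (- (t * (norm (y :: real^'k))\<^sup>2))) \<partial>lborel)"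
          by (rule nn_integral_cong) (rule *)
        also have "\<dots> = ennreal (t powr (a - 1) * exp (- t)) * ennreal ((pi / t) powr ?k)"
          unfolding nn_integral_gaussian[OF True, symmetric] by (rule nn_integral_cmult) measurable
        also have "\<dots> = ennreal (pi powr ?k) * (ennreal (t powr ((a - ?k) - 1) * exp (- (1 * t))) * indicator {0..} t)"
        proof -
          have "(pi / t) powr ?k = pi powr ?k * t powr (- ?k)"
            unfolding powr_minus divide_inverse[symmetric] using True by (subst powr_divide) auto
          moreover have "t powr (a - 1) * t powr (- ?k) = t powr ((a - ?k) - 1)"
            unfolding powr_add[symmetric] by (rule arg_cong2[where f = "(powr)"]) auto
          ultimately have "t powr (a - 1) * exp (- t) * (pi / t) powr ?k = pi powr ?k * (t powr ((a - ?k) - 1) * exp (- (1 * t)))"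
            by (simp add: mult_ac)
          then show ?thesis
            using True by (simp add: ennreal_mult'[symmetric])
        qed
        finally show ?thesis .
      next
        case False
        with elim show ?thesis by (simp add: indicator_def)
      qed
    qed
  qed
  also have "\<dots> = ennreal (pi powr ?k) * (\<integral>\<^sup>+t. ennreal (t powr ((a - ?k) - 1) * exp (- (1 * t))) * indicator {0..} t \<partial>lborel)"
    by (rule nn_integral_cmult) measurable
  also have "(\<integral>\<^sup>+t. ennreal (t powr ((a - ?k) - 1) * exp (- (1 * t))) * indicator {0..} t \<partial>lborel) = ennreal (Gamma (a - ?k))"
    using nn_integral_Gamma_scaled[OF a(2) zero_less_one] by (simp only: powr_one_eq_one mult_1_right)
  finally have "ennreal (Gamma a) * (\<integral>\<^sup>+y. ennreal ((1 + (norm (y :: real^'k))\<^sup>2) powr (- a)) \<partial>lborel)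
      = ennreal (pi powr ?k * Gamma (a - ?k))"
    by (simp add: ennreal_mult')
  then have "ennreal (1 / Gamma a) * (ennreal (Gamma a) * (\<integral>\<^sup>+y. ennreal ((1 + (norm (y :: real^'k))\<^sup>2) powr (- a)) \<partial>lborel))
      = ennreal (1 / Gamma a) * ennreal (pi powr ?k * Gamma (a - ?k))" by simp
  then show ?thesis
    using Ga by (simp add: ennreal_mult'[symmetric] flip: mult.assoc)
qed

lemma t_density_measurable [measurable]: "t_density \<mu> \<Sigma> \<nu> \<in> borel_measurable borel"
  unfolding t_density_def[abs_def] Let_def by measurable

lemma t_density_pos:
  assumes "pos_def \<Sigma>" "0 < \<nu>"
  shows "0 < t_density \<mu> \<Sigma> \<nu> (x :: real^'k)"
proof -
  have "0 < Gamma ((\<nu> + real CARD('k)) / 2)" "0 < Gamma (\<nu> / 2)"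
    using assms by (auto intro!: Gamma_real_pos)
  moreover have "0 < 1 + (norm (inv_sqrt \<Sigma> *v (x - \<mu>)))\<^sup>2 / \<nu>"
    using assms by (simp add: add_pos_nonneg)
  ultimately show ?thesis
    using assms pos_def_det_pos[OF assms(1)] by (simp add: t_density_def Let_def)
qed

text \<open>The substitution \<open>y = T (x - \<mu>)\<close>, with \<open>T\<close> the matrix
  \<open>inv_sqrt \<Sigma>\<close> divided by \<open>sqrt \<nu>\<close>, reduces the claim to
  \<open>nn_integral_radial\<close> at \<open>a = (\<nu> + k) / 2\<close>; then
  \<open>a - k / 2 = \<nu> / 2\<close> accounts for the second Gamma factor.\<close>

lemma prob_space_t_law:
  fixes \<mu> :: "real^'k::{finite,linorder}"
  assumes "pos_def \<Sigma>" "0 < \<nu>"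
  shows "prob_space (t_law \<mu> \<Sigma> \<nu>)"
proof
  let ?k = "real CARD('k)"
  define a where "a = (\<nu> + ?k) / 2"
  define B where "B = inv_sqrt \<Sigma>"
  define T where "T = (1 / sqrt \<nu>) *\<^sub>R B"
  have dB: "0 < det B" unfolding B_def by (rule pos_def_det_pos[OF inv_sqrt_pos_def(1)[OF assms(1)]])
  \<comment> \<open>Writing the scalar factor as a matrix lets \<open>det_mul\<close> split off its
    \<open>k\<close>-th power.\<close>
  have "T = matrix ((*\<^sub>R) (1 / sqrt \<nu>)) ** B"
  proof (rule matrix_eq[THEN iffD2], rule allI)
    fix x
    have "matrix ((*\<^sub>R) (1 / sqrt \<nu>)) *v (B *v x) = (1 / sqrt \<nu>) *\<^sub>R (B *v x)"
      by (rule fun_cong[OF matrix_vector_mul(2)]) (rule linear_scaleR)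
    then show "T *v x = (matrix ((*\<^sub>R) (1 / sqrt \<nu>)) ** B) *v x"
      unfolding T_def scaleR_matrix_vector_assoc[symmetric] matrix_vector_mul_assoc[symmetric] by (rule sym)
  qed
  then have dT: "det T = (1 / sqrt \<nu>) ^ CARD('k) * det B"
    by (simp add: det_mul)
  have sk: "(1 / sqrt \<nu>) ^ CARD('k) = \<nu> powr (- (?k / 2))"
  proof -
    have "1 / sqrt \<nu> = \<nu> powr (- (1 / 2))"
      unfolding powr_minus using assms(2) by (subst powr_half_sqrt) (auto simp: divide_inverse)
    moreover have "(\<nu> powr (- (1 / 2))) ^ CARD('k) = (\<nu> powr (- (1 / 2))) powr ?k"
      using assms(2) by (subst powr_realpow) auto
    ultimately show ?thesis by (simp add: powr_powr)
  qed
  have T: "(norm (T *v y))\<^sup>2 = (norm (B *v y))\<^sup>2 / \<nu>" for y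
    using assms(2) by (simp add: T_def scaleR_matrix_vector_assoc[symmetric] power_divide)
  define c where "c = Gamma a / ((pi * \<nu>) powr (?k / 2) * Gamma (\<nu> / 2))"
  have G: "0 < Gamma a" "0 < Gamma (\<nu> / 2)"
    using assms by (auto simp: a_def intro!: Gamma_real_pos)
  have c: "0 < c" using G assms by (simp add: c_def)
  let ?h = "\<lambda>y. ennreal ((1 + (norm y)\<^sup>2) powr (- a))"
  have dens: "ennreal (t_density \<mu> \<Sigma> \<nu> x) = ennreal (c * det B) * ?h (T *v (x - \<mu>))" for x
  proof -
    have "t_density \<mu> \<Sigma> \<nu> x = c * det B * (1 + (norm (T *v (x - \<mu>)))\<^sup>2) powr (- a)"
      unfolding t_density_def Let_def T c_def a_def unfolding B_def det_inv_sqrt[OF assms(1)]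
      by (simp only: minus_divide_left)
    then show ?thesis
      using c dB by (simp only: ennreal_mult' mult_nonneg_nonneg less_imp_le)
  qed
  have "emeasure (t_law \<mu> \<Sigma> \<nu>) UNIV = (\<integral>\<^sup>+x. ennreal (c * det B) * ?h (T *v (x - \<mu>)) \<partial>lborel)"
    unfolding t_law_def by (subst emeasure_density) (auto simp: dens)
  also have "\<dots> = ennreal (c * det B) * (\<integral>\<^sup>+x. ?h (T *v (x - \<mu>)) \<partial>lborel)"
    by (rule nn_integral_cmult) measurable
  also have "(\<integral>\<^sup>+x. ?h (T *v (x - \<mu>)) \<partial>lborel) = (\<integral>\<^sup>+x. ?h (T *v x) \<partial>lborel)"
  proof -
    have "(\<integral>\<^sup>+x. ?h (T *v (x - \<mu>)) \<partial>lborel) = (\<integral>\<^sup>+x. ?h (T *v (x - \<mu>)) \<partial>(distr lborel borel ((+) \<mu>)))"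
      by (simp add: lborel_distr_plus)
    also have "\<dots> = (\<integral>\<^sup>+x. ?h (T *v x) \<partial>lborel)"
      by (subst nn_integral_distr) auto
    finally show ?thesis .
  qed
  also have "ennreal (c * det B) * (\<integral>\<^sup>+x. ?h (T *v x) \<partial>lborel) = 1"
  proof -
    have dT0: "0 < det T" using dB assms(2) by (simp add: dT)
    have "(\<integral>\<^sup>+y. ?h (y :: (real, 'k) vec) \<partial>lborel) = ennreal \<bar>det T\<bar> * (\<integral>\<^sup>+x. ?h (T *v x) \<partial>lborel)"
      by (rule nn_integral_linear) (use dT0 in auto)
    moreover have "(\<integral>\<^sup>+y. ?h (y :: (real, 'k) vec) \<partial>lborel) = ennreal (pi powr (?k / 2) * Gamma (\<nu> / 2) / Gamma a)"
      using nn_integral_radial[where 'k='k, of a] assms(2) by (simp add: a_def add_divide_distrib)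
    ultimately have eq: "ennreal (det T) * (\<integral>\<^sup>+x. ?h (T *v x) \<partial>lborel) = ennreal (pi powr (?k / 2) * Gamma (\<nu> / 2) / Gamma a)"
      using dT0 by simp
    have cd: "c * det B = (Gamma a / (pi powr (?k / 2) * Gamma (\<nu> / 2))) * det T"
      unfolding c_def dT sk powr_minus using assms(2) by (simp add: powr_mult field_simps)
    have "ennreal (c * det B) * (\<integral>\<^sup>+x. ?h (T *v x) \<partial>lborel)
        = ennreal (Gamma a / (pi powr (?k / 2) * Gamma (\<nu> / 2))) * (ennreal (det T) * (\<integral>\<^sup>+x. ?h (T *v x) \<partial>lborel))"
      unfolding cd using G dT0 by (subst ennreal_mult) (auto simp: mult.assoc)
    also have "\<dots> = 1"
      unfolding eq using G by (simp add: ennreal_mult'[symmetric])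
    finally show ?thesis .
  qed
  finally show "emeasure (t_law \<mu> \<Sigma> \<nu>) (space (t_law \<mu> \<Sigma> \<nu>)) = 1"
    by (simp add: t_law_def)
qed

section \<open>Matrix inverse and determinant as functions of the matrix\<close>

lemma continuous_on_det [continuous_intros]:
  fixes f :: "'a::topological_space \<Rightarrow> real^'n^'n"
  assumes "continuous_on T f"
  shows "continuous_on T (\<lambda>t. det (f t))"
  unfolding det_def by (intro continuous_intros assms)

lemma continuous_on_matrix_vector_mult [continuous_intros]:
  fixes f :: "'a::topological_space \<Rightarrow> real^'n^'m"
  assumes "continuous_on T f" "continuous_on T g"
  shows "continuous_on T (\<lambda>t. f t *v g t)"
  unfolding matrix_vector_mult_def by (intro continuous_intros continuous_on_vec_lambda assms)

text \<open>Cramer's rule writes each component as a quotient of two determinants, hence of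
  polynomials in the entries.\<close>

lemma continuous_on_matrix_inv_mult:
  fixes f :: "'a::topological_space \<Rightarrow> real^'n^'n"
  assumes f: "continuous_on T f" and g: "continuous_on T g" and "\<And>t. t \<in> T \<Longrightarrow> det (f t) \<noteq> 0"
  shows "continuous_on T (\<lambda>t. matrix_inv (f t) *v g t)"
proof -
  have "matrix_inv (f t) *v g t = (\<chi> k. det (\<chi> i j. if j = k then g t $ i else f t $ i $ j) / det (f t))" if "t \<in> T" for t
  proof -
    have "invertible (f t)" using assms(3)[OF that] by (simp add: invertible_det_nz)
    then have "f t *v (matrix_inv (f t) *v g t) = g t" by (rule matrix_inv_mult_vec)
    then show ?thesis using cramer[OF assms(3)[OF that], of "matrix_inv (f t) *v g t" "g t"] by simp
  qed
  moreover have "continuous_on T (\<lambda>t. \<chi> k. det (\<chi> i j. if j = k then g t $ i else f t $ i $ j) / det (f t))"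
  proof (intro continuous_on_vec_lambda continuous_on_divide continuous_on_det)
    fix k i j
    show "continuous_on T (\<lambda>t. if j = k then g t $ i else f t $ i $ j)"
      by (cases "j = k") (auto intro!: continuous_intros f g)
  qed (use f assms(3) in auto)
  ultimately show ?thesis
    by (simp cong: continuous_on_cong)
qed

text \<open>Termwise derivative of the Leibniz expansion; in this form continuity in
  \<open>A\<close> can be read off.\<close>

definition det_deriv :: "real^'n^'n \<Rightarrow> real^'n^'n \<Rightarrow> real" where
  "det_deriv A H = (\<Sum>p\<in>{p. p permutes UNIV}. of_int (sign p) * (\<Sum>i\<in>UNIV. H $ i $ p i * (\<Prod>j\<in>UNIV - {i}. A $ j $ p j)))"

lemma has_derivative_det: "(det has_derivative det_deriv A) (at (A :: real^'n^'n))"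
proof -
  have 1: "((\<lambda>A :: real^'n^'n. A $ i $ j) has_derivative (\<lambda>H. H $ i $ j)) (at A)" for i j
    by (intro bounded_linear_imp_has_derivative bounded_linear_intros)
       (auto intro: bounded_linear_compose[OF bounded_linear_vec_nth bounded_linear_vec_nth])
  have "((\<lambda>A :: real^'n^'n. \<Prod>i\<in>UNIV. A $ i $ p i) has_derivative (\<lambda>H. \<Sum>i\<in>UNIV. H $ i $ p i * (\<Prod>j\<in>UNIV - {i}. A $ j $ p j))) (at A)" for p
    by (intro has_derivative_prod 1)
  then show ?thesis
    unfolding det_def[abs_def] det_deriv_def[abs_def]
    by (intro has_derivative_sum has_derivative_mult_right)
qed

lemma norm_matrix_vector_mult_le: "norm (A *v x) \<le> norm A * norm (x :: real^'n)" for A :: "real^'n^'m"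
proof -
  have "norm (A *v x) = L2_set (\<lambda>i. \<bar>(A $ i) \<bullet> x\<bar>) UNIV"
    by (simp add: norm_vec_def matrix_vector_mul_component)
  also have "\<dots> \<le> L2_set (\<lambda>i. norm (A $ i) * norm x) UNIV"
    by (intro L2_set_mono Cauchy_Schwarz_ineq2) auto
  also have "\<dots> = norm A * norm x"
    by (simp add: L2_set_left_distrib norm_vec_def[of A])
  finally show ?thesis .
qed

section \<open>The Student t log-density and its derivative\<close>

type_synonym 'k par = "(real, 'k) vec \<times> (real, 'k vech_index) vec \<times> real"

lemma unvech_nth: "unvech v $ i $ j = v $ Abs_vech_index (min i j, max i j)"
  by (simp add: unvech_def)

lemma unvech_sym: "transpose (unvech v) = unvech v"
  by (simp add: transpose_def vec_eq_iff unvech_nth min.commute max.commute)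

lemma bounded_linear_unvech: "bounded_linear (unvech :: _ \<Rightarrow> ('k::{finite,linorder}) rmat)"
  by (simp add: linear_conv_bounded_linear[symmetric]) (auto intro!: linearI simp: vec_eq_iff unvech_nth)

lemma unvech_add: "unvech (v + w) = unvech v + unvech w"
  and unvech_scaleR: "unvech (c *\<^sub>R v) = c *\<^sub>R unvech v"
  and unvech_diff: "unvech (v - w) = unvech v - unvech w"
  by (simp_all add: vec_eq_iff unvech_nth)

definition Sig :: "'k::{finite,linorder} par \<Rightarrow> 'k rmat" where "Sig \<theta> = unvech (fst (snd \<theta>))"

definition Par :: "'k::{finite,linorder} par set" where "Par = {\<theta>. pos_def (Sig \<theta>) \<and> 0 < snd (snd \<theta>)}"

definition dens :: "'k::{finite,linorder} par \<Rightarrow> 'k rvec \<Rightarrow> real"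
  where "dens \<theta> x = t_density (fst \<theta>) (Sig \<theta>) (snd (snd \<theta>)) x"

definition wvec :: "'k::{finite,linorder} par \<Rightarrow> 'k rvec \<Rightarrow> real \<Rightarrow> 'k rvec"
  where "wvec \<theta> z r = matrix_inv (Sig \<theta>) *v (z - r *\<^sub>R fst \<theta>)"

text \<open>\<open>quad \<theta> z r\<close> is the homogeneous form of \<open>\<nu> + (x - \<mu>)' \<Sigma>\<^sup>-\<^sup>1 (x - \<mu>)\<close> in \<open>(x, 1)\<close>. Scaling \<open>(x, 1)\<close>
  to the unit sphere reduces all bounds that are uniform in \<open>x\<close> to compactness.\<close>

definition quad :: "'k::{finite,linorder} par \<Rightarrow> 'k rvec \<Rightarrow> real \<Rightarrow> real"
  where "quad \<theta> z r = snd (snd \<theta>) * r\<^sup>2 + (z - r *\<^sub>R fst \<theta>) \<bullet> wvec \<theta> z r"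

lemma continuous_on_Sig [continuous_intros]: "continuous_on T f \<Longrightarrow> continuous_on T (\<lambda>t. Sig (f t))"
  unfolding Sig_def by (intro bounded_linear.continuous_on[OF bounded_linear_unvech] continuous_intros)

text \<open>Coercivity with constant \<open>c\<close> leaves a positive definite form after any
  symmetric perturbation of norm below \<open>c\<close>; \<open>K\<close> expresses this in the free
  coordinates.\<close>

lemma open_pos_def_unvech: "open {v :: (real, 'k::{finite,linorder} vech_index) vec. pos_def (unvech v)}"
proof (rule openI)
  fix v :: "(real, 'k vech_index) vec" assume "v \<in> {v. pos_def (unvech v)}"
  then obtain c where c: "0 < c" "\<And>x. c * (norm x)\<^sup>2 \<le> x \<bullet> (unvech v *v x)"
    using pos_def_coercive by blast
  obtain K where K: "0 < K" "\<And>v :: (real, 'k vech_index) vec. norm (unvech v) \<le> norm v * K"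
    using bounded_linear.pos_bounded[OF bounded_linear_unvech] by blast
  have "pos_def (unvech w)" if w: "w \<in> ball v (c / K)" for w
    unfolding pos_def_def
  proof (intro conjI allI impI)
    show "transpose (unvech w) = unvech w" by (rule unvech_sym)
    fix x :: "'k rvec" assume "x \<noteq> 0"
    have "norm (unvech (w - v)) \<le> norm (w - v) * K" by (rule K(2))
    also have "\<dots> < c" using w K(1) by (simp add: dist_norm norm_minus_commute field_simps)
    finally have lt: "norm (unvech (w - v)) < c" .
    have "\<bar>x \<bullet> (unvech (w - v) *v x)\<bar> \<le> norm x * (norm (unvech (w - v)) * norm x)"
      by (rule order_trans[OF Cauchy_Schwarz_ineq2]) (intro mult_left_mono norm_matrix_vector_mult_le norm_ge_zero)
    also have "\<dots> = norm (unvech (w - v)) * (norm x)\<^sup>2" by (simp add: power2_eq_square)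
    also have "\<dots> < c * (norm x)\<^sup>2" using lt \<open>x \<noteq> 0\<close> by (intro mult_strict_right_mono) auto
    also have "\<dots> \<le> x \<bullet> (unvech v *v x)" by (rule c(2))
    finally have "0 < x \<bullet> (unvech v *v x) + x \<bullet> (unvech (w - v) *v x)" by linarith
    also have "\<dots> = x \<bullet> (unvech w *v x)"
      by (simp add: unvech_diff matrix_vector_mult_diff_rdistrib inner_diff_right)
    finally show "0 < x \<bullet> (unvech w *v x)" .
  qed
  then show "\<exists>e>0. ball v e \<subseteq> {v. pos_def (unvech v)}"
    using c K by (intro exI[of _ "c / K"]) auto
qed

lemma open_Par: "open (Par :: 'k::{finite,linorder} par set)"
proof -
  have eq: "Par = {\<theta> :: 'k par. fst (snd \<theta>) \<in> {v. pos_def (unvech v)}} \<inter> {\<theta>. 0 < snd (snd \<theta>)}"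
    by (auto simp: Par_def Sig_def)
  have 1: "open {\<theta> :: 'k par. fst (snd \<theta>) \<in> {v. pos_def (unvech v)}}"
    using open_vimage[OF open_pos_def_unvech, of "\<lambda>\<theta> :: 'k par. fst (snd \<theta>)"] by (simp add: vimage_def continuous_intros)
  have 2: "open {\<theta> :: 'k par. 0 < snd (snd \<theta>)}"
    by (intro open_Collect_less continuous_intros)
  show ?thesis
    unfolding eq by (rule open_Int[OF 1 2])
qed

lemma Par_D: "\<theta> \<in> Par \<Longrightarrow> pos_def (Sig \<theta>)" "\<theta> \<in> Par \<Longrightarrow> 0 < snd (snd \<theta>)" "\<theta> \<in> Par \<Longrightarrow> 0 < det (Sig \<theta>)"
  by (auto simp: Par_def pos_def_det_pos)

lemma quad_pos:
  assumes "\<theta> \<in> Par" "z \<noteq> 0 \<or> r \<noteq> 0"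
  shows "0 < quad \<theta> z r"
proof -
  have nn: "0 \<le> y \<bullet> (matrix_inv (Sig \<theta>) *v y)" for y
    using pos_def_pos[OF pos_def_matrix_inv[OF Par_D(1)[OF assms(1)]], of y] by (cases "y = 0") auto
  show ?thesis
  proof (cases "r = 0")
    case True
    then show ?thesis
      using pos_def_pos[OF pos_def_matrix_inv[OF Par_D(1)[OF assms(1)]], of z] assms(2) by (simp add: quad_def wvec_def)
  next
    case False
    then show ?thesis
      using Par_D(2)[OF assms(1)] nn by (simp add: quad_def wvec_def add_pos_nonneg)
  qed
qed

lemma wvec_scale: "wvec \<theta> (c *\<^sub>R z) (c * r) = c *\<^sub>R wvec \<theta> z r"
  by (simp add: wvec_def matrix_vector_mult_scaleR flip: scaleR_scaleR scaleR_diff_right)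

lemma quad_scale: "quad \<theta> (c *\<^sub>R z) (c * r) = c\<^sup>2 * quad \<theta> z r"
  unfolding quad_def wvec_scale
  by (simp add: power_mult_distrib power2_eq_square algebra_simps flip: scaleR_scaleR scaleR_diff_right)

lemma continuous_on_wvec [continuous_intros]:
  assumes "continuous_on T f" "continuous_on T g" "continuous_on T h" "\<And>t. t \<in> T \<Longrightarrow> f t \<in> Par"
  shows "continuous_on T (\<lambda>t. wvec (f t) (g t) (h t))"
proof -
  have "det (Sig (f t)) \<noteq> 0" if "t \<in> T" for t
    using Par_D(3)[OF assms(4)[OF that]] by simp
  then show ?thesis
    unfolding wvec_def using assms(1-3)
    by (intro continuous_on_matrix_inv_mult continuous_intros)
qed

lemma continuous_on_quad [continuous_intros]:
  assumes "continuous_on T f" "continuous_on T g" "continuous_on T h" "\<And>t. t \<in> T \<Longrightarrow> f t \<in> Par"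
  shows "continuous_on T (\<lambda>t. quad (f t) (g t) (h t))"
  unfolding quad_def by (intro continuous_intros assms)

text \<open>All terms of the log-density that are free of \<open>x\<close>. The summand
  \<open>(s + k) / 2 * ln s\<close> arises because the base of the power in the density is rewritten
  as \<open>quad / s\<close>.\<close>

definition log_const :: "'k::{finite,linorder} par \<Rightarrow> real"
  where "log_const \<theta> = (let s = snd (snd \<theta>); k = real CARD('k) in
    ln_Gamma ((s + k) / 2) - (k / 2) * ln (pi * s) - ln_Gamma (s / 2) + (s + k) / 2 * ln s - ln (det (Sig \<theta>)) / 2)"

lemma ln_dens:
  fixes \<theta> :: "'k::{finite,linorder} par"
  assumes "\<theta> \<in> Par"
  shows "ln (dens \<theta> x) = log_const \<theta> - (snd (snd \<theta>) + real CARD('k)) / 2 * ln (quad \<theta> x 1)"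
proof -
  let ?s = "snd (snd \<theta>)" and ?k = "real CARD('k)"
  have s: "0 < ?s" using Par_D(2)[OF assms] .
  have d: "0 < det (Sig \<theta>)" using Par_D(3)[OF assms] .
  have G: "0 < Gamma ((?s + ?k) / 2)" "0 < Gamma (?s / 2)"
    using s by (auto intro!: Gamma_real_pos)
  have lG: "ln (Gamma ((?s + ?k) / 2)) = ln_Gamma ((?s + ?k) / 2)" "ln (Gamma (?s / 2)) = ln_Gamma (?s / 2)"
    using s by (simp_all add: Gamma_real_pos_exp add_pos_nonneg)
  define n where "n = (norm (inv_sqrt (Sig \<theta>) *v (x - fst \<theta>)))\<^sup>2"
  have n: "n = (x - fst \<theta>) \<bullet> (matrix_inv (Sig \<theta>) *v (x - fst \<theta>))"
    unfolding n_def by (rule norm_inv_sqrt[OF Par_D(1)[OF assms]])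
  have n0: "0 \<le> n" by (simp add: n_def)
  have q: "quad \<theta> x 1 = ?s + n"
    by (simp add: quad_def wvec_def n)
  have "1 + n / ?s = quad \<theta> x 1 / ?s"
    using s by (simp add: q field_simps)
  then have l1: "ln (1 + n / ?s) = ln (quad \<theta> x 1) - ln ?s"
    using s n0 by (simp add: q ln_div)
  have p1: "0 < 1 + n / ?s" using s n0 by (simp add: add_pos_nonneg)
  have "dens \<theta> x = (Gamma ((?s + ?k) / 2) / ((pi * ?s) powr (?k / 2) * Gamma (?s / 2)))
      * det (Sig \<theta>) powr (- 1 / 2) * (1 + n / ?s) powr (- (?s + ?k) / 2)"
    unfolding dens_def t_density_def Let_def n_def ..
  also have "ln \<dots> = ln (Gamma ((?s + ?k) / 2)) - ((?k / 2) * ln (pi * ?s) + ln (Gamma (?s / 2)))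
      + (- 1 / 2) * ln (det (Sig \<theta>)) + (- (?s + ?k) / 2) * ln (1 + n / ?s)"
  proof -
    have l: "ln (a / (b * c) * d * e) = ln a - (ln b + ln c) + ln d + ln e"
      if "0 < a" "0 < b" "0 < c" "0 < d" "0 < e" for a b c d e :: real
      using that by (simp add: ln_mult_pos ln_divide_pos)
    have "0 < (pi * ?s) powr (?k / 2)" "0 < det (Sig \<theta>) powr (- 1 / 2)" "0 < (1 + n / ?s) powr (- (?s + ?k) / 2)"
      using s d p1 by (simp_all only: powr_gt_zero) auto
    from l[OF G(1) this(1) G(2) this(2,3)] show ?thesis
      by (simp only: ln_powr)
  qed
  finally show ?thesis
    unfolding lG l1 log_const_def Let_def by (simp add: field_simps)
qed

definition dlog_const :: "'k::{finite,linorder} par \<Rightarrow> 'k par \<Rightarrow> real"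
  where "dlog_const \<theta> h = (let s = snd (snd \<theta>); k = real CARD('k); h3 = snd (snd h) in
    h3 * (Digamma ((s + k) / 2) / 2 - k / (2 * s) - Digamma (s / 2) / 2 + ln s / 2 + (s + k) / (2 * s))
    - det_deriv (Sig \<theta>) (Sig h) / (2 * det (Sig \<theta>)))"

lemma log_const_deriv:
  fixes \<theta> :: "'k::{finite,linorder} par"
  assumes "\<theta> \<in> Par"
  shows "(log_const has_derivative dlog_const \<theta>) (at \<theta>)"
proof -
  let ?s = "snd (snd \<theta>)" and ?k = "real CARD('k)"
  have s: "0 < ?s" using Par_D(2)[OF assms] .
  have d: "0 < det (Sig \<theta>)" using Par_D(3)[OF assms] .
  define c where "c s = ln_Gamma ((s + ?k) / 2) - (?k / 2) * ln (pi * s) - ln_Gamma (s / 2) + (s + ?k) / 2 * ln s" for s :: real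
  have c': "(c has_field_derivative (Digamma ((?s + ?k) / 2) / 2 - ?k / (2 * ?s) - Digamma (?s / 2) / 2 + ln ?s / 2 + (?s + ?k) / (2 * ?s))) (at ?s)"
    unfolding c_def using s
    by (auto intro!: derivative_eq_intros simp: add_pos_nonneg field_simps)
  have ds: "((\<lambda>\<theta> :: 'k par. snd (snd \<theta>)) has_derivative (\<lambda>h. snd (snd h))) (at \<theta>)"
    by (auto intro!: derivative_eq_intros)
  have dS: "(Sig has_derivative Sig) (at \<theta>)"
    unfolding Sig_def[abs_def]
    by (intro bounded_linear.has_derivative[OF bounded_linear_unvech]) (auto intro!: derivative_eq_intros)
  have "((\<lambda>\<theta>. ln (det (Sig \<theta>))) has_derivative (\<lambda>h. det_deriv (Sig \<theta>) (Sig h) / det (Sig \<theta>))) (at \<theta>)"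
    using has_derivative_ln[OF d has_derivative_compose[OF dS has_derivative_det]]
    by (rule has_derivative_eq_rhs) (simp only: divide_inverse)
  moreover have "((\<lambda>\<theta>. c (snd (snd \<theta>))) has_derivative (\<lambda>h. (Digamma ((?s + ?k) / 2) / 2 - ?k / (2 * ?s) - Digamma (?s / 2) / 2 + ln ?s / 2 + (?s + ?k) / (2 * ?s)) * snd (snd h))) (at \<theta>)"
    by (rule has_derivative_compose[OF ds c'[unfolded has_field_derivative_def]])
  ultimately have "((\<lambda>\<theta>. c (snd (snd \<theta>)) - ln (det (Sig \<theta>)) / 2) has_derivative
      (\<lambda>h. (Digamma ((?s + ?k) / 2) / 2 - ?k / (2 * ?s) - Digamma (?s / 2) / 2 + ln ?s / 2 + (?s + ?k) / (2 * ?s)) * snd (snd h)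
        - det_deriv (Sig \<theta>) (Sig h) / det (Sig \<theta>) / 2)) (at \<theta>)"
    by (intro has_derivative_diff bounded_linear.has_derivative[OF bounded_linear_divide])
  then show ?thesis
    unfolding log_const_def[abs_def] dlog_const_def[abs_def] Let_def c_def by (simp add: mult.commute)
qed

text \<open>With \<open>w = \<Sigma>\<^sup>-\<^sup>1 y\<close> and \<open>w' = \<Sigma>'\<^sup>-\<^sup>1 y'\<close>, symmetry gives the exact identity
  \<open>y'\<bullet>w' - y\<bullet>w = (y' - y)\<bullet>w' + (y' - y)\<bullet>w - w\<bullet>(\<Sigma>' - \<Sigma>)w'\<close>.\<close>

lemma quad_deriv:
  fixes \<theta> :: "'k::{finite,linorder} par" and x :: "'k rvec"
  assumes \<theta>: "\<theta> \<in> Par"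
  defines "w \<equiv> wvec \<theta> x 1"
  shows "((\<lambda>\<theta>. quad \<theta> x 1) has_derivative (\<lambda>h. snd (snd h) - 2 * (w \<bullet> fst h) - w \<bullet> (Sig h *v w))) (at \<theta>)"
  (is "(?f has_derivative ?D) _")
  unfolding has_derivative_within_alt
proof (intro conjI allI impI)
  obtain K where K: "0 < K" "\<And>v :: (real, 'k vech_index) vec. norm (unvech v) \<le> norm v * K"
    using bounded_linear.pos_bounded[OF bounded_linear_unvech] by blast
  have SigK: "norm (Sig h) \<le> K * norm h" for h :: "'k par"
  proof -
    have "norm (Sig h) \<le> norm (fst (snd h)) * K" unfolding Sig_def by (rule K(2))
    also have "\<dots> \<le> norm h * K"
      using K(1) norm_fst_le[of "fst (snd h)" "snd (snd h)"] norm_snd_le[of "snd h" "fst h"]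
      by (intro mult_right_mono) auto
    finally show ?thesis by (simp add: mult.commute)
  qed
  have "linear ?D"
    by (rule linearI) (simp_all add: Sig_def unvech_add unvech_scaleR inner_add_right matrix_vector_mult_add_rdistrib scaleR_matrix_vector_assoc[symmetric] algebra_simps)
  then show "bounded_linear ?D" by (simp add: linear_conv_bounded_linear)
  fix e :: real assume e: "0 < e"
  \<comment> \<open>The remainder below is at most
    \<open>(1 + norm w * K) * norm (w' - w) * norm h\<close>; this is the size of
    \<open>w' - w\<close> that it tolerates.\<close>
  define e' where "e' = e / (1 + norm w * K)"
  have den: "0 < 1 + norm w * K" using K by (simp add: add_pos_nonneg)
  have e': "0 < e'" using e den by (simp add: e'_def)
  have "continuous_on Par (\<lambda>\<theta>'. wvec \<theta>' x 1)"
    by (intro continuous_intros) auto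
  then have "isCont (\<lambda>\<theta>'. wvec \<theta>' x 1) \<theta>"
    by (rule continuous_on_interior) (simp add: interior_open[OF open_Par] \<theta>)
  then obtain d1 where d1: "0 < d1" "\<And>\<theta>'. dist \<theta>' \<theta> < d1 \<Longrightarrow> dist (wvec \<theta>' x 1) w < e'"
    using e' unfolding continuous_at_eps_delta w_def by blast
  obtain d2 where d2: "0 < d2" "ball \<theta> d2 \<subseteq> Par"
    using open_Par \<theta> open_contains_ball by blast
  show "\<exists>d>0. \<forall>y\<in>UNIV. norm (y - \<theta>) < d \<longrightarrow> norm (?f y - ?f \<theta> - ?D (y - \<theta>)) \<le> e * norm (y - \<theta>)"
  proof (intro exI[of _ "min d1 d2"] conjI ballI impI)
    show "0 < min d1 d2" using d1 d2 by simp
    fix \<theta>' assume "norm (\<theta>' - \<theta>) < min d1 d2"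
    then have "dist \<theta>' \<theta> < d1" "\<theta>' \<in> ball \<theta> d2" by (auto simp: dist_norm norm_minus_commute)
    then have d: "dist \<theta>' \<theta> < d1" "\<theta>' \<in> Par" using d2(2) by blast+
    define w' where "w' = wvec \<theta>' x 1"
    define y where "y = x - fst \<theta>"
    define y' where "y' = x - fst \<theta>'"
    define h where "h = \<theta>' - \<theta>"
    have y: "Sig \<theta> *v w = y" "Sig \<theta>' *v w' = y'"
      unfolding w_def w'_def y_def y'_def wvec_def
      using matrix_inv_mult_vec(1)[OF pos_def_invertible[OF Par_D(1)[OF \<theta>]]]
        matrix_inv_mult_vec(1)[OF pos_def_invertible[OF Par_D(1)[OF d(2)]]] by simp_all
    have yh: "y' - y = - fst h" by (simp add: y_def y'_def h_def)
    have Sh: "Sig \<theta>' = Sig \<theta> + Sig h" by (simp add: Sig_def h_def unvech_diff)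
    have "w \<bullet> (Sig \<theta> *v w') = y \<bullet> w'"
      using sym_dot[OF pos_def_sym[OF Par_D(1)[OF \<theta>]], of w w'] y by simp
    moreover have "w \<bullet> (Sig \<theta>' *v w') = w \<bullet> y'" using y by simp
    ultimately have sh: "w \<bullet> (Sig h *v w') = w \<bullet> y' - y \<bullet> w'"
      unfolding Sh matrix_vector_mult_add_rdistrib inner_add_right by simp
    have "?f \<theta>' - ?f \<theta> = snd (snd h) + (y' \<bullet> w' - y \<bullet> w)"
      by (simp add: quad_def w_def w'_def y_def y'_def h_def)
    also have "y' \<bullet> w' - y \<bullet> w = (y' - y) \<bullet> w' + (y' - y) \<bullet> w - w \<bullet> (Sig h *v w')"
      unfolding sh by (simp add: inner_diff_left inner_diff_right inner_commute)
    \<comment> \<open>Each remaining term contains both \<open>h\<close> and \<open>w' - w\<close>,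
      so continuity of \<open>wvec\<close> suffices and the matrix inverse is never
      differentiated.\<close>
    finally have "?f \<theta>' - ?f \<theta> - ?D h = - (fst h \<bullet> (w' - w)) - w \<bullet> (Sig h *v (w' - w))"
      unfolding yh by (simp add: inner_diff_right matrix_vector_mult_diff_distrib inner_commute)
    then have "norm (?f \<theta>' - ?f \<theta> - ?D h) \<le> \<bar>fst h \<bullet> (w' - w)\<bar> + \<bar>w \<bullet> (Sig h *v (w' - w))\<bar>"
      by simp
    also have "\<dots> \<le> norm h * norm (w' - w) + norm w * (K * norm h * norm (w' - w))"
    proof (rule add_mono)
      show "\<bar>fst h \<bullet> (w' - w)\<bar> \<le> norm h * norm (w' - w)"
        using norm_fst_le[of "fst h" "snd h"]
        by (intro order_trans[OF Cauchy_Schwarz_ineq2] mult_right_mono) auto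
      show "\<bar>w \<bullet> (Sig h *v (w' - w))\<bar> \<le> norm w * (K * norm h * norm (w' - w))"
        by (intro order_trans[OF Cauchy_Schwarz_ineq2] mult_left_mono order_trans[OF norm_matrix_vector_mult_le] mult_right_mono SigK) auto
    qed
    also have "\<dots> = (1 + norm w * K) * norm (w' - w) * norm h" by (simp add: algebra_simps)
    also have "\<dots> \<le> (1 + norm w * K) * e' * norm h"
      using d1(2)[OF d(1)] den by (intro mult_right_mono mult_left_mono) (auto simp: w'_def dist_norm)
    also have "\<dots> = e * norm h" using den by (simp add: e'_def)
    finally show "norm (?f \<theta>' - ?f \<theta> - ?D (\<theta>' - \<theta>)) \<le> e * norm (\<theta>' - \<theta>)"
      by (simp add: h_def)
  qed
qed

definition dlog :: "'k::{finite,linorder} par \<Rightarrow> 'k rvec \<Rightarrow> 'k par \<Rightarrow> real"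
  where "dlog \<theta> x h = dlog_const \<theta> h - snd (snd h) / 2 * ln (quad \<theta> x 1)
    - (snd (snd \<theta>) + real CARD('k)) / 2 *
      ((snd (snd h) - 2 * (wvec \<theta> x 1 \<bullet> fst h) - wvec \<theta> x 1 \<bullet> (Sig h *v wvec \<theta> x 1)) / quad \<theta> x 1)"

lemma ln_dens_deriv:
  fixes \<theta> :: "'k::{finite,linorder} par"
  assumes \<theta>: "\<theta> \<in> Par"
  shows "((\<lambda>\<theta>. ln (dens \<theta> x)) has_derivative dlog \<theta> x) (at \<theta>)"
proof -
  let ?D = "\<lambda>h. snd (snd h) - 2 * (wvec \<theta> x 1 \<bullet> fst h) - wvec \<theta> x 1 \<bullet> (Sig h *v wvec \<theta> x 1)"
  have q: "0 < quad \<theta> x 1" by (rule quad_pos[OF \<theta>]) simp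
  have dln: "((\<lambda>\<theta>. ln (quad \<theta> x 1)) has_derivative (\<lambda>h. ?D h / quad \<theta> x 1)) (at \<theta>)"
    using has_derivative_ln[OF q quad_deriv[OF \<theta>]] by (rule has_derivative_eq_rhs) (simp only: divide_inverse)
  have ds: "((\<lambda>\<theta> :: 'k par. (snd (snd \<theta>) + real CARD('k)) / 2) has_derivative (\<lambda>h. (snd (snd h) + 0) / 2)) (at \<theta>)"
    by (intro bounded_linear.has_derivative[OF bounded_linear_divide] has_derivative_add has_derivative_snd
        has_derivative_const has_derivative_ident)
  have "((\<lambda>\<theta>. log_const \<theta> - (snd (snd \<theta>) + real CARD('k)) / 2 * ln (quad \<theta> x 1)) has_derivative dlog \<theta> x) (at \<theta>)"
    using has_derivative_diff[OF log_const_deriv[OF \<theta>] has_derivative_mult[OF ds dln]]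
    by (rule has_derivative_eq_rhs) (simp add: dlog_def[abs_def] algebra_simps)
  then show ?thesis
    by (rule has_derivative_transform_within_open[OF _ open_Par \<theta>]) (simp add: ln_dens)
qed

lemma continuous_on_dlog_const [continuous_intros]:
  assumes "continuous_on T f" "\<And>t. t \<in> T \<Longrightarrow> f t \<in> Par"
  shows "continuous_on T (\<lambda>t. dlog_const (f t) h)"
proof -
  have pos: "0 < snd (snd (f t))" "snd (snd (f t)) \<noteq> 0" "det (Sig (f t)) \<noteq> 0" if "t \<in> T" for t
    using Par_D(2,3)[OF assms(2)[OF that]] by auto
  have Dig: "continuous_on T (\<lambda>t. Digamma (g t))" if "continuous_on T g" "\<And>t. t \<in> T \<Longrightarrow> 0 < g t" for g :: "_ \<Rightarrow> real"
  proof (rule continuous_on_compose2[OF continuous_on_Polygamma that(1)])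
    show "{0<..} \<inter> \<int>\<^sub>\<le>\<^sub>0 = ({} :: real set)" by (auto elim!: nonpos_Ints_cases)
  qed (use that in auto)
  show ?thesis
    unfolding dlog_const_def Let_def det_deriv_def
    by (intro continuous_intros assms Dig) (auto simp: pos add_pos_nonneg)
qed

lemma continuous_on_log_const [continuous_intros]:
  assumes "continuous_on T f" "\<And>t. t \<in> T \<Longrightarrow> f t \<in> Par"
  shows "continuous_on T (\<lambda>t. log_const (f t))"
proof -
  have "continuous_on Par log_const"
    using log_const_deriv has_derivative_continuous continuous_at_imp_continuous_on by blast
  then show ?thesis
    using assms(1) by (rule continuous_on_compose2) (use assms(2) in blast)
qed

lemma continuous_on_dlog [continuous_intros]:
  assumes "continuous_on T f" "continuous_on T g" "\<And>t. t \<in> T \<Longrightarrow> f t \<in> Par"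
  shows "continuous_on T (\<lambda>t. dlog (f t) (g t) h)"
proof -
  have "quad (f t) (g t) 1 \<noteq> 0" if "t \<in> T" for t
    using quad_pos[OF assms(3)[OF that], of "g t" 1] by simp
  then show ?thesis
    unfolding dlog_def
    by (intro continuous_intros assms) auto
qed

section \<open>Uniform bounds and the model as a smooth model\<close>

definition rho :: "'k::finite rvec \<Rightarrow> real" where "rho x = sqrt (1 + (norm x)\<^sup>2)"

lemma rho_ge_1: "1 \<le> rho x" and rho_pos: "0 < rho x" and rho_sq: "(rho x)\<^sup>2 = 1 + (norm x)\<^sup>2"
  by (simp_all add: rho_def add_pos_nonneg)

lemma rho_measurable [measurable]: "rho \<in> borel_measurable borel"
  unfolding rho_def[abs_def] by measurable

definition dir :: "'k::finite rvec \<Rightarrow> 'k rvec \<times> real" where "dir x = ((1 / rho x) *\<^sub>R x, 1 / rho x)"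

lemma dir_sphere: "dir x \<in> sphere 0 1"
proof -
  have "(norm (dir x))\<^sup>2 = (norm x / rho x)\<^sup>2 + (1 / rho x)\<^sup>2"
    using rho_pos[of x] by (simp add: dir_def norm_Pair)
  also have "\<dots> = ((norm x)\<^sup>2 + 1) / (rho x)\<^sup>2"
    by (simp add: power_divide add_divide_distrib)
  also have "(norm x)\<^sup>2 + 1 = (rho x)\<^sup>2"
    by (simp add: rho_sq)
  finally have "(norm (dir x))\<^sup>2 = 1\<^sup>2"
    using rho_pos[of x] by simp
  then have "norm (dir x) = 1"
    by (rule power2_eq_imp_eq) simp_all
  then show ?thesis by simp
qed

lemma quad_dir: "quad \<theta> x 1 = (rho x)\<^sup>2 * quad \<theta> (fst (dir x)) (snd (dir x))"
  using quad_scale[of \<theta> "rho x" "fst (dir x)" "snd (dir x)"] rho_pos[of x] by (simp add: dir_def)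

lemma wvec_dir: "wvec \<theta> x 1 = rho x *\<^sub>R wvec \<theta> (fst (dir x)) (snd (dir x))"
  using wvec_scale[of \<theta> "rho x" "fst (dir x)" "snd (dir x)"] rho_pos[of x] by (simp add: dir_def)

text \<open>The numerator and \<open>quad\<close> are both homogeneous of degree 2, so on the sphere
  the powers of \<open>rho x\<close> cancel in the quotient. Only the logarithm leaves a separate
  term, which appears in the lemma of the same name.\<close>

definition dlog_dir :: "'k::{finite,linorder} par \<Rightarrow> 'k rvec \<times> real \<Rightarrow> 'k par \<Rightarrow> real"
  where "dlog_dir \<theta> u h = dlog_const \<theta> h - snd (snd h) / 2 * ln (quad \<theta> (fst u) (snd u))
    - (snd (snd \<theta>) + real CARD('k)) / 2 *
      ((snd (snd h) * (snd u)\<^sup>2 - 2 * snd u * (wvec \<theta> (fst u) (snd u) \<bullet> fst h)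
        - wvec \<theta> (fst u) (snd u) \<bullet> (Sig h *v wvec \<theta> (fst u) (snd u))) / quad \<theta> (fst u) (snd u))"

definition log_dir :: "'k::{finite,linorder} par \<Rightarrow> 'k rvec \<times> real \<Rightarrow> real"
  where "log_dir \<theta> u = log_const \<theta> - (snd (snd \<theta>) + real CARD('k)) / 2 * ln (quad \<theta> (fst u) (snd u))"

lemma sphere_nonzero: "u \<in> sphere 0 1 \<Longrightarrow> fst u \<noteq> 0 \<or> snd u \<noteq> 0" for u :: "'k::finite rvec \<times> real"
  by (cases u) (auto simp: norm_Pair)

lemma quad_dir_pos: "\<theta> \<in> Par \<Longrightarrow> 0 < quad \<theta> (fst (dir x)) (snd (dir x))"
  by (rule quad_pos[OF _ sphere_nonzero[OF dir_sphere]])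

lemma ln_quad_dir: "\<theta> \<in> Par \<Longrightarrow> ln (quad \<theta> x 1) = 2 * ln (rho x) + ln (quad \<theta> (fst (dir x)) (snd (dir x)))"
  unfolding quad_dir[of \<theta> x] using quad_dir_pos[of \<theta> x] rho_pos[of x] by (simp add: ln_mult_pos ln_realpow)

lemma ln_dens_dir:
  fixes \<theta> :: "'k::{finite,linorder} par"
  shows "\<theta> \<in> Par \<Longrightarrow> ln (dens \<theta> x) = log_dir \<theta> (dir x) - (snd (snd \<theta>) + real CARD('k)) * ln (rho x)"
  by (simp add: ln_dens ln_quad_dir log_dir_def algebra_simps)

lemma dlog_dir: "\<theta> \<in> Par \<Longrightarrow> dlog \<theta> x h = dlog_dir \<theta> (dir x) h - snd (snd h) * ln (rho x)"
proof -
  assume \<theta>: "\<theta> \<in> Par"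
  define W where "W = wvec \<theta> (fst (dir x)) (snd (dir x))"
  define Q where "Q = quad \<theta> (fst (dir x)) (snd (dir x))"
  have Q: "0 < Q" unfolding Q_def by (rule quad_dir_pos[OF \<theta>])
  have \<rho>: "0 < rho x" by (rule rho_pos)
  have "(snd (snd h) - 2 * (wvec \<theta> x 1 \<bullet> fst h) - wvec \<theta> x 1 \<bullet> (Sig h *v wvec \<theta> x 1)) / quad \<theta> x 1
      = (snd (snd h) * (1 / rho x)\<^sup>2 - 2 * (1 / rho x) * (W \<bullet> fst h) - W \<bullet> (Sig h *v W)) / Q"
    unfolding quad_dir[of \<theta> x] wvec_dir[of \<theta> x] W_def[symmetric] Q_def[symmetric]
    using Q \<rho> by (simp add: matrix_vector_mult_scaleR field_simps power2_eq_square)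
  moreover have "snd (dir x) = 1 / rho x" by (simp add: dir_def)
  ultimately show ?thesis
    unfolding dlog_def dlog_dir_def ln_quad_dir[OF \<theta>] W_def[symmetric] Q_def[symmetric]
    by (simp add: algebra_simps)
qed

lemma compact_bound:
  fixes f :: "'k::{finite,linorder} par \<Rightarrow> 'k rvec \<times> real \<Rightarrow> real"
  assumes "cball \<theta> \<epsilon> \<subseteq> Par" "continuous_on (cball \<theta> \<epsilon> \<times> sphere 0 1) (\<lambda>(\<theta>', u). f \<theta>' u)"
  shows "\<exists>K\<ge>0. \<forall>\<theta>'\<in>cball \<theta> \<epsilon>. \<forall>u\<in>sphere 0 1. \<bar>f \<theta>' u\<bar> \<le> K"
proof -
  have "bounded ((\<lambda>(\<theta>', u). f \<theta>' u) ` (cball \<theta> \<epsilon> \<times> sphere 0 1))"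
    by (intro compact_imp_bounded compact_continuous_image assms(2) compact_Times compact_cball compact_sphere)
  then obtain K where "\<forall>\<theta>'\<in>cball \<theta> \<epsilon>. \<forall>u\<in>sphere 0 1. \<bar>f \<theta>' u\<bar> \<le> K"
    unfolding bounded_iff by force
  then show ?thesis
    by (intro exI[of _ "max K 0"]) (force simp: le_max_iff_disj)
qed

lemma dir_bounds:
  fixes \<theta> :: "'k::{finite,linorder} par"
  assumes "cball \<theta> \<epsilon> \<subseteq> Par"
  shows "\<exists>K\<ge>0. \<forall>\<theta>'\<in>cball \<theta> \<epsilon>. \<forall>u\<in>sphere 0 1. \<bar>log_dir \<theta>' u\<bar> \<le> K"
    and "\<exists>K\<ge>0. \<forall>\<theta>'\<in>cball \<theta> \<epsilon>. \<forall>u\<in>sphere 0 1. \<bar>dlog_dir \<theta>' u h\<bar> \<le> K"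
proof -
  let ?S = "cball \<theta> \<epsilon> \<times> sphere (0 :: 'k rvec \<times> real) 1"
  have P: "fst v \<in> Par" if "v \<in> ?S" for v using that assms by (auto simp: mem_Times_iff)
  have q: "quad (fst v) (fst (snd v)) (snd (snd v)) \<noteq> 0" if "v \<in> ?S" for v
  proof -
    have "snd v \<in> sphere 0 1" using that by (simp add: mem_Times_iff)
    from quad_pos[OF P[OF that] sphere_nonzero[OF this]] show ?thesis by simp
  qed
  have q': "quad \<theta>' z r \<noteq> 0" if "dist \<theta> \<theta>' \<le> \<epsilon>" "norm (z, r) = 1" for \<theta>' z r
    using q[of "(\<theta>', z, r)"] that by simp
  show "\<exists>K\<ge>0. \<forall>\<theta>'\<in>cball \<theta> \<epsilon>. \<forall>u\<in>sphere 0 1. \<bar>log_dir \<theta>' u\<bar> \<le> K"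
    unfolding log_dir_def
    by (rule compact_bound[OF assms], unfold case_prod_beta, intro continuous_intros P) (auto simp: q')
  show "\<exists>K\<ge>0. \<forall>\<theta>'\<in>cball \<theta> \<epsilon>. \<forall>u\<in>sphere 0 1. \<bar>dlog_dir \<theta>' u h\<bar> \<le> K"
    unfolding dlog_dir_def
    by (rule compact_bound[OF assms], unfold case_prod_beta, intro continuous_intros P) (auto simp: q')
qed

text \<open>Assembled over \<open>Basis\<close>, so that continuity in the parameter and in
  \<open>x\<close> follows from that of \<open>dlog\<close> in each fixed direction.\<close>

definition scoreS :: "'k::{finite,linorder} par \<Rightarrow> 'k rvec \<Rightarrow> 'k par"
  where "scoreS \<theta> x = (\<Sum>b\<in>Basis. dlog \<theta> x b *\<^sub>R b)"

lemma scoreS_inner: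
  fixes \<theta> :: "'k::{finite,linorder} par"
  assumes "\<theta> \<in> Par"
  shows "scoreS \<theta> x \<bullet> h = dlog \<theta> x h"
proof -
  have lin: "linear (dlog \<theta> x)"
    by (rule has_derivative_linear[OF ln_dens_deriv[OF assms]])
  have "dlog \<theta> x h = dlog \<theta> x (\<Sum>b\<in>Basis. (h \<bullet> b) *\<^sub>R b)"
    by (simp add: euclidean_representation)
  also have "\<dots> = (\<Sum>b\<in>Basis. (h \<bullet> b) * dlog \<theta> x b)"
    by (simp add: linear_sum[OF lin] linear_scale[OF lin])
  also have "\<dots> = (\<Sum>b\<in>Basis. dlog \<theta> x b * (b \<bullet> h))"
    by (intro sum.cong) (simp_all add: inner_commute)
  finally show ?thesis
    by (simp add: scoreS_def inner_sum_left)
qed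

lemma dens_pos: "\<theta> \<in> Par \<Longrightarrow> 0 < dens \<theta> x"
  unfolding dens_def by (rule t_density_pos) (auto simp: Par_def)

lemma dens_measurable [measurable]: "dens \<theta> \<in> borel_measurable borel"
proof -
  have "dens \<theta> = t_density (fst \<theta>) (Sig \<theta>) (snd (snd \<theta>))"
    by (simp add: dens_def fun_eq_iff)
  then show ?thesis by (simp only: t_density_measurable)
qed

lemma integrable_radial:
  fixes a :: real
  assumes "real CARD('k) / 2 < a"
  shows "integrable lborel (\<lambda>x :: (real, 'k::finite) vec. (1 + (norm x)\<^sup>2) powr (- a))"
  by (rule integrableI_nonneg) (auto simp: nn_integral_radial[OF assms] less_top[symmetric])

text \<open>\<open>D\<close> is a constant times a small power of \<open>rho\<close>. The
  directional parts are bounded by compactness, \<open>ln (rho x)\<close> is at most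
  \<open>rho x powr \<epsilon> / \<epsilon>\<close>, and the ratio of densities grows at most like
  \<open>rho\<close> to the power of the decrease in \<open>\<nu>\<close>, which is below
  \<open>\<epsilon>\<close> on the ball.\<close>

lemma dens_dominated:
  fixes \<theta> :: "'k::{finite,linorder} par"
  assumes \<theta>: "\<theta> \<in> Par"
  shows "\<exists>\<epsilon>>0. \<exists>D. D \<in> borel_measurable lborel \<and> ball \<theta> \<epsilon> \<subseteq> Par \<and>
        integrable (density lborel (\<lambda>x. ennreal (dens \<theta> x))) (\<lambda>x. (D x)^4) \<and>
        (\<forall>x. 1 \<le> D x) \<and> (\<forall>\<theta>'\<in>ball \<theta> \<epsilon>. \<forall>x. norm (scoreS \<theta>' x) \<le> D x \<and> dens \<theta>' x \<le> D x * dens \<theta> x)"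
proof -
  let ?s = "snd (snd \<theta>)" and ?k = "real CARD('k)"
  have s: "0 < ?s" by (rule Par_D(2)[OF \<theta>])
  obtain \<epsilon>1 where \<epsilon>1: "0 < \<epsilon>1" "cball \<theta> \<epsilon>1 \<subseteq> Par"
    using open_Par \<theta> open_contains_cball by blast
  \<comment> \<open>\<open>D^4\<close> costs \<open>4 * \<epsilon> \<le> \<nu> / 2\<close> in the
    exponent, so that a tail of order \<open>rho\<close> to the power
    \<open>- (\<nu> + k) + 4 * \<epsilon>\<close> stays integrable in dimension
    \<open>k\<close>.\<close>
  define \<epsilon> where "\<epsilon> = min \<epsilon>1 (?s / 8)"
  have \<epsilon>: "0 < \<epsilon>" "\<epsilon> \<le> ?s / 8" using \<epsilon>1 s by (auto simp: \<epsilon>_def)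
  have cb: "cball \<theta> \<epsilon> \<subseteq> Par"
    by (rule order_trans[OF _ \<epsilon>1(2)]) (auto simp: \<epsilon>_def)
  obtain K1 where K1: "0 \<le> K1" "\<And>\<theta>' u. \<theta>' \<in> cball \<theta> \<epsilon> \<Longrightarrow> u \<in> sphere 0 1 \<Longrightarrow> \<bar>log_dir \<theta>' u\<bar> \<le> K1"
    using dir_bounds(1)[OF cb] by blast
  have "\<forall>h\<in>(Basis :: 'k par set). \<exists>K\<ge>0. \<forall>\<theta>'\<in>cball \<theta> \<epsilon>. \<forall>u\<in>sphere 0 1. \<bar>dlog_dir \<theta>' u h\<bar> \<le> K"
    using dir_bounds(2)[OF cb] by blast
  then obtain K2 where K2: "\<And>h. h \<in> (Basis :: 'k par set) \<Longrightarrow> 0 \<le> K2 h"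
      "\<And>h \<theta>' u. h \<in> (Basis :: 'k par set) \<Longrightarrow> \<theta>' \<in> cball \<theta> \<epsilon> \<Longrightarrow> u \<in> sphere 0 1 \<Longrightarrow> \<bar>dlog_dir \<theta>' u h\<bar> \<le> K2 h"
    by (metis (no_types, lifting) bchoice)
  \<comment> \<open>The exponential covers the ratio of densities, the sum covers the score, and the
    summand 1 ensures \<open>1 \<le> D\<close>.\<close>
  define K where "K = 1 + exp (2 * K1) + (\<Sum>h\<in>(Basis :: 'k par set). K2 h + 1 / \<epsilon>)"
  have K: "1 \<le> K" "exp (2 * K1) \<le> K" "(\<Sum>h\<in>(Basis :: 'k par set). K2 h + 1 / \<epsilon>) \<le> K"
  proof -
    have "0 \<le> (\<Sum>h\<in>(Basis :: 'k par set). K2 h + 1 / \<epsilon>)"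
      using K2(1) \<epsilon> by (intro sum_nonneg add_nonneg_nonneg) auto
    moreover have "0 \<le> exp (2 * K1)" by simp
    ultimately show "1 \<le> K" "exp (2 * K1) \<le> K" "(\<Sum>h\<in>(Basis :: 'k par set). K2 h + 1 / \<epsilon>) \<le> K"
      unfolding K_def by linarith+
  qed
  define D where "D x = K * rho x powr \<epsilon>" for x :: "'k rvec"
  have rp: "1 \<le> rho x powr \<epsilon>" for x :: "'k rvec"
    using rho_ge_1[of x] \<epsilon> by (simp add: ge_one_powr_ge_zero)
  have lnr: "0 \<le> ln (rho x)" "ln (rho x) \<le> rho x powr \<epsilon> / \<epsilon>" for x :: "'k rvec"
    using rho_ge_1[of x] \<epsilon>(1) by (auto intro: ln_powr_bound)
  show ?thesis
  proof (intro exI[of _ \<epsilon>] exI[of _ D] conjI ballI allI)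
    show "0 < \<epsilon>" by (rule \<epsilon>)
    show "D \<in> borel_measurable lborel" unfolding D_def[abs_def] by measurable
    show "ball \<theta> \<epsilon> \<subseteq> Par" using cb ball_subset_cball by blast
    show "1 \<le> D x" for x
      using mult_mono[OF K(1) rp[of x]] K(1) by (simp add: D_def)
    show "integrable (density lborel (\<lambda>x. ennreal (dens \<theta> x))) (\<lambda>x. (D x)^4)"
    proof -
      define a where "a = (?s + ?k - 4 * \<epsilon>) / 2"
      have a: "?k / 2 < a" using s \<epsilon> by (simp add: a_def field_simps)
      have "integrable lborel (\<lambda>x. dens \<theta> x * D x ^ 4)"
      proof (rule Bochner_Integration.integrable_bound)
        show "integrable lborel (\<lambda>x :: 'k rvec. (K ^ 4 * exp K1) * (1 + (norm x)\<^sup>2) powr (- a))"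
          by (intro integrable_mult_right integrable_radial a)
        show "(\<lambda>x. dens \<theta> x * D x ^ 4) \<in> borel_measurable lborel"
          unfolding D_def by measurable
        show "AE x in lborel. norm (dens \<theta> x * D x ^ 4) \<le> norm ((K ^ 4 * exp K1) * (1 + (norm x)\<^sup>2) powr (- a))"
        proof (rule AE_I2)
          fix x :: "'k rvec"
          have r0: "0 < rho x" by (rule rho_pos)
          have "dens \<theta> x = exp (ln (dens \<theta> x))" using dens_pos[OF \<theta>, of x] by simp
          also have "\<dots> = exp (log_dir \<theta> (dir x)) * exp (- (?s + ?k) * ln (rho x))"
            unfolding ln_dens_dir[OF \<theta>] exp_add[symmetric] by (simp add: algebra_simps)
          also have "exp (- (?s + ?k) * ln (rho x)) = rho x powr (- (?s + ?k))"
            using r0 by (simp add: powr_def)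
          finally have d: "dens \<theta> x = exp (log_dir \<theta> (dir x)) * rho x powr (- (?s + ?k))" .
          have "exp (log_dir \<theta> (dir x)) \<le> exp K1"
            using K1(2)[of \<theta> "dir x"] \<epsilon> dir_sphere[of x] by auto
          then have d': "dens \<theta> x \<le> exp K1 * rho x powr (- (?s + ?k))"
            unfolding d by (intro mult_right_mono) auto
          have D4: "D x ^ 4 = K ^ 4 * rho x powr (4 * \<epsilon>)"
          proof -
            have "(rho x powr \<epsilon>) ^ 4 = rho x powr (\<epsilon> * real 4)"
              using r0 by (subst powr_powr[symmetric], subst powr_realpow) auto
            then show ?thesis by (simp add: D_def power_mult_distrib mult.commute)
          qed
          have "dens \<theta> x * D x ^ 4 \<le> (exp K1 * rho x powr (- (?s + ?k))) * D x ^ 4"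
            using d' by (intro mult_right_mono) (auto simp: D4)
          also have "\<dots> = (K ^ 4 * exp K1) * (rho x powr (- (?s + ?k)) * rho x powr (4 * \<epsilon>))"
            by (simp add: D4)
          also have "rho x powr (- (?s + ?k)) * rho x powr (4 * \<epsilon>) = (1 + (norm x)\<^sup>2) powr (- a)"
          proof -
            have r: "rho x = (1 + (norm x)\<^sup>2) powr (1 / 2)"
              by (simp add: rho_def powr_half_sqrt)
            have e: "1 / 2 * - (?s + ?k) + 1 / 2 * (4 * \<epsilon>) = - a"
              by (simp add: a_def field_simps)
            show ?thesis
              unfolding powr_add[symmetric] r powr_powr e ..
          qed
          finally have "dens \<theta> x * D x ^ 4 \<le> (K ^ 4 * exp K1) * (1 + (norm x)\<^sup>2) powr (- a)" .
          moreover have "0 \<le> dens \<theta> x * D x ^ 4"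
            using dens_pos[OF \<theta>, of x] by (simp add: D4)
          ultimately show "norm (dens \<theta> x * D x ^ 4) \<le> norm ((K ^ 4 * exp K1) * (1 + (norm x)\<^sup>2) powr (- a))"
            by (simp only: real_norm_def)
        qed
      qed
      then show ?thesis
        using dens_pos[OF \<theta>] by (subst integrable_density) (auto simp: less_imp_le D_def)
    qed
    fix \<theta>' and x :: "'k rvec" assume "\<theta>' \<in> ball \<theta> \<epsilon>"
    then have \<theta>': "\<theta>' \<in> cball \<theta> \<epsilon>" "\<theta>' \<in> Par" and d: "dist \<theta> \<theta>' < \<epsilon>" using cb by auto
    have r0: "0 < rho x" by (rule rho_pos)
    have "norm (scoreS \<theta>' x) \<le> (\<Sum>b\<in>Basis. \<bar>dlog \<theta>' x b\<bar>)"
      unfolding scoreS_def by (rule order_trans[OF norm_sum]) simp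
    also have "\<dots> \<le> (\<Sum>b\<in>(Basis :: 'k par set). (K2 b + 1 / \<epsilon>) * rho x powr \<epsilon>)"
    proof (rule sum_mono)
      fix b :: "'k par" assume b: "b \<in> Basis"
      have "\<bar>snd (snd b)\<bar> \<le> norm (snd b)" using norm_snd_le[of "snd (snd b)" "fst (snd b)"] by simp
      also have "\<dots> \<le> norm b" using norm_snd_le[of "snd b" "fst b"] by simp
      finally have b1: "\<bar>snd (snd b)\<bar> \<le> 1" using b by simp
      have "\<bar>dlog \<theta>' x b\<bar> \<le> \<bar>dlog_dir \<theta>' (dir x) b\<bar> + \<bar>snd (snd b)\<bar> * ln (rho x)"
        unfolding dlog_dir[OF \<theta>'(2)] using lnr(1)[of x] by (simp add: abs_mult order_trans[OF abs_triangle_ineq4])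
      also have "\<dots> \<le> K2 b + 1 * (rho x powr \<epsilon> / \<epsilon>)"
        using K2(2)[OF b \<theta>'(1) dir_sphere[of x]] lnr[of x] b1 by (intro add_mono mult_mono) auto
      also have "\<dots> \<le> K2 b * rho x powr \<epsilon> + 1 * (rho x powr \<epsilon> / \<epsilon>)"
        using mult_left_mono[OF rp[of x] K2(1)[OF b]] by simp
      finally show "\<bar>dlog \<theta>' x b\<bar> \<le> (K2 b + 1 / \<epsilon>) * rho x powr \<epsilon>"
        by (simp add: distrib_right)
    qed
    also have "\<dots> = (\<Sum>b\<in>(Basis :: 'k par set). K2 b + 1 / \<epsilon>) * rho x powr \<epsilon>"
      by (rule sum_distrib_right[symmetric])
    also have "\<dots> \<le> D x"
      unfolding D_def by (intro mult_right_mono K) simp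
    finally show "norm (scoreS \<theta>' x) \<le> D x" .
    have "\<bar>snd (snd \<theta>) - snd (snd \<theta>')\<bar> \<le> dist \<theta> \<theta>'"
      using order_trans[OF dist_snd_le[of "snd \<theta>" "snd \<theta>'"] dist_snd_le[of \<theta> \<theta>']] by (simp add: dist_real_def)
    then have sd: "?s - snd (snd \<theta>') \<le> \<epsilon>" using d by linarith
    have "ln (dens \<theta>' x) - ln (dens \<theta> x) = log_dir \<theta>' (dir x) - log_dir \<theta> (dir x) + (?s - snd (snd \<theta>')) * ln (rho x)"
      unfolding ln_dens_dir[OF \<theta>] ln_dens_dir[OF \<theta>'(2)] by (simp add: algebra_simps)
    also have "\<dots> \<le> 2 * K1 + \<epsilon> * ln (rho x)"
    proof (rule add_mono)
      show "log_dir \<theta>' (dir x) - log_dir \<theta> (dir x) \<le> 2 * K1"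
        using K1(2)[OF \<theta>'(1) dir_sphere[of x]] K1(2)[of \<theta> "dir x"] dir_sphere[of x] \<epsilon> by simp
      show "(?s - snd (snd \<theta>')) * ln (rho x) \<le> \<epsilon> * ln (rho x)"
        using sd lnr(1) by (intro mult_right_mono)
    qed
    finally have "exp (ln (dens \<theta>' x)) \<le> exp (2 * K1 + \<epsilon> * ln (rho x) + ln (dens \<theta> x))"
      by simp
    then have "dens \<theta>' x \<le> exp (2 * K1) * rho x powr \<epsilon> * dens \<theta> x"
      using dens_pos[OF \<theta>, of x] dens_pos[OF \<theta>'(2), of x] r0 by (simp add: exp_add powr_def)
    also have "\<dots> \<le> D x * dens \<theta> x"
      unfolding D_def using dens_pos[OF \<theta>, of x] by (intro mult_right_mono K) auto
    finally show "dens \<theta>' x \<le> D x * dens \<theta> x" .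
  qed
qed

lemma t_law_dens: "t_law (fst \<theta>) (Sig \<theta>) (snd (snd \<theta>)) = density lborel (\<lambda>x. ennreal (dens \<theta> x))"
  by (simp add: t_law_def dens_def)

interpretation t: smooth_model lborel "Par :: 'k::{finite,linorder} par set" dens scoreS
proof (rule smooth_model.intro)
  fix \<theta> :: "'k par" assume \<theta>: "\<theta> \<in> Par"
  have "scoreS \<theta> \<in> borel_measurable borel"
    unfolding scoreS_def[abs_def]
    by (intro borel_measurable_continuous_onI continuous_intros \<theta>)
  then show "scoreS \<theta> \<in> borel_measurable lborel"
    by simp
  show "prob_space (density lborel (\<lambda>x. ennreal (dens \<theta> x)))"
    unfolding t_law_dens[symmetric] using \<theta> by (intro prob_space_t_law) (auto simp: Par_def)
  fix x
  show "((\<lambda>\<theta>. ln (dens \<theta> x)) has_derivative (\<lambda>h. scoreS \<theta> x \<bullet> h)) (at \<theta>)"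
    unfolding scoreS_inner[OF \<theta>] by (rule ln_dens_deriv[OF \<theta>])
  have "continuous_on Par (\<lambda>\<theta>. scoreS \<theta> x)"
    unfolding scoreS_def by (intro continuous_intros) auto
  then show "isCont (\<lambda>\<theta>. scoreS \<theta> x) \<theta>"
    by (rule continuous_on_interior) (simp add: interior_open[OF open_Par] \<theta>)
qed (use open_Par dens_pos dens_dominated in auto)

section \<open>Scores and Fisher information\<close>

lemma gradient_eq:
  fixes f :: "'a::real_inner \<Rightarrow> real"
  assumes "(f has_derivative (\<lambda>h. D \<bullet> h)) (at x)"
  shows "gradient f x = D"
  unfolding gradient_def
proof (rule the_equality)
  show "GDERIV f x :> D"
    unfolding gderiv_def using assms by (simp add: inner_commute)
  fix D' assume "GDERIV f x :> D'"
  then have "(\<lambda>h. h \<bullet> D') = (\<lambda>h. D \<bullet> h)"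
    unfolding gderiv_def by (rule has_derivative_unique) (rule assms)
  then have "(D' - D) \<bullet> (D' - D) = 0"
    by (metis inner_commute inner_diff_left right_minus_eq)
  then show "D' = D" by simp
qed

text \<open>The chain rule restricts the joint derivative to each block of coordinates. The matrix
  enters through \<open>unvech\<close>, so its block is already the gradient in the free
  coordinates.\<close>

lemma score_components:
  fixes \<theta> :: "'k::{finite,linorder} par"
  assumes \<theta>: "\<theta> \<in> Par"
  shows "score1 (fst \<theta>) (Sig \<theta>) (snd (snd \<theta>)) x = fst (scoreS \<theta> x)"
    and "score2 (fst \<theta>) (Sig \<theta>) (snd (snd \<theta>)) x = fst (snd (scoreS \<theta> x))"
    and "score3 (fst \<theta>) (Sig \<theta>) (snd (snd \<theta>)) x = snd (snd (scoreS \<theta> x))"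
proof -
  obtain m v s where t: "\<theta> = (m, v, s)" by (cases \<theta>)
  have der: "((\<lambda>\<theta>. ln (dens \<theta> x)) has_derivative (\<lambda>h. scoreS \<theta> x \<bullet> h)) (at \<theta>)"
    unfolding scoreS_inner[OF \<theta>] by (rule ln_dens_deriv[OF \<theta>])
  obtain S1 S2 S3 where S: "scoreS \<theta> x = (S1, S2, S3)" by (cases "scoreS \<theta> x")
  have "((\<lambda>m'. (m', v, s)) has_derivative (\<lambda>h. (h, 0, 0))) (at m)"
    by (intro has_derivative_Pair has_derivative_ident has_derivative_const)
  from has_derivative_compose[OF this der[unfolded t]]
  have "((\<lambda>m'. ln (dens (m', v, s) x)) has_derivative (\<lambda>h. S1 \<bullet> h)) (at m)"
    using S by (simp add: t)
  then show "score1 (fst \<theta>) (Sig \<theta>) (snd (snd \<theta>)) x = fst (scoreS \<theta> x)"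
    unfolding score1_def using S by (intro gradient_eq) (simp add: t dens_def Sig_def)
  have "((\<lambda>v'. (m, v', s)) has_derivative (\<lambda>h. (0, h, 0))) (at v)"
    by (intro has_derivative_Pair has_derivative_ident has_derivative_const)
  from has_derivative_compose[OF this der[unfolded t]]
  have "((\<lambda>v'. ln (dens (m, v', s) x)) has_derivative (\<lambda>h. S2 \<bullet> h)) (at v)"
    using S by (simp add: t)
  then show "score2 (fst \<theta>) (Sig \<theta>) (snd (snd \<theta>)) x = fst (snd (scoreS \<theta> x))"
    unfolding score2_def using S by (intro gradient_eq) (simp add: t dens_def Sig_def vech_unvech)
  have "((\<lambda>s'. (m, v, s')) has_derivative (\<lambda>h. (0, 0, h))) (at s)"
    by (intro has_derivative_Pair has_derivative_ident has_derivative_const)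
  from has_derivative_compose[OF this der[unfolded t]]
  have "((\<lambda>s'. ln (dens (m, v, s') x)) has_derivative (\<lambda>h. S3 * h)) (at s)"
    using S by (simp add: t)
  then have "((\<lambda>s'. ln (dens (m, v, s') x)) has_field_derivative S3) (at s)"
    by (simp add: has_field_derivative_def)
  then show "score3 (fst \<theta>) (Sig \<theta>) (snd (snd \<theta>)) x = snd (snd (scoreS \<theta> x))"
    unfolding score3_def using S DERIV_imp_deriv by (fastforce simp: t dens_def Sig_def)
qed

definition dirn :: "('k::{finite,linorder} + 'k vech_index + unit) \<Rightarrow> 'k par"
  where "dirn a = (case a of Inl i \<Rightarrow> (axis i 1, 0, 0) | Inr (Inl p) \<Rightarrow> (0, axis p 1, 0) | Inr (Inr u) \<Rightarrow> (0, 0, 1))"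

lemma score_dirn:
  assumes "\<theta> \<in> Par"
  shows "score (fst \<theta>) (Sig \<theta>) (snd (snd \<theta>)) x $ a = dirn a \<bullet> scoreS \<theta> x"
  using score_components[OF assms, of x]
  by (cases "scoreS \<theta> x") (auto simp: score_def dirn_def inner_axis' split: sum.split)

lemma t_P: "t.P \<theta> = t_law (fst \<theta>) (Sig \<theta>) (snd (snd \<theta>))"
  by (simp add: t.P_def t_law_dens)

text \<open>The means in the covariance vanish, which leaves the raw second moments of
  \<open>t.info\<close>.\<close>

lemma fisher_info_eq:
  assumes "\<theta> \<in> Par"
  shows "fisher_info (fst \<theta>) (Sig \<theta>) (snd (snd \<theta>)) $ a $ b = t.info \<theta> (dirn a) (dirn b)"
  unfolding fisher_info_def covariance_matrix_def t.info_def t_P[symmetric]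
  using t.score_mean_zero[OF assms] by (simp add: score_dirn[OF assms])

definition nuDir :: "'k::{finite,linorder} par" where "nuDir = (0, 0, 1)"

abbreviation "F22 \<theta> \<equiv> fisher22 (fst \<theta>) (Sig \<theta>) (snd (snd \<theta>))"
abbreviation "F23 \<theta> \<equiv> fisher23 (fst \<theta>) (Sig \<theta>) (snd (snd \<theta>))"
abbreviation "F33 \<theta> \<equiv> fisher33 (fst \<theta>) (Sig \<theta>) (snd (snd \<theta>))"
abbreviation "Geff \<theta> \<equiv> eff_fisher33 (fst \<theta>) (Sig \<theta>) (snd (snd \<theta>))"

lemma fisher_entries:
  assumes "\<theta> \<in> Par"
  shows "F22 \<theta> $ p $ q = t.info \<theta> (0, axis p 1, 0) (0, axis q 1, 0)"
    and "F23 \<theta> $ p = t.info \<theta> (0, axis p 1, 0) nuDir"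
    and "F33 \<theta> = t.info \<theta> nuDir nuDir"
  by (simp_all add: fisher22_def fisher23_def fisher33_def fisher_info_eq[OF assms] dirn_def nuDir_def)

lemma info_sum_left:
  fixes \<theta> :: "'k::{finite,linorder} par"
  assumes "\<theta> \<in> Par"
  shows "t.info \<theta> (0, v, 0) h = (\<Sum>p\<in>UNIV. v $ p * t.info \<theta> (0, axis p 1, 0) h)"
proof -
  have lin: "linear (\<lambda>v. t.info \<theta> (0, v, 0) h)"
  proof (rule linearI)
    fix v w :: "(real, 'k vech_index) vec" and c :: real
    show "t.info \<theta> (0, v + w, 0) h = t.info \<theta> (0, v, 0) h + t.info \<theta> (0, w, 0) h"
      using t.info_add_right[OF assms, of h "(0, v, 0)" "(0, w, 0)"] by (simp add: t.info_commute[of _ h])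
    show "t.info \<theta> (0, c *\<^sub>R v, 0) h = c *\<^sub>R t.info \<theta> (0, v, 0) h"
      using t.info_scale_right[of \<theta> h c "(0, v, 0)"] by (simp add: t.info_commute[of _ h])
  qed
  have "v = (\<Sum>p\<in>UNIV. v $ p *\<^sub>R axis p 1)"
    using basis_expansion[of v] by (simp add: scalar_mult_eq_scaleR)
  then have "t.info \<theta> (0, v, 0) h = t.info \<theta> (0, \<Sum>p\<in>UNIV. v $ p *\<^sub>R axis p 1, 0) h"
    by simp
  also have "\<dots> = (\<Sum>p\<in>UNIV. v $ p * t.info \<theta> (0, axis p 1, 0) h)"
    using linear_sum[OF lin, of "\<lambda>p. v $ p *\<^sub>R axis p 1" UNIV] linear_scale[OF lin] by simp
  finally show ?thesis .
qed

lemma info_F22: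
  assumes "\<theta> \<in> Par"
  shows "t.info \<theta> (0, v, 0) (0, w, 0) = v \<bullet> (F22 \<theta> *v w)"
    and "t.info \<theta> (0, v, 0) nuDir = v \<bullet> F23 \<theta>"
proof -
  have "t.info \<theta> (0, axis p 1, 0) (0, w, 0) = (\<Sum>q\<in>UNIV. w $ q * F22 \<theta> $ p $ q)" for p
    unfolding fisher_entries[OF assms] t.info_commute[of \<theta> "(0, axis p 1, 0)"] by (rule info_sum_left[OF assms])
  then show "t.info \<theta> (0, v, 0) (0, w, 0) = v \<bullet> (F22 \<theta> *v w)"
    unfolding info_sum_left[OF assms, of v] inner_vec_def matrix_vector_mult_def by (simp add: mult.commute)
  show "t.info \<theta> (0, v, 0) nuDir = v \<bullet> F23 \<theta>"
    unfolding info_sum_left[OF assms, of v] inner_vec_def by (simp add: fisher_entries[OF assms])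
qed

lemma scoreS_continuous [continuous_intros]:
  assumes "continuous_on T f" "continuous_on T g" "\<And>t. t \<in> T \<Longrightarrow> f t \<in> Par"
  shows "continuous_on T (\<lambda>t. scoreS (f t) (g t))"
  unfolding scoreS_def by (intro continuous_intros assms)

section \<open>Nonsingularity and block structure of the information\<close>

text \<open>A vanishing second moment makes the score zero almost everywhere under the law, hence
  under Lebesgue measure, as the density is positive. By continuity the exceptional set is open, and
  an open null set is empty.\<close>

lemma info_zero_imp:
  fixes \<theta> :: "'k::{finite,linorder} par"
  assumes \<theta>: "\<theta> \<in> Par" and "t.info \<theta> a a = 0"
  shows "dlog \<theta> x a = 0"
proof -
  let ?f = "\<lambda>x. a \<bullet> scoreS \<theta> x"
  have c: "continuous_on UNIV ?f"
    by (intro continuous_intros \<theta>)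
  then have [measurable]: "?f \<in> borel_measurable borel"
    by (rule borel_measurable_continuous_onI)
  have "AE x in t.P \<theta>. ?f x * ?f x = 0"
    using assms(2) integral_nonneg_eq_0_iff_AE[OF t.score_prod_integrable(1)[OF \<theta>, of a a]]
    by (simp add: t.info_def)
  then have "AE x in lborel. ?f x = 0"
    unfolding t.P_def using dens_pos[OF \<theta>] by (subst (asm) AE_density) auto
  moreover have "{x. ?f x \<noteq> 0} \<in> sets lborel"
    by measurable
  ultimately have "{x. ?f x \<noteq> 0} \<in> null_sets lborel"
    by (subst AE_iff_null_sets) auto
  then have "negligible {x. ?f x \<noteq> 0}"
    by (simp add: negligible_iff_null_sets null_sets_completionI)
  moreover have "open {x. ?f x \<noteq> 0}"
    using c by (intro open_Collect_neq) auto
  ultimately have "{x. ?f x \<noteq> 0} = {}"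
    using open_not_negligible by blast
  then show ?thesis
    using scoreS_inner[OF \<theta>, of x a] by (auto simp: inner_commute)
qed

text \<open>The vanishing score is examined at the points \<open>\<mu> + \<tau> \<Sigma> w\<close>.
  For \<open>c \<noteq> 0\<close> the logarithm would grow without bound in \<open>\<tau>\<close>
  while all other terms stay bounded. With \<open>c = 0\<close> the centre \<open>\<mu>\<close>
  gives \<open>C0 = 0\<close>, then the quadratic form of \<open>H\<close> vanishes everywhere, and
  polarisation gives \<open>H = 0\<close>.\<close>

lemma info_pos_def:
  fixes \<theta> :: "'k::{finite,linorder} par"
  assumes \<theta>: "\<theta> \<in> Par" and "t.info \<theta> (0, v, c) (0, v, c) = 0"
  shows "v = 0" "c = 0"
proof -
  let ?s = "snd (snd \<theta>)" and ?k = "real CARD('k)"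
  define H where "H = unvech v"
  define C0 where "C0 = dlog_const \<theta> (0, v, c)"
  define B where "B w = (Sig \<theta> *v w) \<bullet> w" for w
  have s: "0 < ?s" by (rule Par_D(2)[OF \<theta>])
  have sk: "0 < ?s + ?k" using s by (simp add: add_pos_nonneg)
  have inv: "matrix_inv (Sig \<theta>) *v (Sig \<theta> *v w) = w" for w
    by (rule matrix_inv_mult_vec(2)[OF pos_def_invertible[OF Par_D(1)[OF \<theta>]]])
  have Bpos: "0 < B w" if "w \<noteq> 0" for w
    using pos_def_pos[OF Par_D(1)[OF \<theta>] that] by (simp add: B_def inner_commute)
  have eq: "C0 - c / 2 * ln (?s + \<tau>\<^sup>2 * B w) - (?s + ?k) / 2 * ((c - \<tau>\<^sup>2 * (w \<bullet> (H *v w))) / (?s + \<tau>\<^sup>2 * B w)) = 0" for \<tau> w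
  proof -
    \<comment> \<open>At this point \<open>wvec\<close> equals \<open>\<tau> w\<close>, so that no
      inverse matrix remains.\<close>
    let ?x = "fst \<theta> + \<tau> *\<^sub>R (Sig \<theta> *v w)"
    have w: "wvec \<theta> ?x 1 = \<tau> *\<^sub>R w"
      by (simp add: wvec_def matrix_vector_mult_scaleR inv)
    have q: "quad \<theta> ?x 1 = ?s + \<tau>\<^sup>2 * B w"
      by (simp add: quad_def w B_def power2_eq_square)
    show ?thesis
      using info_zero_imp[OF assms, of ?x]
      by (simp add: dlog_def w q C0_def H_def Sig_def[of "(0, v, c)"] matrix_vector_mult_scaleR power2_eq_square mult.assoc)
  qed
  show c: "c = 0"
  proof (rule ccontr)
    assume "c \<noteq> 0"
    define w where "w = (axis undefined 1 :: 'k rvec)"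
    have "w \<noteq> 0" by (simp add: w_def axis_eq_0_iff)
    then have b: "0 < B w" by (rule Bpos)
    define d where "d = w \<bullet> (H *v w)"
    \<comment> \<open>\<open>K\<close> bounds all terms other than the logarithm, uniformly in
      \<open>\<tau>\<close>; \<open>M\<close> and \<open>\<tau>\<close> are then chosen so that the
      logarithmic term has absolute value at least \<open>K + 1\<close>.\<close>
    define K where "K = \<bar>C0\<bar> + (?s + ?k) / 2 * (\<bar>c\<bar> / ?s + \<bar>d\<bar> / B w)"
    have K: "0 \<le> K" using s sk b by (simp add: K_def)
    define M where "M = 2 * (K + 1) / \<bar>c\<bar>"
    have M: "0 < M" using K \<open>c \<noteq> 0\<close> by (simp add: M_def)
    define \<tau> where "\<tau> = sqrt (exp M / B w)"
    have \<tau>: "\<tau>\<^sup>2 * B w = exp M" using b by (simp add: \<tau>_def)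
    define q where "q = ?s + \<tau>\<^sup>2 * B w"
    have q: "exp M \<le> q" "?s \<le> q" "\<tau>\<^sup>2 * B w \<le> q" "0 < q"
      using s unfolding q_def \<tau> by (auto simp: add_pos_pos)
    have "\<bar>(c - \<tau>\<^sup>2 * d) / q\<bar> \<le> \<bar>c\<bar> / q + \<tau>\<^sup>2 * \<bar>d\<bar> / q"
      using q by (simp add: abs_mult divide_right_mono flip: add_divide_distrib)
        (metis abs_mult abs_power2 abs_triangle_ineq4 divide_right_mono less_imp_le)
    also have "\<dots> \<le> \<bar>c\<bar> / ?s + \<bar>d\<bar> / B w"
    proof (rule add_mono)
      show "\<bar>c\<bar> / q \<le> \<bar>c\<bar> / ?s" using q s by (intro divide_left_mono) auto
      have "\<tau>\<^sup>2 * B w * \<bar>d\<bar> \<le> q * \<bar>d\<bar>" using q by (intro mult_right_mono) auto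
      then show "\<tau>\<^sup>2 * \<bar>d\<bar> / q \<le> \<bar>d\<bar> / B w" using q b by (simp add: field_simps)
    qed
    finally have f: "\<bar>(c - \<tau>\<^sup>2 * d) / q\<bar> \<le> \<bar>c\<bar> / ?s + \<bar>d\<bar> / B w" .
    have "M \<le> ln q" using q ln_mono[of "exp M" q] by simp
    then have "K + 1 \<le> \<bar>c\<bar> / 2 * ln q"
      using \<open>c \<noteq> 0\<close> by (simp add: M_def field_simps)
    also have "\<dots> = \<bar>c / 2 * ln q\<bar>"
      using \<open>M \<le> ln q\<close> M by (simp add: abs_mult)
    also have "c / 2 * ln q = C0 - (?s + ?k) / 2 * ((c - \<tau>\<^sup>2 * d) / q)"
      using eq[of \<tau> w] unfolding q_def d_def by linarith
    also have "\<bar>\<dots>\<bar> \<le> \<bar>C0\<bar> + (?s + ?k) / 2 * \<bar>(c - \<tau>\<^sup>2 * d) / q\<bar>"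
      using sk abs_triangle_ineq4[of C0 "(?s + ?k) / 2 * ((c - \<tau>\<^sup>2 * d) / q)"] by (simp only: abs_mult) simp
    also have "\<dots> \<le> K"
      unfolding K_def using f sk by (intro add_left_mono mult_left_mono) auto
    finally show False by simp
  qed
  have "C0 = 0" using eq[of 0 0] c by simp
  have d: "w \<bullet> (H *v w) = 0" for w
  proof (cases "w = 0")
    case False
    have "0 < ?s + B w" using Bpos[OF False] s by simp
    then show ?thesis using eq[of 1 w] c \<open>C0 = 0\<close> sk by simp
  qed simp
  have "H = 0"
  proof -
    have Hs: "transpose H = H" unfolding H_def by (rule unvech_sym)
    have "x \<bullet> (H *v y) = 0" for x y
      using d[of "x + y"] d[of x] d[of y] sym_dot[OF Hs, of x y]
      by (simp add: matrix_vector_right_distrib inner_add_left inner_add_right inner_commute)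
    then have "H *v y = 0" for y using inner_eq_zero_iff by blast
    then show ?thesis by (simp add: matrix_eq)
  qed
  then have "vech (unvech v) = vech 0" by (simp add: H_def)
  also have "vech (0 :: 'k rmat) = 0" by (simp add: vech_def vec_eq_iff split_beta)
  finally show "v = 0" by (simp add: vech_unvech)
qed

lemma pos_def_F22:
  assumes "\<theta> \<in> Par"
  shows "pos_def (F22 \<theta>)"
  unfolding pos_def_def
proof (intro conjI allI impI)
  show "transpose (F22 \<theta>) = F22 \<theta>"
    by (simp add: transpose_def vec_eq_iff fisher_entries[OF assms] t.info_commute)
  fix v :: "(real, 'a vech_index) vec" assume "v \<noteq> 0"
  then have "t.info \<theta> (0, v, 0) (0, v, 0) \<noteq> 0"
    using info_pos_def[OF assms] by blast
  then show "0 < v \<bullet> (F22 \<theta> *v v)"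
    using t.info_nonneg[of \<theta> "(0, v, 0)"] by (simp add: info_F22[OF assms])
qed

text \<open>\<open>\<mu>\<close> is informationally orthogonal to \<open>(\<Sigma>, \<nu>)\<close>: reflection of \<open>x\<close> at \<open>\<mu>\<close> preserves the density
  and the scores for \<open>\<Sigma>\<close> and \<open>\<nu>\<close>, and changes the sign of the score for \<open>\<mu>\<close>.\<close>

lemma info_location_orthogonal:
  fixes \<theta> :: "'k::{finite,linorder} par"
  assumes \<theta>: "\<theta> \<in> Par"
  shows "t.info \<theta> (h1, 0, 0) (0, h2, h3) = 0"
proof -
  \<comment> \<open>The reflection \<open>2 \<mu> - x\<close>, written as an affine map with factor
    \<open>-1\<close> so that invariance of Lebesgue measure can be read off
    \<open>lborel_affine\<close>.\<close>
  let ?r = "\<lambda>x. 2 *\<^sub>R fst \<theta> + (- 1) *\<^sub>R x"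
  have w: "wvec \<theta> (?r x) 1 = - wvec \<theta> x 1" for x
  proof -
    have "?r x - 1 *\<^sub>R fst \<theta> = (- 1) *\<^sub>R (x - 1 *\<^sub>R fst \<theta>)" by (simp add: scaleR_2)
    then show ?thesis unfolding wvec_def by (simp only: matrix_vector_mult_scaleR) simp
  qed
  have q: "quad \<theta> (?r x) 1 = quad \<theta> x 1" for x
  proof -
    have "?r x - 1 *\<^sub>R fst \<theta> = - (x - 1 *\<^sub>R fst \<theta>)" by (simp add: scaleR_2)
    then show ?thesis
      unfolding quad_def w by (simp only: inner_minus_left inner_minus_right minus_minus)
  qed
  have ds: "dens \<theta> (?r x) = dens \<theta> x" for x
  proof -
    have "ln (dens \<theta> (?r x)) = ln (dens \<theta> x)" by (simp only: ln_dens[OF \<theta>] q)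
    then show ?thesis using dens_pos[OF \<theta>] by simp
  qed
  have S0: "Sig (h1, 0, 0) = (0 :: 'k rmat)" by (simp add: Sig_def vec_eq_iff unvech_nth)
  have "det_deriv (Sig \<theta>) 0 = 0" by (simp add: det_deriv_def)
  then have d1: "dlog \<theta> (?r x) (h1, 0, 0) = - dlog \<theta> x (h1, 0, 0)" for x
    unfolding dlog_def w q dlog_const_def Let_def S0 by simp
  have d2: "dlog \<theta> (?r x) (0, h2, h3) = dlog \<theta> x (0, h2, h3)" for x
    unfolding dlog_def w q by (simp add: vec.neg)
  have refl: "distr lborel borel ?r = (lborel :: 'k rvec measure)"
    using lborel_affine[of "- 1" "2 *\<^sub>R fst \<theta>"] by (simp add: density_1)
  let ?g = "\<lambda>x. dens \<theta> x * (dlog \<theta> x (h1, 0, 0) * dlog \<theta> x (0, h2, h3))"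
  have dm: "(\<lambda>x. dlog \<theta> x h) \<in> borel_measurable borel" for h
    by (intro borel_measurable_continuous_onI continuous_intros \<theta>)
  have gm: "?g \<in> borel_measurable borel"
    by (intro borel_measurable_times dens_measurable dm)
  have "t.info \<theta> (h1, 0, 0) (0, h2, h3) = (LINT x|lborel. ?g x)"
    unfolding t.info_def t.P_def inner_commute[of _ "scoreS \<theta> _"] scoreS_inner[OF \<theta>]
    using dens_pos[OF \<theta>] dm by (subst integral_density) (auto simp: less_imp_le)
  also have "\<dots> = (LINT x|distr lborel borel ?r. ?g x)"
    by (simp only: refl)
  also have "\<dots> = (LINT x|lborel. ?g (?r x))"
    by (rule integral_distr) (use gm in auto)
  also have "\<dots> = (LINT x|lborel. - ?g x)"
    unfolding ds d1 d2 by simp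
  also have "\<dots> = - (LINT x|lborel. ?g x)"
    by simp
  finally show ?thesis
    unfolding t.info_def t.P_def inner_commute[of _ "scoreS \<theta> _"] scoreS_inner[OF \<theta>]
    using dens_pos[OF \<theta>] dm by (subst (asm) (1) integral_density, (auto simp: less_imp_le)[3], subst integral_density) (auto simp: less_imp_le)
qed

section \<open>The efficient score for \<open>\<nu>\<close>\<close>

text \<open>The middle block is minus the coefficient vector of the projection of the score for
  \<open>\<nu>\<close> on the scores for \<open>\<Sigma>\<close>, so the score in this direction is
  the efficient score. The first block is 0 because location is orthogonal to both.\<close>

definition effDir :: "'k::{finite,linorder} par \<Rightarrow> 'k par"
  where "effDir \<theta> = (0, - (matrix_inv (F22 \<theta>) *v F23 \<theta>), 1)"

lemma F22_inv:
  assumes "\<theta> \<in> Par"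
  shows "F22 \<theta> *v (matrix_inv (F22 \<theta>) *v v) = v"
  by (rule matrix_inv_mult_vec(1)[OF pos_def_invertible[OF pos_def_F22[OF assms]]])

text \<open>The location part drops out by \<open>info_location_orthogonal\<close>, the part for
  \<open>\<Sigma>\<close> by the normal equation \<open>F22 u = F23\<close>, and in the direction of
  \<open>\<nu>\<close> the Schur complement remains.\<close>

lemma info_effDir:
  fixes \<theta> :: "'k::{finite,linorder} par"
  assumes \<theta>: "\<theta> \<in> Par"
  shows "t.info \<theta> (effDir \<theta>) h = Geff \<theta> * (nuDir \<bullet> h)"
proof -
  define u where "u = matrix_inv (F22 \<theta>) *v F23 \<theta>"
  obtain h1 h2 h3 where h: "h = (h1, h2, h3)" by (cases h)
  have add: "t.info \<theta> a (b + c) = t.info \<theta> a b + t.info \<theta> a c" for a b c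
    by (rule t.info_add_right[OF \<theta>])
  have e: "effDir \<theta> = (0, - u, 0) + nuDir"
    by (simp add: effDir_def u_def nuDir_def)
  have h': "h = (h1, 0, 0) + ((0, h2, 0) + h3 *\<^sub>R nuDir)"
    by (simp add: h nuDir_def)
  have 1: "t.info \<theta> (effDir \<theta>) (h1, 0, 0) = 0"
    unfolding t.info_commute[of _ "effDir \<theta>"] unfolding effDir_def by (rule info_location_orthogonal[OF \<theta>])
  have 2: "t.info \<theta> (effDir \<theta>) (0, h2, 0) = 0"
  proof -
    have "t.info \<theta> (0, h2, 0) (0, - u, 0) = h2 \<bullet> (F22 \<theta> *v (- u))"
      by (rule info_F22(1)[OF \<theta>])
    also have "F22 \<theta> *v (- u) = - (F22 \<theta> *v u)" by (simp add: vec.neg)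
    also have "F22 \<theta> *v u = F23 \<theta>" unfolding u_def by (rule F22_inv[OF \<theta>])
    finally show ?thesis
      unfolding t.info_commute[of _ "effDir \<theta>"] unfolding e add by (simp add: info_F22(2)[OF \<theta>])
  qed
  have 3: "t.info \<theta> (effDir \<theta>) nuDir = Geff \<theta>"
  proof -
    have "t.info \<theta> nuDir (0, - u, 0) = - (u \<bullet> F23 \<theta>)"
      unfolding t.info_commute[of _ nuDir] by (simp add: info_F22(2)[OF \<theta>])
    then show ?thesis
      unfolding t.info_commute[of _ "effDir \<theta>"] unfolding e add
      by (simp add: eff_fisher33_def fisher_entries(3)[OF \<theta>] u_def inner_commute)
  qed
  have "t.info \<theta> (effDir \<theta>) h = h3 * Geff \<theta>"
    unfolding h' add 1 2 t.info_scale_right 3 by simp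
  then show ?thesis
    by (simp add: h nuDir_def)
qed

lemma nuDir_effDir: "nuDir \<bullet> effDir \<theta> = 1"
  by (simp add: nuDir_def effDir_def)

text \<open>\<open>Geff\<close> is the information in a direction whose last coordinate is 1, so by
  \<open>info_pos_def\<close> it cannot vanish.\<close>

lemma Geff_pos:
  assumes "\<theta> \<in> Par"
  shows "0 < Geff \<theta>"
proof -
  have eq: "t.info \<theta> (effDir \<theta>) (effDir \<theta>) = Geff \<theta>"
    unfolding info_effDir[OF assms] nuDir_effDir by (rule mult_1_right)
  have "Geff \<theta> \<noteq> 0"
  proof
    assume "Geff \<theta> = 0"
    then have "t.info \<theta> (effDir \<theta>) (effDir \<theta>) = 0"
      unfolding eq .
    then have "(1::real) = 0"
      unfolding effDir_def by (rule info_pos_def(2)[OF assms])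
    then show False by simp
  qed
  moreover have "0 \<le> Geff \<theta>"
    using t.info_nonneg[of \<theta> "effDir \<theta>"] unfolding eq .
  ultimately show ?thesis
    by linarith
qed

lemma continuous_on_F:
  "continuous_on Par F22" "continuous_on Par F23" "continuous_on Par F33"
proof -
  have "continuous_on Par (\<lambda>\<theta>. \<chi> p q. t.info \<theta> (0, axis p 1, 0) (0, axis q 1, 0))"
    by (intro continuous_on_vec_lambda t.info_continuous)
  then show "continuous_on Par F22"
    by (rule continuous_on_eq) (simp add: vec_eq_iff fisher_entries)
  have "continuous_on Par (\<lambda>\<theta>. \<chi> p. t.info \<theta> (0, axis p 1, 0) nuDir)"
    by (intro continuous_on_vec_lambda t.info_continuous)
  then show "continuous_on Par F23"
    by (rule continuous_on_eq) (simp add: vec_eq_iff fisher_entries)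
  have "continuous_on Par (\<lambda>\<theta>. t.info \<theta> nuDir nuDir)"
    by (rule t.info_continuous)
  then show "continuous_on Par F33"
    by (rule continuous_on_eq) (simp add: fisher_entries)
qed

lemma continuous_on_eff:
  "continuous_on Par effDir" "continuous_on Par Geff"
proof -
  have u: "continuous_on Par (\<lambda>\<theta>. matrix_inv (F22 \<theta>) *v F23 \<theta>)"
  proof (rule continuous_on_matrix_inv_mult[OF continuous_on_F(1,2)])
    show "det (F22 \<theta>) \<noteq> 0" if "\<theta> \<in> Par" for \<theta>
      using pos_def_det_pos[OF pos_def_F22[OF that]] by simp
  qed
  show "continuous_on Par effDir"
    unfolding effDir_def[abs_def] by (intro continuous_intros u)
  show "continuous_on Par Geff"
    unfolding eff_fisher33_def by (intro continuous_on_diff continuous_on_inner u continuous_on_F)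
qed

interpretation te: efficient_model lborel "Par :: 'k::{finite,linorder} par set" dens scoreS nuDir effDir Geff
  by unfold_locales (auto intro: continuous_on_eff Geff_pos info_effDir nuDir_effDir)

text \<open>Symmetry of the inverse of \<open>F22\<close> moves it from the central sequence for
  \<open>\<Sigma>\<close> to \<open>F23\<close>.\<close>

lemma Delta_eq:
  assumes \<theta>: "\<theta> \<in> Par"
  shows "eff_central3 n (fst \<theta>) (Sig \<theta>) (snd (snd \<theta>)) X = te.Delta n \<theta> X"
proof -
  define u where "u = matrix_inv (F22 \<theta>) *v F23 \<theta>"
  have sym: "F23 \<theta> \<bullet> (matrix_inv (F22 \<theta>) *v z) = u \<bullet> z" for z
    unfolding u_def by (rule sym_dot[OF pos_def_sym[OF pos_def_matrix_inv[OF pos_def_F22[OF \<theta>]]]])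
  have e: "effDir \<theta> \<bullet> scoreS \<theta> x = snd (snd (scoreS \<theta> x)) - u \<bullet> fst (snd (scoreS \<theta> x))" for x
    by (cases "scoreS \<theta> x") (simp add: effDir_def u_def)
  show ?thesis
    unfolding eff_central3_def sym te.Delta_def central3_def central2_def score_components[OF \<theta>] e
    by (simp only: sum_subtractf right_diff_distrib inner_scaleR_right inner_sum_right)
qed

section \<open>The one-step estimator of \<open>\<nu>\<close>\<close>

lemma normal_density_second_moment:
  assumes "0 < \<sigma>"
  defines "L \<equiv> density lborel (\<lambda>y. ennreal (normal_density 0 \<sigma> y))"
  shows "integrable L (\<lambda>y. y\<^sup>2)" and "prob_space.variance L (\<lambda>y. y) = \<sigma>\<^sup>2"
proof -
  interpret L: prob_space L
    unfolding L_def by (rule prob_space_normal_density) fact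
  show "integrable L (\<lambda>y. y\<^sup>2)"
    unfolding L_def using integrable_normal_moment[of \<sigma> 0 2] assms(1)
    by (subst integrable_density) auto
  have "distributed L lborel (\<lambda>y. y) (normal_density 0 \<sigma>)"
    unfolding distributed_def L_def by (simp add: distr_id2)
  then show "L.variance (\<lambda>y. y) = \<sigma>\<^sup>2"
    by (rule L.normal_distributed_variance[OF assms(1)])
qed

lemma linear_vech: "linear (vech :: ('k::{finite,linorder}) rmat \<Rightarrow> _)"
  by (rule linearI) (simp_all add: vech_def vec_eq_iff split_beta)

lemmas bounded_linear_vech = linear_conv_bounded_linear[THEN iffD1, OF linear_vech]

lemma Par_vech: "pos_def \<Sigma> \<Longrightarrow> 0 < \<nu> \<Longrightarrow> (\<mu>, vech \<Sigma>, \<nu>) \<in> Par"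
  by (simp add: Par_def Sig_def unvech_vech pos_def_sym)

lemma sample_law_eq: "t.Pn n \<theta> = sample_law n (fst \<theta>) (Sig \<theta>) (snd (snd \<theta>))"
  by (simp add: t.Pn_def sample_law_def t_P)

lemma sets_sample_space: "sets (\<Pi>\<^sub>M j\<in>I. lborel) = sets (\<Pi>\<^sub>M j\<in>I. borel)"
  by (intro sets_PiM_cong) auto

lemma space_sample_space: "space (\<Pi>\<^sub>M j\<in>I. lborel) = space (\<Pi>\<^sub>M j\<in>I. borel)"
  by (rule sets_eq_imp_space_eq[OF sets_sample_space])

lemma measurable_sample_space: "measurable (\<Pi>\<^sub>M j\<in>I. lborel) N = measurable (\<Pi>\<^sub>M j\<in>I. borel) N"
  by (rule measurable_cong_sets[OF sets_sample_space refl])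

lemma sample_law_perturbed:
  fixes \<mu> t1 :: "'k::{finite,linorder} rvec"
  assumes "transpose \<Sigma> = \<Sigma>" "transpose t2 = t2"
  shows "sample_law n (\<mu> + (1 / sqrt (real n)) *\<^sub>R t1) (\<Sigma> + (1 / sqrt (real n)) *\<^sub>R t2) (\<nu> + t3 / sqrt (real n))
    = t.Pn n ((\<mu>, vech \<Sigma>, \<nu>) + (1 / sqrt (real n)) *\<^sub>R (t1, vech t2, t3))"
  unfolding sample_law_eq by (simp add: Sig_def unvech_add unvech_scaleR unvech_vech assms)

text \<open>\<open>vech\<close> and \<open>unvech\<close> match the symmetric perturbations with all
  vectors of free coordinates. The two centrings agree only for \<open>n > 0\<close>, where
  \<open>sqrt n * (t3 / sqrt n) = t3\<close>.\<close>

lemma regular_with_limit_iff: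
  fixes \<mu> :: "'k::{finite,linorder} rvec"
  assumes "pos_def \<Sigma>"
  shows "regular_with_limit T \<mu> \<Sigma> \<nu> L \<longleftrightarrow> real_distribution L \<and>
    (\<forall>h. weak_conv_m (\<lambda>n. distr (t.Pn n ((\<mu>, vech \<Sigma>, \<nu>) + (1 / sqrt (real n)) *\<^sub>R h)) borel
      (\<lambda>X. sqrt (real n) * (T n X - nuDir \<bullet> (\<mu>, vech \<Sigma>, \<nu>)) - nuDir \<bullet> h)) L)"
    (is "_ \<longleftrightarrow> _ \<and> (\<forall>h. weak_conv_m (?R h) L)")
proof -
  let ?S = "\<lambda>t1 t2 t3 n. distr
    (sample_law n (\<mu> + (1 / sqrt (real n)) *\<^sub>R t1) (\<Sigma> + (1 / sqrt (real n)) *\<^sub>R t2) (\<nu> + t3 / sqrt (real n)))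
    borel (\<lambda>X. sqrt (real n) * (T n X - \<nu> - t3 / sqrt (real n)))"
  have eq: "\<forall>\<^sub>F n in sequentially. ?S t1 t2 t3 n = ?R (t1, vech t2, t3) n" if "transpose t2 = t2" for t1 :: "(real, 'k) vec" and t2 :: "((real, 'k) vec, 'k) vec" and t3 :: real
    using eventually_gt_at_top[of 0]
  proof eventually_elim
    case (elim n)
    show ?case
      unfolding sample_law_perturbed[OF pos_def_sym[OF assms] that]
      using elim by (simp add: nuDir_def right_diff_distrib)
  qed
  have "(\<forall>(t1 :: 'k rvec) (t2 :: 'k rmat) (t3 :: real). transpose t2 = t2 \<longrightarrow> weak_conv_m (?S t1 t2 t3) L) \<longleftrightarrow> (\<forall>h. weak_conv_m (?R h) L)"
  proof (intro iffI allI impI)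
    fix h :: "'k par" assume *: "\<forall>(t1 :: 'k rvec) (t2 :: 'k rmat) (t3 :: real). transpose t2 = t2 \<longrightarrow> weak_conv_m (?S t1 t2 t3) L"
    obtain t1 v t3 where h: "h = (t1, v, t3)" by (cases h)
    have "weak_conv_m (?S t1 (unvech v) t3) L"
      using * unvech_sym by blast
    from weak_conv_m_cong[OF this eq[OF unvech_sym]] show "weak_conv_m (?R h) L"
      unfolding h vech_unvech .
  next
    fix t1 :: "(real, 'k) vec" and t3 :: real and t2 :: "((real, 'k) vec, 'k) vec"
    assume *: "\<forall>h. weak_conv_m (?R h) L" and t2: "transpose t2 = t2"
    have "\<forall>\<^sub>F n in sequentially. ?R (t1, vech t2, t3) n = ?S t1 t2 t3 n"
      using eq[OF t2] by eventually_elim (rule sym)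
    then show "weak_conv_m (?S t1 t2 t3) L"
      by (rule weak_conv_m_cong[OF spec[OF *]])
  qed
  then show ?thesis
    unfolding regular_with_limit_def by (rule arg_cong)
qed

locale t_estimators =
  fixes mu_hat :: "nat \<Rightarrow> (nat \<Rightarrow> ('k::{finite,linorder}) rvec) \<Rightarrow> 'k rvec"
    and Sigma_hat :: "nat \<Rightarrow> (nat \<Rightarrow> 'k rvec) \<Rightarrow> 'k rmat"
    and nu_hat :: "nat \<Rightarrow> (nat \<Rightarrow> 'k rvec) \<Rightarrow> real"
  assumes estimators: "estimator UNIV mu_hat" "estimator {\<Sigma>. pos_def \<Sigma>} Sigma_hat" "estimator {0<..} nu_hat"
    and consistent: "root_n_consistent (\<lambda>\<mu> \<Sigma> \<nu>. \<mu>) mu_hat" "root_n_consistent (\<lambda>\<mu> \<Sigma> \<nu>. \<Sigma>) Sigma_hat"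
      "root_n_consistent (\<lambda>\<mu> \<Sigma> \<nu>. \<nu>) nu_hat"
    and discrete: "loc_asymp_discrete UNIV mu_hat" "loc_asymp_discrete {\<Sigma>. pos_def \<Sigma>} Sigma_hat"
      "loc_asymp_discrete {0<..} nu_hat"
begin

definition est :: "nat \<Rightarrow> (nat \<Rightarrow> 'k rvec) \<Rightarrow> 'k par"
  where "est n X = (mu_hat n X, vech (Sigma_hat n X), nu_hat n X)"

abbreviation "cam \<equiv> nu_cam mu_hat Sigma_hat nu_hat"

lemma est_in_Par:
  assumes "1 \<le> n" "X \<in> space (sample_space n)"
  shows "est n X \<in> Par" and "Sig (est n X) = Sigma_hat n X"
proof -
  have "pos_def (Sigma_hat n X)" "0 < nu_hat n X"
    using estimators(2,3) assms unfolding estimator_def by blast+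
  then show "est n X \<in> Par" "Sig (est n X) = Sigma_hat n X"
    by (simp_all add: est_def Par_vech) (simp add: Sig_def unvech_vech pos_def_sym)
qed

lemma hat_measurable:
  assumes "1 \<le> n"
  shows "mu_hat n \<in> borel_measurable (sample_space n)" "Sigma_hat n \<in> borel_measurable (sample_space n)"
    "nu_hat n \<in> borel_measurable (sample_space n)"
  using estimators assms unfolding estimator_def by blast+

lemma est_measurable: "1 \<le> n \<Longrightarrow> est n \<in> borel_measurable (sample_space n)"
  unfolding est_def[abs_def]
  by (intro borel_measurable_Pair hat_measurable
      measurable_compose[OF hat_measurable(2) borel_measurable_continuous_onI[OF linear_continuous_on[OF bounded_linear_vech]]])

lemma cam_eq:
  assumes "1 \<le> n" "X \<in> space (sample_space n)"
  shows "cam n X = nuDir \<bullet> est n X + (1 / sqrt (real n)) * (inverse (Geff (est n X)) * te.Delta n (est n X) X)"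
  unfolding Delta_eq[OF est_in_Par(1)[OF assms], symmetric] est_in_Par(2)[OF assms] nu_cam_def
  by (simp add: est_def nuDir_def)

text \<open>Continuity of \<open>Geff\<close> and \<open>effDir\<close> is available on
  \<open>Par\<close> only, so the estimate is first viewed as a map into the Borel space restricted
  to \<open>Par\<close>.\<close>

lemma cam_measurable:
  assumes n: "1 \<le> n"
  shows "cam n \<in> borel_measurable (sample_space n)"
proof -
  have "est n \<in> measurable (sample_space n) (restrict_space borel Par)"
    using est_measurable[OF n] est_in_Par(1)[OF n] by (intro measurable_restrict_space2) auto
  note * = measurable_compose[OF this]
  have G: "(\<lambda>X. Geff (est n X)) \<in> borel_measurable (sample_space n)"
    by (rule *[OF borel_measurable_continuous_on_restrict[OF continuous_on_eff(2)]])
  have S: "(\<lambda>X. effDir (est n X) \<bullet> scoreS (est n X) (X j)) \<in> borel_measurable (sample_space n)" if "j < n" for j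
  proof -
    let ?A = "Par \<times> UNIV :: ('k par \<times> 'k rvec) set"
    have c: "continuous_on ?A (\<lambda>z. effDir (fst z) \<bullet> scoreS (fst z) (snd z))"
      by (intro continuous_intros continuous_on_compose2[OF continuous_on_eff(1)]) auto
    have "(\<lambda>X. (est n X, X j)) \<in> borel_measurable (sample_space n)"
      using that by (intro borel_measurable_Pair est_measurable[OF n] measurable_component_singleton) auto
    then have "(\<lambda>X. (est n X, X j)) \<in> measurable (sample_space n) (restrict_space borel ?A)"
      using est_in_Par(1)[OF n] by (intro measurable_restrict_space2) auto
    from measurable_compose[OF this borel_measurable_continuous_on_restrict[OF c]]
    show ?thesis by (simp only: fst_conv snd_conv)
  qed
  have "(\<lambda>X. nuDir \<bullet> est n X + (1 / sqrt (real n)) * (inverse (Geff (est n X)) * te.Delta n (est n X) X))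
      \<in> borel_measurable (sample_space n)"
    unfolding te.Delta_def
    by (intro borel_measurable_add borel_measurable_times borel_measurable_const borel_measurable_inner
        borel_measurable_inverse borel_measurable_sum est_measurable[OF n] G S) auto
  then show ?thesis
    by (subst measurable_cong[OF cam_eq[OF n]])
qed

lemma est_consistent:
  assumes \<theta>: "\<theta> \<in> Par" and \<epsilon>: "0 < \<epsilon>"
  shows "\<exists>C. \<forall>\<^sub>F n in sequentially.
    measure (t.Pn n \<theta>) {X \<in> space (t.Pn n \<theta>). C < norm (sqrt (real n) *\<^sub>R (est n X - \<theta>))} \<le> \<epsilon>"
proof -
  obtain \<mu> v \<nu> where t: "\<theta> = (\<mu>, v, \<nu>)" by (cases \<theta>)
  define \<Sigma> where "\<Sigma> = Sig \<theta>"
  have v: "v = vech \<Sigma>" by (simp add: \<Sigma>_def Sig_def t vech_unvech)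
  have law: "sample_law n \<mu> \<Sigma> \<nu> = t.Pn n \<theta>" for n
    by (simp add: sample_law_eq t \<Sigma>_def)
  have p: "pos_def \<Sigma>" "0 < \<nu>" using Par_D[OF \<theta>] by (simp_all add: \<Sigma>_def t)
  let ?B = "\<lambda>n C Y. {X \<in> space (t.Pn n \<theta>). C < norm (sqrt (real n) *\<^sub>R Y n X)}"
  define Y1 where "Y1 n X = mu_hat n X - \<mu>" for n X
  define Y2 where "Y2 n X = Sigma_hat n X - \<Sigma>" for n X
  define Y3 where "Y3 n X = nu_hat n X - \<nu>" for n X
  have e3: "0 < \<epsilon> / 3" using \<epsilon> by simp
  obtain C1 where C1: "\<forall>\<^sub>F n in sequentially. measure (t.Pn n \<theta>) (?B n C1 Y1) \<le> \<epsilon> / 3"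
    using consistent(1) p e3 unfolding root_n_consistent_def Y1_def law[symmetric] by blast
  obtain C2 where C2: "\<forall>\<^sub>F n in sequentially. measure (t.Pn n \<theta>) (?B n C2 Y2) \<le> \<epsilon> / 3"
    using consistent(2) p e3 unfolding root_n_consistent_def Y2_def law[symmetric] by blast
  obtain C3 where C3: "\<forall>\<^sub>F n in sequentially. measure (t.Pn n \<theta>) (?B n C3 Y3) \<le> \<epsilon> / 3"
    using consistent(3) p e3 unfolding root_n_consistent_def Y3_def law[symmetric] by blast
  obtain K where K: "0 < K" "\<And>A. norm (vech (A :: 'k rmat)) \<le> norm A * K"
    using bounded_linear.pos_bounded[OF bounded_linear_vech] by blast
  interpret P: prob_space "t.Pn n \<theta>" for n by (rule t.prob_space_Pn[OF \<theta>])
  \<comment> \<open>The norm of the triple is at most the sum of the three norms, and passing to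
    \<open>vech\<close> costs the factor \<open>K\<close>.\<close>
  have sub: "?B n (C1 + C2 * K + C3) (\<lambda>n X. est n X - \<theta>) \<subseteq> (?B n C1 Y1 \<union> ?B n C2 Y2) \<union> ?B n C3 Y3" for n
  proof
    fix X assume X: "X \<in> ?B n (C1 + C2 * K + C3) (\<lambda>n X. est n X - \<theta>)"
    have "sqrt (real n) *\<^sub>R (est n X - \<theta>)
        = (sqrt (real n) *\<^sub>R Y1 n X, vech (sqrt (real n) *\<^sub>R Y2 n X), sqrt (real n) *\<^sub>R Y3 n X)"
      by (simp add: est_def t v Y1_def Y2_def Y3_def linear_scale[OF linear_vech] linear_diff[OF linear_vech])
    then have "norm (sqrt (real n) *\<^sub>R (est n X - \<theta>))
        \<le> norm (sqrt (real n) *\<^sub>R Y1 n X) + (norm (vech (sqrt (real n) *\<^sub>R Y2 n X)) + norm (sqrt (real n) *\<^sub>R Y3 n X))"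
      by (simp only:) (rule order_trans[OF norm_Pair_le add_left_mono[OF norm_Pair_le]])
    also have "\<dots> \<le> norm (sqrt (real n) *\<^sub>R Y1 n X) + (norm (sqrt (real n) *\<^sub>R Y2 n X) * K + norm (sqrt (real n) *\<^sub>R Y3 n X))"
      by (intro add_mono K order_refl)
    finally have "C1 + C2 * K + C3 < \<dots>"
      using X by auto
    moreover have "norm (sqrt (real n) *\<^sub>R Y2 n X) * K \<le> C2 * K" if "norm (sqrt (real n) *\<^sub>R Y2 n X) \<le> C2"
      using that K by (intro mult_right_mono) auto
    ultimately have "C1 < norm (sqrt (real n) *\<^sub>R Y1 n X) \<or> C2 < norm (sqrt (real n) *\<^sub>R Y2 n X)
        \<or> C3 < norm (sqrt (real n) *\<^sub>R Y3 n X)"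
      by linarith
    then show "X \<in> (?B n C1 Y1 \<union> ?B n C2 Y2) \<union> ?B n C3 Y3"
      using X by blast
  qed
  have sets: "?B n C1 Y1 \<in> sets (t.Pn n \<theta>)" "?B n C2 Y2 \<in> sets (t.Pn n \<theta>)" "?B n C3 Y3 \<in> sets (t.Pn n \<theta>)"
    if "1 \<le> n" for n
  proof -
    have m: "measurable (t.Pn n \<theta>) borel = measurable (sample_space n) borel"
      by (rule measurable_cong_sets[OF t.sets_Pn[unfolded sets_sample_space] refl])
    have "Y1 n \<in> borel_measurable (t.Pn n \<theta>)" "Y2 n \<in> borel_measurable (t.Pn n \<theta>)" "Y3 n \<in> borel_measurable (t.Pn n \<theta>)"
      unfolding m Y1_def[abs_def] Y2_def[abs_def] Y3_def[abs_def]
      by (intro borel_measurable_diff hat_measurable[OF that] borel_measurable_const)+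
    then show "?B n C1 Y1 \<in> sets (t.Pn n \<theta>)" "?B n C2 Y2 \<in> sets (t.Pn n \<theta>)" "?B n C3 Y3 \<in> sets (t.Pn n \<theta>)"
      by measurable
  qed
  have "\<forall>\<^sub>F n in sequentially. measure (t.Pn n \<theta>) (?B n (C1 + C2 * K + C3) (\<lambda>n X. est n X - \<theta>)) \<le> \<epsilon>"
    using C1 C2 C3 eventually_ge_at_top[of 1]
  proof eventually_elim
    case (elim n)
    have "measure (t.Pn n \<theta>) (?B n (C1 + C2 * K + C3) (\<lambda>n X. est n X - \<theta>))
        \<le> measure (t.Pn n \<theta>) ((?B n C1 Y1 \<union> ?B n C2 Y2) \<union> ?B n C3 Y3)"
      using sub sets[OF elim(4)] by (intro P.finite_measure_mono sets.Un)
    also have "\<dots> \<le> measure (t.Pn n \<theta>) (?B n C1 Y1 \<union> ?B n C2 Y2) + measure (t.Pn n \<theta>) (?B n C3 Y3)"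
      using sets[OF elim(4)] by (intro measure_Un_le sets.Un)
    also have "measure (t.Pn n \<theta>) (?B n C1 Y1 \<union> ?B n C2 Y2)
        \<le> measure (t.Pn n \<theta>) (?B n C1 Y1) + measure (t.Pn n \<theta>) (?B n C2 Y2)"
      using sets[OF elim(4)] by (intro measure_Un_le)
    finally show ?case
      using elim by linarith
  qed
  then show ?thesis by blast
qed

text \<open>A ball in parameter space projects into balls for the three components, for
  \<open>\<Sigma>\<close> with the radius multiplied by the bound \<open>K\<close> of
  \<open>unvech\<close>. The values of \<open>est\<close> therefore come from a product of three
  finite sets of bounded size.\<close>

lemma est_discrete:
  assumes \<theta>: "\<theta> \<in> Par" and c: "0 < c"
  shows "\<exists>N. \<forall>\<^sub>F n in sequentially.
    finite (est n ` space (sample_space n) \<inter> ball \<theta> (c / sqrt (real n))) \<and>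
    card (est n ` space (sample_space n) \<inter> ball \<theta> (c / sqrt (real n))) \<le> N"
proof -
  obtain \<mu> v \<nu> where t: "\<theta> = (\<mu>, v, \<nu>)" by (cases \<theta>)
  define \<Sigma> where "\<Sigma> = Sig \<theta>"
  have p: "\<Sigma> \<in> {\<Sigma>. pos_def \<Sigma>}" "\<nu> \<in> {0<..}" using Par_D[OF \<theta>] by (simp_all add: \<Sigma>_def t)
  obtain K where K: "0 < K" "\<And>w. norm (unvech w :: 'k rmat) \<le> norm w * K"
    using bounded_linear.pos_bounded[OF bounded_linear_unvech] by blast
  have cK: "0 < c * K" using c K by simp
  let ?E1 = "\<lambda>n. mu_hat n ` space (sample_space n) \<inter> ball \<mu> (c / sqrt (real n))"
  let ?E2 = "\<lambda>n. Sigma_hat n ` space (sample_space n) \<inter> ball \<Sigma> (c * K / sqrt (real n))"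
  let ?E3 = "\<lambda>n. nu_hat n ` space (sample_space n) \<inter> ball \<nu> (c / sqrt (real n))"
  let ?E = "\<lambda>n. est n ` space (sample_space n) \<inter> ball \<theta> (c / sqrt (real n))"
  obtain N1 where N1: "\<forall>\<^sub>F n in sequentially. finite (?E1 n) \<and> card (?E1 n) \<le> N1"
    using discrete(1) c unfolding loc_asymp_discrete_def by blast
  obtain N2 where N2: "\<forall>\<^sub>F n in sequentially. finite (?E2 n) \<and> card (?E2 n) \<le> N2"
    using discrete(2) p(1) cK unfolding loc_asymp_discrete_def by blast
  obtain N3 where N3: "\<forall>\<^sub>F n in sequentially. finite (?E3 n) \<and> card (?E3 n) \<le> N3"
    using discrete(3) p(2) c unfolding loc_asymp_discrete_def by blast
  let ?g = "\<lambda>(m, S, s). (m, vech S, s)"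
  have "\<forall>\<^sub>F n in sequentially. finite (?E n) \<and> card (?E n) \<le> N1 * (N2 * N3)"
    using N1 N2 N3 eventually_ge_at_top[of 1]
  proof eventually_elim
    case (elim n)
    have sub: "?E n \<subseteq> ?g ` (?E1 n \<times> ?E2 n \<times> ?E3 n)"
    proof
      fix \<theta>' assume "\<theta>' \<in> ?E n"
      then obtain X where X: "X \<in> space (sample_space n)" and eq: "\<theta>' = est n X"
        and d: "dist \<theta> (est n X) < c / sqrt (real n)" by auto
      have "dist (fst \<theta>) (fst (est n X)) < c / sqrt (real n)"
        using dist_fst_le[of \<theta> "est n X"] d by linarith
      then have 1: "mu_hat n X \<in> ?E1 n"
        using X by (simp add: est_def t)
      have "dist (snd (snd \<theta>)) (snd (snd (est n X))) < c / sqrt (real n)"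
        using dist_snd_le[of \<theta> "est n X"] dist_snd_le[of "snd \<theta>" "snd (est n X)"] d by linarith
      then have 3: "nu_hat n X \<in> ?E3 n"
        using X by (simp add: est_def t)
      have "dist (fst (snd \<theta>)) (fst (snd (est n X))) < c / sqrt (real n)"
        using dist_snd_le[of \<theta> "est n X"] dist_fst_le[of "snd \<theta>" "snd (est n X)"] d by linarith
      then have "norm (fst (snd \<theta>) - fst (snd (est n X))) * K < c / sqrt (real n) * K"
        unfolding dist_norm by (rule mult_strict_right_mono) (rule K(1))
      moreover have "\<Sigma> - Sigma_hat n X = unvech (fst (snd \<theta>) - fst (snd (est n X)))"
        using est_in_Par(2)[OF elim(4) X] by (simp add: unvech_diff \<Sigma>_def Sig_def)
      ultimately have "dist \<Sigma> (Sigma_hat n X) < c * K / sqrt (real n)"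
        using K(2)[of "fst (snd \<theta>) - fst (snd (est n X))"] by (simp add: dist_norm)
      then have 2: "Sigma_hat n X \<in> ?E2 n"
        using X by simp
      show "\<theta>' \<in> ?g ` (?E1 n \<times> ?E2 n \<times> ?E3 n)"
        by (rule image_eqI[of _ _ "(mu_hat n X, Sigma_hat n X, nu_hat n X)"]) (use 1 2 3 in \<open>simp_all add: eq est_def\<close>)
    qed
    have fin: "finite (?E1 n \<times> ?E2 n \<times> ?E3 n)"
      using elim by (intro finite_cartesian_product) blast+
    have "card (?E n) \<le> card (?E1 n \<times> ?E2 n \<times> ?E3 n)"
      by (rule surj_card_le[OF fin sub])
    also have "\<dots> \<le> N1 * (N2 * N3)"
      unfolding card_cartesian_product using elim by (intro mult_le_mono) blast+
    finally show ?case
      using finite_subset[OF sub finite_imageI[OF fin]] by blast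
  qed
  then show ?thesis by blast
qed

lemma one_step_t: "one_step lborel Par dens scoreS nuDir effDir Geff est cam"
proof (rule one_step.intro[OF te.efficient_model_axioms one_step_axioms.intro], unfold measurable_sample_space space_sample_space)
qed (fact est_measurable est_in_Par(1) est_consistent est_discrete cam_measurable cam_eq)+

lemma cam_regular:
  assumes "pos_def \<Sigma>" "0 < \<nu>"
  shows "regular_with_limit cam \<mu> \<Sigma> \<nu>
    (density lborel (\<lambda>y. ennreal (normal_density 0 (sqrt (inverse (eff_fisher33 \<mu> \<Sigma> \<nu>))) y)))"
proof -
  interpret o: one_step lborel Par dens scoreS nuDir effDir Geff est cam
    by (rule one_step_t)
  have \<theta>: "(\<mu>, vech \<Sigma>, \<nu>) \<in> Par" by (rule Par_vech[OF assms])
  have G: "Geff (\<mu>, vech \<Sigma>, \<nu>) = eff_fisher33 \<mu> \<Sigma> \<nu>"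
    by (simp add: Sig_def unvech_vech pos_def_sym assms)
  show ?thesis
    unfolding regular_with_limit_iff[OF assms(1)]
    using o.one_step_regular[OF \<theta>] Geff_pos[OF \<theta>] unfolding G
    by (auto intro!: real_distribution_normal_density)
qed

end

theorem theorem3:
  fixes mu_hat :: "nat \<Rightarrow> (nat \<Rightarrow> ('k::{finite,linorder}) rvec) \<Rightarrow> 'k rvec"
    and Sigma_hat :: "nat \<Rightarrow> (nat \<Rightarrow> 'k rvec) \<Rightarrow> 'k rmat"
    and nu_hat :: "nat \<Rightarrow> (nat \<Rightarrow> 'k rvec) \<Rightarrow> real"
  assumes "estimator UNIV mu_hat"
    and "estimator {\<Sigma>. pos_def \<Sigma>} Sigma_hat"
    and "estimator {0<..} nu_hat"
    and "root_n_consistent (\<lambda>\<mu> \<Sigma> \<nu>. \<mu>) mu_hat"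
    and "root_n_consistent (\<lambda>\<mu> \<Sigma> \<nu>. \<Sigma>) Sigma_hat"
    and "root_n_consistent (\<lambda>\<mu> \<Sigma> \<nu>. \<nu>) nu_hat"
    and "loc_asymp_discrete UNIV mu_hat"
    and "loc_asymp_discrete {\<Sigma>. pos_def \<Sigma>} Sigma_hat"
    and "loc_asymp_discrete {0<..} nu_hat"
  shows "(\<forall>\<mu> \<Sigma> \<nu>. pos_def \<Sigma> \<and> 0 < \<nu> \<longrightarrow>
            weak_conv_m
              (\<lambda>n. distr (sample_law n \<mu> \<Sigma> \<nu>) borel
                     (\<lambda>X. sqrt (real n) * (nu_cam mu_hat Sigma_hat nu_hat n X - \<nu>)))
              (density lborel
                (\<lambda>y. ennreal (normal_density 0 (sqrt (inverse (eff_fisher33 \<mu> \<Sigma> \<nu>))) y)))) \<and>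
         most_efficient (nu_cam mu_hat Sigma_hat nu_hat)"
proof -
  interpret t_estimators mu_hat Sigma_hat nu_hat
    by (rule t_estimators.intro) fact+
  let ?L = "\<lambda>\<mu> \<Sigma> \<nu>. density lborel (\<lambda>y. ennreal (normal_density 0 (sqrt (inverse (eff_fisher33 \<mu> \<Sigma> \<nu>))) y))"
  have pos: "0 < eff_fisher33 \<mu> \<Sigma> \<nu>" if "pos_def \<Sigma>" "0 < \<nu>" for \<mu> :: "'k rvec" and \<Sigma> \<nu>
    using Geff_pos[OF Par_vech[OF that]] that by (simp add: Sig_def unvech_vech pos_def_sym)
  \<comment> \<open>Convergence under the fixed law is regularity in the direction zero.\<close>
  have conv: "weak_conv_m (\<lambda>n. distr (sample_law n \<mu> \<Sigma> \<nu>) borel (\<lambda>X. sqrt (real n) * (cam n X - \<nu>))) (?L \<mu> \<Sigma> \<nu>)"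
    if "pos_def \<Sigma>" "0 < \<nu>" for \<mu> \<Sigma> \<nu>
  proof -
    have "transpose 0 = (0 :: 'k rmat)" by (simp add: transpose_def vec_eq_iff)
    with cam_regular[OF that, of \<mu>, unfolded regular_with_limit_def, THEN conjunct2, rule_format, of 0 0 0]
    show ?thesis by simp
  qed
  have attained: "regular_with_limit cam \<mu> \<Sigma> \<nu> (?L \<mu> \<Sigma> \<nu>) \<and> integrable (?L \<mu> \<Sigma> \<nu>) (\<lambda>y. y\<^sup>2) \<and>
      prob_space.variance (?L \<mu> \<Sigma> \<nu>) (\<lambda>y. y) = inverse (eff_fisher33 \<mu> \<Sigma> \<nu>)"
    if "pos_def \<Sigma>" "0 < \<nu>" for \<mu> \<Sigma> \<nu>
    using cam_regular[OF that, of \<mu>] normal_density_second_moment[of "sqrt (inverse (eff_fisher33 \<mu> \<Sigma> \<nu>))"] pos[OF that, of \<mu>]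
    by (simp only: real_sqrt_gt_0_iff positive_imp_inverse_positive real_sqrt_pow2 less_imp_le)
  have bound: "inverse (eff_fisher33 \<mu> \<Sigma> \<nu>) \<le> prob_space.variance L' (\<lambda>y. y)"
    if p: "pos_def \<Sigma>" "0 < \<nu>" and T': "estimator UNIV T'" and R: "regular_with_limit T' \<mu> \<Sigma> \<nu> L'"
      and L': "integrable L' (\<lambda>y. y\<^sup>2)"
    for \<mu> :: "'k rvec" and \<Sigma> \<nu> T' L'
  proof -
    have G: "Geff (\<mu>, vech \<Sigma>, \<nu>) = eff_fisher33 \<mu> \<Sigma> \<nu>"
      by (simp add: Sig_def unvech_vech pos_def_sym p)
    show ?thesis
      unfolding G[symmetric]
    proof (rule te.regular_variance_bound[OF Par_vech[OF p] _ _ L'])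
      show "T' n \<in> borel_measurable (\<Pi>\<^sub>M j\<in>{..<n}. lborel)" if "1 \<le> n" for n
        unfolding measurable_sample_space using T' that unfolding estimator_def by blast
    qed (use R in \<open>simp_all only: regular_with_limit_iff[OF p(1)]\<close>)
  qed
  have "estimator UNIV cam"
    using cam_measurable by (simp add: estimator_def)
  then have "most_efficient cam"
    unfolding most_efficient_def using attained bound by blast
  with conv show ?thesis by blast
qed

end
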